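(* Let $q\ge 1$ and $1\le p\le q$ be integers, and let $f$ be an exponential polynomial of order $q$ in the normalized form $f(z)=H_0(z)e^{w_0z^q}+H_1(z)e^{w_1z^q}+\cdots+H_m(z)e^{w_mz^q}$, where the coefficients $H_j$ are exponential polynomials of order $\rho(H_j)\le q-p$. Let $c>0$ be sufficiently large (depending on $f$). Then the number $n_{\lambda_p}(r)$ of zeros of $f$ in $|z|\le r$ lying outside of the union of the finitely many domains $\Lambda_p(\theta^*,c)$, where $\theta^*$ runs through the critical angles of $f$, satisfies $$n_{\lambda_p}(r)=O\left(r^{q-p}+\log r\right)\quad (r\to\infty).$$ Moreover, let $\overline{w}_j,\overline{w}_k$ be two consecutive vertex points of $\operatorname{co}(W_f)$, and let $\theta_0^\bot$ denote the argument of the ray parallel to the outer normal of $\operatorname{co}(W_f)$ corresponding to its side $[\overline{w}_j,\overline{w}_k]$. Let $\varepsilon>0$, and let $\theta^*$ be any critical angle for $f$ associated with $\theta_0^\bot$, i.e. $\theta^*=(\theta_0^\bot+2\pi n)/q$ for some $n\in\mathbb{Z}$. Then the number $n(r,\Lambda_p)$ of zeros of $f$ in $\Lambda_p(\theta^*,c)\cap\{|z|<r\}$ satisfies $$n(r,\Lambda_p)=|w_j-w_k|\frac{r^q}{2\pi}+O\left(r^{q-p}\log^{3+\varepsilon}r\right)\quad (r\to\infty).$$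
   Context: An exponential polynomial is an entire function $P_0e^{Q_0}+\cdots+P_ne^{Q_n}$ with polynomials $P_j,Q_j$; the $Q_j$ are taken pairwise different with $Q_j(0)=0$, and the order is $\max_j\deg Q_j$. Ordinary polynomials are exponential polynomials of order $0$. Every exponential polynomial of order $q\ge1$ can be written in the normalized form $f(z)=\sum_{j=0}^m H_j(z)e^{w_jz^q}$, where $w_0=0$, the leading coefficients $w_0,\ldots,w_m\in\mathbb{C}$ are pairwise distinct (so $w_j\ne0$ for $j\ge1$), $H_1,\ldots,H_m\not\equiv0$, possibly $H_0\equiv 0$, and the $H_j$ are exponential polynomials of order $\le q-p$ for some integer $1\le p\le q$ (if $p=q$ the $H_j$ are ordinary polynomials). $W_f=\{\overline{w}_0=0,\overline{w}_1,\ldots,\overline{w}_m\}$ if $H_0\not\equiv0$, and $W_f=\{\overline{w}_1,\ldots,\overline{w}_m\}$ if $H_0\equiv0$. $\operatorname{co}(W_f)$ is its convex hull; when this is a nondegenerate segment, it is regarded as a polygon with two vertices and two (coinciding) sides having opposite outer normals. Critical angles $\theta^*$ of $f$: the angles at which the indicator $h_f(\theta)=\max_j \Re(w_je^{iq\theta})$ (the maximum being over those $j$ with $H_j\not\equiv 0$) is not differentiable. Equivalently, they are the angles $(\theta^\bot+2\pi n)/q$, $n\in\mathbb{Z}$, where $\theta^\bot$ runs through the arguments of the outer normals of the sides of $\operatorname{co}(W_f)$. There are finitely many modulo $2\pi$. Modified logarithmic strip: $\Lambda_p(\theta^*,c)=\{z=re^{i\theta}: r>1,\ |\arg(z)-\theta^*|<c\,\frac{\log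 r}{r^p}\}$. Zeros are counted with multiplicity. *)

theory Defs
  imports "HOL-Complex_Analysis.Complex_Analysis" "HOL-Library.Landau_Symbols"
begin

(* Requiring P j to be nonzero unless Q j = 0 makes the order independent of the representation,
   while the zero function (n = 0, P 0 = Q 0 = 0) still has order 0. *)
definition exp_poly_has_order :: "(complex \<Rightarrow> complex) \<Rightarrow> nat \<Rightarrow> bool" where
  "exp_poly_has_order f d \<longleftrightarrow>
     (\<exists>(n::nat) (P :: nat \<Rightarrow> complex poly) (Q :: nat \<Rightarrow> complex poly).
        inj_on Q {..n} \<and>
        (\<forall>j\<le>n. poly (Q j) 0 = 0) \<and>
        (\<forall>j\<le>n. P j = 0 \<longrightarrow> Q j = 0) \<and>
        (\<forall>z. f z = (\<Sum>j\<le>n. poly (P j) z * exp (poly (Q j) z))) \<and>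
        d = Max ((\<lambda>j. degree (Q j)) ` {..n}))"

definition exp_poly_order_le :: "(complex \<Rightarrow> complex) \<Rightarrow> nat \<Rightarrow> bool" where
  "exp_poly_order_le f d \<longleftrightarrow> (\<exists>d'\<le>d. exp_poly_has_order f d')"

definition active_indices :: "nat \<Rightarrow> (nat \<Rightarrow> complex \<Rightarrow> complex) \<Rightarrow> nat set" where
  "active_indices m H = {j. j \<le> m \<and> (\<exists>z. H j z \<noteq> 0)}"

definition conj_coeffs ::
  "nat \<Rightarrow> (nat \<Rightarrow> complex) \<Rightarrow> (nat \<Rightarrow> complex \<Rightarrow> complex) \<Rightarrow> complex set" where
  "conj_coeffs m w H = (\<lambda>j. cnj (w j)) ` active_indices m H"

definition indicator_fun ::
  "nat \<Rightarrow> nat \<Rightarrow> (nat \<Rightarrow> complex) \<Rightarrow> (nat \<Rightarrow> complex \<Rightarrow> complex) \<Rightarrow> real \<Rightarrow> real" where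
  "indicator_fun q m w H \<theta> = Max ((\<lambda>j. Re (w j * cis (real q * \<theta>))) ` active_indices m H)"

definition critical_angle ::
  "nat \<Rightarrow> nat \<Rightarrow> (nat \<Rightarrow> complex) \<Rightarrow> (nat \<Rightarrow> complex \<Rightarrow> complex) \<Rightarrow> real \<Rightarrow> bool" where
  "critical_angle q m w H \<theta> \<longleftrightarrow> \<not> (indicator_fun q m w H) differentiable (at \<theta>)"

(* The argument is multivalued: z lies in the strip if some value of arg z satisfies the
   inequality, so the strip depends on the angle \<phi> only modulo 2 pi. *)
definition log_strip :: "nat \<Rightarrow> real \<Rightarrow> real \<Rightarrow> complex set" where
  "log_strip p \<phi> c =
     {z. \<exists>r \<theta>. z = of_real r * cis \<theta> \<and> r > 1 \<and> \<bar>\<theta> - \<phi>\<bar> < c * (ln r / r ^ p)}"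

(* Zeros of f in A with multiplicity; intended for f entire, not identically zero, and A bounded,
   so that the sum is finite and zorder is the usual multiplicity. *)
definition zero_count :: "(complex \<Rightarrow> complex) \<Rightarrow> complex set \<Rightarrow> int" where
  "zero_count f A = (\<Sum>z\<in>{z\<in>A. f z = 0}. zorder f z)"

definition consecutive_vertices :: "complex set \<Rightarrow> complex \<Rightarrow> complex \<Rightarrow> bool" where
  "consecutive_vertices K a b \<longleftrightarrow>
     a extreme_point_of K \<and> b extreme_point_of K \<and> closed_segment a b edge_of K"

(* The direction cis \<theta> is orthogonal to the side [a, b] and K lies on its non-positive side.
   If K is the segment [a, b] itself (an improper face, hence an edge), both normal directions
   qualify, which is the convention of two coinciding sides with opposite outer normals. *)
definition outer_normal_arg :: "complex set \<Rightarrow> complex \<Rightarrow> complex \<Rightarrow> real \<Rightarrow> bool" where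
  "outer_normal_arg K a b \<theta> \<longleftrightarrow>
     (b - a) \<bullet> cis \<theta> = 0 \<and> (\<forall>x\<in>K. (x - a) \<bullet> cis \<theta> \<le> 0)"

end

theory Submission
  imports Defs
begin

text \<open>
  Put \<open>z = exp s\<close> and cut the \<open>s\<close>-plane into blocks \<open>X \<le> Re s \<le> X + 1\<close>; strips become rectangles of
  height comparable to \<open>X exp (- p X)\<close>. Write \<open>d = q - p\<close>. By a Jensen-type factorization each coefficient
  \<open>H\<^sub>j (exp s)\<close> is, on a disc of fixed radius, a product over \<open>O (exp (d X))\<close> zeros times the exponential
  of a function whose oscillation is \<open>O (exp (d X))\<close>. Hence a pigeonhole argument finds horizontal and
  vertical lines on which \<open>H\<^sub>j\<close> is at least \<open>exp (- O (X exp (d X)))\<close>, and the argument of \<open>H\<^sub>j\<close> varies along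
  them by \<open>O (exp (d X))\<close> only. Away from a critical ray, at distance at least a large multiple of
  \<open>X exp (- p X)\<close>, a single term \<open>H\<^sub>j exp (w\<^sub>j z^q)\<close> beats all the others on such lines.

  The argument principle then gives both estimates. For a rectangle in which one term dominates on all four
  sides the contributions of \<open>exp (w\<^sub>j z^q)\<close> cancel, which leaves \<open>O (exp (d X))\<close> zeros. For a rectangle
  around a critical ray the horizontal sides are governed by the two extreme terms and produce the main
  term, while the short vertical sides contribute \<open>O (X exp (d X))\<close> by the factorization on a disc of radius
  comparable to the height. Summing over the blocks yields the theorem, with an error term
  \<open>O (r^d log\<^sup>2 r)\<close> in the strips.
\<close>

subsection \<open>Factorization of entire functions on discs\<close>

text \<open>The strip width comes from a balance. The coefficients may vanish, so a lower bound
  \<open>exp (- O (X * growth X))\<close> is available only along well chosen lines, while two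
  competing exponentials at distance t from a critical ray differ by a factor whose logarithm has
  size about \<open>exp (q * X) * t\<close>. The two sizes match when t is a multiple of
  \<open>X * exp (- p * X)\<close>. The extra factor X is the price of passing close to zeros of a
  coefficient. It does not affect the argument: a zero, however close, turns the argument along a
  segment by at most pi, so only the number of zeros and the oscillation of the remaining exponent
  count. This yields \<open>growth X\<close> instead of \<open>X * growth X\<close> per block
  outside the strips. It requires factorization data without the factor X even when d = 0, where a
  coefficient is a polynomial of size r^k; hence that power is split off first. On the vertical
  sides across a critical ray several terms compete and a factor X is lost per block. The additive
  log r outside the strips comes from d = 0, where each of about log r blocks contributes a bounded
  number of zeros. The local thresholds depend on the angle; compactness of the circle makes a
  single c suffice.\<close>

lemma entire_factor_zero:
  fixes F :: "complex \<Rightarrow> complex"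
  assumes F: "F holomorphic_on UNIV" and nz: "\<exists>s. F s \<noteq> 0"
  obtains E where "E holomorphic_on UNIV" "\<And>s. F s = (s - \<zeta>) ^ nat (zorder F \<zeta>) * E s" "E \<zeta> \<noteq> 0"
proof -
  define n where "n = nat (zorder F \<zeta>)"
  obtain r where r: "r > 0" "zor_poly F \<zeta> holomorphic_on cball \<zeta> r"
    "\<And>s. s \<in> cball \<zeta> r \<Longrightarrow> F s = zor_poly F \<zeta> s * (s - \<zeta>) ^ n \<and> zor_poly F \<zeta> s \<noteq> 0"
    using zorder_exist_zero[OF F open_UNIV connected_UNIV UNIV_I, of \<zeta>] nz unfolding n_def by blast
  \<comment> \<open>The quotient with its removable singularity filled in: near \<zeta> it coincides
    with \<open>zor_poly\<close>, elsewhere it is visibly holomorphic.\<close>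
  define E where "E s = (if s = \<zeta> then zor_poly F \<zeta> \<zeta> else F s / (s - \<zeta>) ^ n)" for s
  have E1: "E s = zor_poly F \<zeta> s" if "s \<in> ball \<zeta> r" for s
    using r(3)[of s] that by (auto simp: E_def)
  have "E holomorphic_on ball \<zeta> r"
    using holomorphic_on_subset[OF r(2) ball_subset_cball] by (subst holomorphic_cong[OF refl E1]) auto
  moreover have "E holomorphic_on - {\<zeta>}"
  proof -
    have "(\<lambda>s. F s / (s - \<zeta>) ^ n) holomorphic_on - {\<zeta>}"
      by (intro holomorphic_intros holomorphic_on_subset[OF F]) auto
    thus ?thesis by (subst holomorphic_cong[OF refl, where g = "\<lambda>s. F s / (s - \<zeta>) ^ n"]) (auto simp: E_def)
  qed
  ultimately have "E holomorphic_on (ball \<zeta> r \<union> - {\<zeta>})"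
    by (intro holomorphic_on_Un) auto
  moreover have "ball \<zeta> r \<union> - {\<zeta>} = UNIV" using r(1) by auto
  ultimately have "E holomorphic_on UNIV" by simp
  moreover have "F s = (s - \<zeta>) ^ n * E s" for s
    using r(1) r(3)[of \<zeta>] by (cases "s = \<zeta>") (auto simp: E_def)
  moreover have "E \<zeta> \<noteq> 0" using r(1) r(3)[of \<zeta>] by (auto simp: E_def)
  ultimately show ?thesis using that unfolding n_def by blast
qed

lemma entire_factor_finite:
  fixes F :: "complex \<Rightarrow> complex"
  assumes F: "F holomorphic_on UNIV" and nz: "\<exists>s. F s \<noteq> 0" and fin: "finite Z"
  obtains E where "E holomorphic_on UNIV"
    "\<And>s. F s = (\<Prod>\<zeta>\<in>Z. (s - \<zeta>) ^ nat (zorder F \<zeta>)) * E s" "\<And>\<zeta>. \<zeta> \<in> Z \<Longrightarrow> E \<zeta> \<noteq> 0"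
  using fin
proof (induction Z arbitrary: thesis)
  case empty
  show ?case by (rule empty[of F]) (use F in auto)
next
  case (insert \<xi> Z)
  obtain E where E: "E holomorphic_on UNIV"
    "\<And>s. F s = (\<Prod>\<zeta>\<in>Z. (s - \<zeta>) ^ nat (zorder F \<zeta>)) * E s" "\<And>\<zeta>. \<zeta> \<in> Z \<Longrightarrow> E \<zeta> \<noteq> 0"
    using insert.IH by blast
  have nzE: "\<exists>s. E s \<noteq> 0" using nz E(2) by auto
  define P where "P s = (\<Prod>\<zeta>\<in>Z. (s - \<zeta>) ^ nat (zorder F \<zeta>))" for s
  have P: "P holomorphic_on UNIV" unfolding P_def by (intro holomorphic_intros)
  have P0: "P \<xi> \<noteq> 0" unfolding P_def using insert.hyps by auto
  \<comment> \<open>The factors already split off do not vanish at \<xi>, so the cofactor carries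
    the full multiplicity there.\<close>
  have "zorder F \<xi> = zorder E \<xi>"
  proof -
    have "F = (\<lambda>s. P s * E s)" using E(2) unfolding P_def by auto
    moreover obtain s0 where s0: "F s0 \<noteq> 0" using nz by blast
    have ev: "\<forall>\<^sub>F s in at \<xi>. F s \<noteq> 0"
      using non_zero_neighbour_alt[OF F open_UNIV connected_UNIV UNIV_I UNIV_I s0] by (auto elim: eventually_mono)
    ultimately have "zorder F \<xi> = zorder P \<xi> + zorder E \<xi>"
      using ev holomorphic_on_imp_analytic_at[OF P open_UNIV] holomorphic_on_imp_analytic_at[OF E(1) open_UNIV]
      by (auto intro!: zorder_times_analytic)
    moreover have "zorder P \<xi> = 0"
      using P P0 by (intro zorder_eq_0I holomorphic_on_imp_analytic_at[OF P open_UNIV]) auto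
    ultimately show ?thesis by simp
  qed
  moreover obtain E' where E': "E' holomorphic_on UNIV"
    "\<And>s. E s = (s - \<xi>) ^ nat (zorder E \<xi>) * E' s" "E' \<xi> \<noteq> 0"
    using entire_factor_zero[OF E(1) nzE] by blast
  ultimately have FE: "F s = (\<Prod>\<zeta>\<in>insert \<xi> Z. (s - \<zeta>) ^ nat (zorder F \<zeta>)) * E' s" for s
    using insert.hyps unfolding E(2)[of s] E'(2)[of s] by simp
  have "E' \<zeta> \<noteq> 0" if "\<zeta> \<in> insert \<xi> Z" for \<zeta>
    using that E' E(3)[of \<zeta>] by auto
  from insert.prems[OF E'(1) FE this] show ?case .
qed

text \<open>The map u / (2A - u) sends the half-plane Re u < A into the unit disc and fixes 0. The
  Schwarz lemma applied to its composition with h, rescaled to the unit disc, gives the bound after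
  solving for |u|.\<close>

lemma borel_caratheodory:
  fixes h :: "complex \<Rightarrow> complex"
  assumes h: "h holomorphic_on ball a R" and h0: "h a = 0" and R: "0 < r" "r < R"
    and Re: "\<And>s. s \<in> ball a R \<Longrightarrow> Re (h s) < A" and s: "dist a s \<le> r"
  shows "norm (h s) \<le> 2 * A * r / (R - r)"
proof -
  have A: "A > 0" using Re[of a] h0 R by auto
  define u where "u z = h (a + of_real R * z)" for z
  define \<phi> where "\<phi> z = u z / (2 * of_real A - u z)" for z
  have in_ball: "a + of_real R * z \<in> ball a R" if "norm z < 1" for z
    using that R by (simp add: dist_norm norm_mult)
  have Reu: "Re (u z) < A" if "norm z < 1" for z
    unfolding u_def using Re in_ball[OF that] by blast
  have uhol: "u holomorphic_on ball 0 1"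
    unfolding u_def using in_ball
    by (intro holomorphic_on_compose_gen[OF _ h, unfolded o_def] holomorphic_intros) auto
  have denom: "2 * of_real A - u z \<noteq> 0" if "norm z < 1" for z
    using Reu[OF that] A by (auto simp: complex_eq_iff)
  have \<phi>hol: "\<phi> holomorphic_on ball 0 1"
    unfolding \<phi>_def using denom by (intro holomorphic_intros uhol) auto
  have lt: "norm (u z) < norm (2 * of_real A - u z)" if "norm z < 1" for z
  proof -
    have "(norm (u z))\<^sup>2 < (norm (2 * of_real A - u z))\<^sup>2"
    proof -
      have "(norm (2 * of_real A - u z))\<^sup>2 - (norm (u z))\<^sup>2 = 4 * A * (A - Re (u z))"
        unfolding cmod_power2 by (simp add: power2_eq_square algebra_simps)
      also have "\<dots> > 0" using A Reu[OF that] by simp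
      finally show ?thesis by simp
    qed
    thus ?thesis by (rule power2_less_imp_less) simp
  qed
  have "norm (\<phi> z) < 1" if "norm z < 1" for z
    using lt[OF that] denom[OF that] by (simp add: \<phi>_def norm_divide divide_simps)
  moreover have "\<phi> 0 = 0" by (simp add: \<phi>_def u_def h0)
  ultimately have Sch: "norm (\<phi> z) \<le> norm z" if "norm z < 1" for z
    using Schwarz_Lemma(1)[OF \<phi>hol] that by blast
  define z where "z = (s - a) / of_real R"
  have z: "norm z \<le> r / R" "norm z < 1"
    using s R by (auto simp: z_def norm_divide dist_norm norm_minus_commute divide_simps)
  have us: "u z = h s" using R by (simp add: u_def z_def)
  have "norm (u z) \<le> norm z * norm (2 * of_real A - u z)"
    using Sch[OF z(2)] denom[OF z(2)] by (simp add: \<phi>_def norm_divide divide_simps)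
  also have "\<dots> \<le> (r / R) * (2 * A + norm (u z))"
  proof (intro mult_mono z)
    show "norm (2 * of_real A - u z) \<le> 2 * A + norm (u z)"
      using norm_triangle_ineq4[of "2 * of_real A" "u z"] A by (simp add: norm_mult)
  qed (use R in auto)
  finally have "R * norm (h s) \<le> r * (2 * A + norm (h s))"
    using R us by (simp add: field_simps)
  hence "norm (h s) * (R - r) \<le> 2 * A * r" by (simp add: algebra_simps)
  thus ?thesis using R by (simp add: field_simps)
qed

lemma entire_finite_zeros:
  fixes F :: "complex \<Rightarrow> complex"
  assumes F: "F holomorphic_on UNIV" and nz: "\<exists>s. F s \<noteq> 0" and B: "bounded B"
  shows "finite {s \<in> B. F s = 0}"
proof (cases "F constant_on UNIV")
  case True
  then show ?thesis using nz unfolding constant_on_def by auto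
next
  case False
  have "finite {s \<in> closure B. F s = 0}"
    using holomorphic_compact_finite_zeros[OF F open_UNIV connected_UNIV _ _ False] B by auto
  thus ?thesis by (rule finite_subset[rotated]) (use closure_subset in auto)
qed

lemma zorder_entire_pos:
  fixes F :: "complex \<Rightarrow> complex"
  assumes "F holomorphic_on UNIV" "\<exists>s. F s \<noteq> 0" "F \<zeta> = 0"
  shows "zorder F \<zeta> > 0"
  using zorder_exist_zero[OF assms(1), of \<zeta>] assms(2,3) by auto

text \<open>Compare \<open>F\<close> with the normalized polynomial of its zeros in the disc of radius \<open>3 \<rho>\<close>: its modulus is
  at least 1 on the circle of radius \<open>9 \<rho>\<close> and at most \<open>2 ^ - N\<close> at the centre.\<close>

lemma local_factorization:
  fixes F :: "complex \<Rightarrow> complex"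
  assumes F: "F holomorphic_on UNIV" and \<rho>: "\<rho> > 0" and M: "M > 0"
    and up: "\<And>s. dist a s \<le> 9 * \<rho> \<Longrightarrow> norm (F s) \<le> exp M" and lo: "exp (- M) \<le> norm (F a)"
  obtains Z m h where "finite Z" "\<And>\<zeta>. \<zeta> \<in> Z \<Longrightarrow> F \<zeta> = 0" "\<And>\<zeta>. \<zeta> \<in> Z \<Longrightarrow> m \<zeta> > (0::nat)"
    "real (\<Sum>\<zeta>\<in>Z. m \<zeta>) \<le> 3 * M" "h holomorphic_on ball a (3 * \<rho>)"
    "\<And>s. s \<in> ball a (3 * \<rho>) \<Longrightarrow> F s = (\<Prod>\<zeta>\<in>Z. ((s - \<zeta>) / of_real (6 * \<rho>)) ^ m \<zeta>) * exp (h s)"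
    "\<And>s s'. dist a s \<le> 2 * \<rho> \<Longrightarrow> dist a s' \<le> 2 * \<rho> \<Longrightarrow> norm (h s - h s') \<le> 24 * M"
    "\<And>s. dist a s \<le> 2 * \<rho> \<Longrightarrow> Re (h s) \<ge> - 13 * M"
proof -
  have "F a \<noteq> 0" using lo by (metis exp_gt_zero norm_zero not_less)
  hence nz: "\<exists>s. F s \<noteq> 0" by blast
  define Z where "Z = {s \<in> cball a (3 * \<rho>). F s = 0}"
  have Z: "finite Z" unfolding Z_def by (intro entire_finite_zeros F nz) auto
  define m where "m \<zeta> = nat (zorder F \<zeta>)" for \<zeta>
  have mpos: "m \<zeta> > 0" if "\<zeta> \<in> Z" for \<zeta>
    using zorder_entire_pos[OF F nz, of \<zeta>] that by (auto simp: m_def Z_def)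
  obtain E0 where E0: "E0 holomorphic_on UNIV" "\<And>s. F s = (\<Prod>\<zeta>\<in>Z. (s - \<zeta>) ^ m \<zeta>) * E0 s" "\<And>\<zeta>. \<zeta> \<in> Z \<Longrightarrow> E0 \<zeta> \<noteq> 0"
    using entire_factor_finite[OF F nz Z] unfolding m_def by blast
  define N where "N = (\<Sum>\<zeta>\<in>Z. m \<zeta>)"
  \<comment> \<open>Zeros lie within 3\<rho> of the centre, hence at distance at least 9\<rho> -
    3\<rho> = 6\<rho> from the outer circle, while from the centre itself they are at most half of
    6\<rho> away.\<close>
  define c where "c = (of_real (6 * \<rho>) :: complex)"
  have c: "c \<noteq> 0" "norm c = 6 * \<rho>" using \<rho> by (auto simp: c_def)
  define P where "P s = (\<Prod>\<zeta>\<in>Z. ((s - \<zeta>) / c) ^ m \<zeta>)" for s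
  define E where "E s = c ^ N * E0 s" for s
  have Ehol: "E holomorphic_on A" for A unfolding E_def by (intro holomorphic_intros holomorphic_on_subset[OF E0(1)]) auto
  have FPE: "F s = P s * E s" for s
  proof -
    have "(\<Prod>\<zeta>\<in>Z. (s - \<zeta>) ^ m \<zeta>) = c ^ N * P s"
      unfolding P_def N_def power_sum prod.distrib[symmetric] using c by (simp add: power_mult_distrib[symmetric])
    thus ?thesis unfolding E0(2) E_def by simp
  qed
  have normP: "norm (P s) = (\<Prod>\<zeta>\<in>Z. (norm (s - \<zeta>) / (6 * \<rho>)) ^ m \<zeta>)" for s
    using c by (simp add: P_def prod_norm[symmetric] norm_power norm_divide)
  have dZ: "dist a \<zeta> \<le> 3 * \<rho>" if "\<zeta> \<in> Z" for \<zeta> using that by (auto simp: Z_def)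
  have P_ge: "norm (P s) \<ge> 1" if "dist a s = 9 * \<rho>" for s
    unfolding normP
  proof (intro prod_ge_1 one_le_power)
    fix \<zeta> assume "\<zeta> \<in> Z"
    have "9 * \<rho> \<le> 3 * \<rho> + norm (s - \<zeta>)"
      using dist_triangle[of a s \<zeta>] dZ[OF \<open>\<zeta> \<in> Z\<close>] that by (simp add: dist_norm norm_minus_commute)
    thus "1 \<le> norm (s - \<zeta>) / (6 * \<rho>)" using \<rho> by simp
  qed
  have P_le: "norm (P a) \<le> (1/2) ^ N"
  proof -
    have "norm (P a) \<le> (\<Prod>\<zeta>\<in>Z. (1/2) ^ m \<zeta>)"
      unfolding normP using dZ \<rho> by (intro prod_mono conjI power_mono) (auto simp: dist_norm divide_simps)
    thus ?thesis by (simp add: N_def power_sum)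
  qed
  have E_le: "norm (E s) \<le> exp M" if "dist a s \<le> 9 * \<rho>" for s
  proof (rule maximum_modulus_frontier[of E "cball a (9 * \<rho>)"])
    fix z assume "z \<in> frontier (cball a (9 * \<rho>))"
    hence z: "dist a z = 9 * \<rho>" using \<rho> by (simp add: frontier_cball)
    have "norm (E z) * 1 \<le> norm (E z) * norm (P z)" using P_ge[OF z] by (intro mult_left_mono) auto
    also have "\<dots> = norm (F z)" unfolding FPE by (simp add: norm_mult)
    also have "\<dots> \<le> exp M" using up z by simp
    finally show "norm (E z) \<le> exp M" by simp
  qed (use that Ehol holomorphic_on_imp_continuous_on[OF Ehol] in auto)
  have Fa: "exp (- M) \<le> norm (P a) * norm (E a)" using lo unfolding FPE[of a] by (simp add: norm_mult)
  have "exp (- M) \<le> (1/2) ^ N * exp M"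
    using Fa mult_mono[OF P_le E_le[of a]] \<rho> by (simp add: order.trans)
  hence "2 ^ N \<le> exp M * exp M"
    by (simp add: exp_minus field_simps power_divide)
  hence "2 ^ N \<le> exp (2 * M)" by (simp add: exp_add[symmetric])
  hence "ln (2 ^ N) \<le> ln (exp (2 * M))" by (subst ln_le_cancel_iff) auto
  hence "real N * ln 2 \<le> 2 * M" by (simp add: ln_realpow)
  \<comment> \<open>Since ln 2 is at least 2/3, the bound N ln 2 \<le> 2M becomes N \<le>
    3M.\<close>
  moreover have "real N * (2/3) \<le> real N * ln 2" using ln2_ge_two_thirds by (intro mult_left_mono) auto
  ultimately have N: "real N \<le> 3 * M" by simp
  have "norm (P a) \<le> 1" using P_le power_le_one[of "1/2::real" N] by linarith
  hence Ea: "exp (- M) \<le> norm (E a)" using Fa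
    by (meson mult_left_le_one_le norm_ge_zero order.trans)
  have Enz: "E s \<noteq> 0" if "s \<in> cball a (3 * \<rho>)" for s
  proof
    assume "E s = 0"
    hence "F s = 0" "E0 s = 0" using FPE c by (auto simp: E_def)
    thus False using E0(3)[of s] that by (auto simp: Z_def)
  qed
  obtain h where h: "h holomorphic_on ball a (3 * \<rho>)" "\<And>s. s \<in> ball a (3 * \<rho>) \<Longrightarrow> E s = exp (h s)"
  proof -
    have "contractible (ball a (3 * \<rho>))" by (simp add: convex_imp_contractible)
    from contractible_imp_holomorphic_log[OF Ehol this] Enz
    show ?thesis using that by (metis ball_subset_cball subsetD)
  qed
  define u where "u s = h s - h a" for s
  have aball: "a \<in> ball a (3 * \<rho>)" using \<rho> by simp
  have Reh: "Re (h s) \<le> M" if "s \<in> ball a (3 * \<rho>)" for s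
  proof -
    have "exp (Re (h s)) \<le> exp M" using E_le[of s] h(2)[OF that] that \<rho> by simp
    thus ?thesis by simp
  qed
  have "exp (- M) \<le> exp (Re (h a))" using Ea h(2)[OF aball] by simp
  hence Reha: "Re (h a) \<ge> - M" by simp
  have u: "norm (u s) \<le> 12 * M" if "dist a s \<le> 2 * \<rho>" for s
  proof -
    \<comment> \<open>On the disc Re h \<le> M and Re (h a) \<ge> -M, so Re u \<le> 2M; this is
      relaxed to 3M to have a strict inequality. With radii 2\<rho> and 3\<rho> the result is 12M,
      whence 24M for differences and -13M = -M - 12M for the real part.\<close>
    have "norm (u s) \<le> 2 * (3 * M) * (2 * \<rho>) / (3 * \<rho> - 2 * \<rho>)"
    proof (rule borel_caratheodory[where a = a and h = u and R = "3 * \<rho>" and s = s])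
      show "u holomorphic_on ball a (3 * \<rho>)" unfolding u_def by (intro holomorphic_intros h)
      show "Re (u z) < 3 * M" if "z \<in> ball a (3 * \<rho>)" for z
        using Reh[OF that] Reha M unfolding u_def by simp
    qed (use \<rho> that in \<open>auto simp: u_def\<close>)
    thus ?thesis using \<rho> by simp
  qed
  have hP: "F s = (\<Prod>\<zeta>\<in>Z. ((s - \<zeta>) / of_real (6 * \<rho>)) ^ m \<zeta>) * exp (h s)" if "s \<in> ball a (3 * \<rho>)" for s
    using FPE h(2)[OF that] by (simp add: P_def c_def)
  show ?thesis
  proof (rule that[of Z m h])
    show "norm (h s - h s') \<le> 24 * M" if "dist a s \<le> 2 * \<rho>" "dist a s' \<le> 2 * \<rho>" for s s'
      using norm_triangle_ineq4[of "u s" "u s'"] u[OF that(1)] u[OF that(2)] by (simp add: u_def)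
    show "- 13 * M \<le> Re (h s)" if "dist a s \<le> 2 * \<rho>" for s
      using u[OF that] abs_Re_le_cmod[of "u s"] Reha by (simp add: u_def)
  qed (use Z mpos N h hP in \<open>auto simp: Z_def N_def\<close>)
qed

subsection \<open>Variation of the argument\<close>

text \<open>Its imaginary part is the change of the argument of F along the path, which is additive
  over products; all estimates below split g into factors and treat them separately.\<close>

abbreviation logint :: "(complex \<Rightarrow> complex) \<Rightarrow> (real \<Rightarrow> complex) \<Rightarrow> complex" where
  "logint F \<gamma> \<equiv> contour_integral \<gamma> (\<lambda>s. deriv F s / F s)"

lemma logderiv_contour_integrable:
  fixes F :: "complex \<Rightarrow> complex"
  assumes "F holomorphic_on U" "open U" "valid_path \<gamma>" "path_image \<gamma> \<subseteq> U" "\<And>s. s \<in> path_image \<gamma> \<Longrightarrow> F s \<noteq> 0"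
  shows "(\<lambda>s. deriv F s / F s) contour_integrable_on \<gamma>"
proof -
  have "open (U \<inter> F -` (- {0}))"
    using assms(1,2) by (intro continuous_open_preimage holomorphic_on_imp_continuous_on) auto
  also have "U \<inter> F -` (- {0}) = {s \<in> U. F s \<noteq> 0}" by auto
  finally have op: "open {s \<in> U. F s \<noteq> 0}" .
  show ?thesis
    by (rule contour_integrable_holomorphic_simple[OF _ op])
       (use assms op in \<open>auto intro!: holomorphic_intros intro: holomorphic_on_subset holomorphic_deriv[where S = U, THEN holomorphic_on_subset]\<close>)
qed

lemma logint_mult:
  assumes "F holomorphic_on U" "G holomorphic_on U" "open U" "valid_path \<gamma>" "path_image \<gamma> \<subseteq> U"
    "\<And>s. s \<in> path_image \<gamma> \<Longrightarrow> F s \<noteq> 0" "\<And>s. s \<in> path_image \<gamma> \<Longrightarrow> G s \<noteq> 0"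
  shows "logint (\<lambda>s. F s * G s) \<gamma> = logint F \<gamma> + logint G \<gamma>"
proof -
  have "logint (\<lambda>s. F s * G s) \<gamma> = contour_integral \<gamma> (\<lambda>s. deriv F s / F s + deriv G s / G s)"
  proof (rule contour_integral_cong[OF refl])
    fix s assume s: "s \<in> path_image \<gamma>"
    hence "deriv (\<lambda>s. F s * G s) s = F s * deriv G s + deriv F s * G s"
      using assms(5) holomorphic_on_imp_differentiable_at[OF assms(1,3)] holomorphic_on_imp_differentiable_at[OF assms(2,3)]
      by (intro deriv_mult) auto
    thus "deriv (\<lambda>s. F s * G s) s / (F s * G s) = deriv F s / F s + deriv G s / G s"
      using assms(6,7)[OF s] by (simp add: field_simps)
  qed
  also have "\<dots> = logint F \<gamma> + logint G \<gamma>"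
    using assms by (intro contour_integral_add logderiv_contour_integrable[where U = U]) auto
  finally show ?thesis .
qed

lemma logint_cong_open:
  assumes "open U" "path_image \<gamma> \<subseteq> U" "\<And>s. s \<in> U \<Longrightarrow> F s = G s"
  shows "logint F \<gamma> = logint G \<gamma>"
proof (rule contour_integral_cong[OF refl])
  fix s assume "s \<in> path_image \<gamma>"
  hence s: "s \<in> U" using assms by auto
  have "deriv F s = deriv G s"
    using eventually_nhds_in_open[OF assms(1) s] by (intro deriv_cong_ev refl) (auto elim!: eventually_mono simp: assms(3))
  thus "deriv F s / F s = deriv G s / G s" using assms(3)[OF s] by simp
qed

lemma logint_exp:
  assumes "h holomorphic_on U" "open U" "valid_path \<gamma>" "path_image \<gamma> \<subseteq> U"
  shows "logint (\<lambda>s. exp (h s)) \<gamma> = h (pathfinish \<gamma>) - h (pathstart \<gamma>)"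
proof -
  have "logint (\<lambda>s. exp (h s)) \<gamma> = contour_integral \<gamma> (deriv h)"
  proof (rule contour_integral_cong[OF refl])
    fix s assume "s \<in> path_image \<gamma>"
    hence s: "s \<in> U" using assms by auto
    have "((\<lambda>s. exp (h s)) has_field_derivative exp (h s) * deriv h s) (at s)"
      using s assms by (auto intro!: derivative_eq_intros holomorphic_derivI)
    thus "deriv (\<lambda>s. exp (h s)) s / exp (h s) = deriv h s" by (simp add: DERIV_imp_deriv)
  qed
  also have "\<dots> = h (pathfinish \<gamma>) - h (pathstart \<gamma>)"
    by (intro contour_integral_unique contour_integral_primitive[OF holomorphic_derivI[THEN has_field_derivative_at_within], where S = U])
       (use assms in auto)
  finally show ?thesis .
qed

text \<open>The values stay in the right half-plane, so \<open>Ln (F s)\<close> is a primitive along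
  the path; its imaginary parts at the two ends lie in (-pi, pi].\<close>

lemma logint_near_one:
  assumes "F holomorphic_on U" "open U" "valid_path \<gamma>" "path_image \<gamma> \<subseteq> U"
    and "\<And>s. s \<in> path_image \<gamma> \<Longrightarrow> norm (F s - 1) \<le> 1 / 2"
  shows "\<bar>Im (logint F \<gamma>)\<bar> \<le> 2 * pi"
proof -
  have Re: "Re (F s) > 0" if "s \<in> path_image \<gamma>" for s
    using assms(5)[OF that] abs_Re_le_cmod[of "F s - 1"] by simp
  have "((\<lambda>s. deriv F s / F s) has_contour_integral (Ln (F (pathfinish \<gamma>)) - Ln (F (pathstart \<gamma>)))) \<gamma>"
  proof (rule contour_integral_primitive[where S = "path_image \<gamma>" and f = "\<lambda>s. Ln (F s)"])
    fix s assume s: "s \<in> path_image \<gamma>"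
    have "(F has_field_derivative deriv F s) (at s)" using s assms by (intro holomorphic_derivI[of F U]) auto
    hence "((\<lambda>s. Ln (F s)) has_field_derivative inverse (F s) * deriv F s) (at s)"
      using Re[OF s] by (intro DERIV_chain2[OF has_field_derivative_Ln]) (auto simp: complex_nonpos_Reals_iff)
    thus "((\<lambda>s. Ln (F s)) has_field_derivative deriv F s / F s) (at s within path_image \<gamma>)"
      by (simp add: field_simps has_field_derivative_at_within)
  qed (use assms in auto)
  hence "logint F \<gamma> = Ln (F (pathfinish \<gamma>)) - Ln (F (pathstart \<gamma>))" by (rule contour_integral_unique)
  moreover have "F (pathfinish \<gamma>) \<noteq> 0" "F (pathstart \<gamma>) \<noteq> 0"
    using Re[of "pathfinish \<gamma>"] Re[of "pathstart \<gamma>"] by (metis pathfinish_in_path_image less_irrefl zero_complex.sel(1),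
      metis pathstart_in_path_image less_irrefl zero_complex.sel(1))
  ultimately show ?thesis
    using mpi_less_Im_Ln[of "F (pathfinish \<gamma>)"] Im_Ln_le_pi[of "F (pathfinish \<gamma>)"]
      mpi_less_Im_Ln[of "F (pathstart \<gamma>)"] Im_Ln_le_pi[of "F (pathstart \<gamma>)"] by simp
qed

text \<open>The change of argument of a linear factor along a segment is 2 pi times the real part of
  a winding number, hence at most pi, no matter how close the zero is to the segment. Only the
  number of zeros and the increment of h enter, which is what avoids a logarithmic loss.\<close>

lemma logint_factored:
  fixes F :: "complex \<Rightarrow> complex"
  assumes Z: "finite Z" "\<And>\<zeta>. \<zeta> \<in> Z \<Longrightarrow> m \<zeta> > (0::nat)"
    and h: "h holomorphic_on U" "open U" and ab: "closed_segment a b \<subseteq> U" and c: "c \<noteq> 0"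
    and F: "\<And>s. s \<in> U \<Longrightarrow> F s = (\<Prod>\<zeta>\<in>Z. ((s - \<zeta>) / c) ^ m \<zeta>) * exp (h s)"
    and nz: "\<And>s. s \<in> closed_segment a b \<Longrightarrow> F s \<noteq> 0"
  shows "\<bar>Im (logint F (linepath a b))\<bar> \<le> pi * real (\<Sum>\<zeta>\<in>Z. m \<zeta>) + norm (h b - h a)"
proof -
  define P where "P A s = (\<Prod>\<zeta>\<in>A. ((s - \<zeta>) / c) ^ m \<zeta>)" for A s
  have Phol: "P A holomorphic_on B" for A B
    unfolding P_def by (intro holomorphic_intros) (use c in auto)
  have notin: "\<zeta> \<notin> closed_segment a b" if "\<zeta> \<in> Z" for \<zeta>
  proof
    assume \<zeta>: "\<zeta> \<in> closed_segment a b"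
    have "(\<Prod>\<xi>\<in>Z. ((\<zeta> - \<xi>) / c) ^ m \<xi>) = 0"
      using Z that by (intro prod_zero bexI[of _ \<zeta>]) (auto simp: power_0_left)
    thus False using nz[OF \<zeta>] F[of \<zeta>] \<zeta> ab by auto
  qed
  have single: "Im (logint (\<lambda>s. ((s - \<zeta>) / c) ^ k) (linepath a b)) = real k * (2 * pi * Re (winding_number (linepath a b) \<zeta>))"
    if "\<zeta> \<notin> closed_segment a b" for \<zeta> k
  proof -
    have "logint (\<lambda>s. ((s - \<zeta>) / c) ^ k) (linepath a b) = contour_integral (linepath a b) (\<lambda>s. of_nat k * (1 / (s - \<zeta>)))"
    proof (rule contour_integral_cong[OF refl])
      fix s assume "s \<in> path_image (linepath a b)"
      hence "s \<noteq> \<zeta>" using that by auto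
      moreover have "((\<lambda>s. ((s - \<zeta>) / c) ^ k) has_field_derivative of_nat k * ((s - \<zeta>) / c) ^ (k - 1) * (1 / c)) (at s)"
        using c by (auto intro!: derivative_eq_intros)
      hence "deriv (\<lambda>s. ((s - \<zeta>) / c) ^ k) s = of_nat k * ((s - \<zeta>) / c) ^ (k - 1) * (1 / c)" by (rule DERIV_imp_deriv)
      ultimately show "deriv (\<lambda>s. ((s - \<zeta>) / c) ^ k) s / ((s - \<zeta>) / c) ^ k = of_nat k * (1 / (s - \<zeta>))"
        using c by (cases k) (auto simp: field_simps)
    qed
    also have "\<dots> = of_nat k * contour_integral (linepath a b) (\<lambda>s. 1 / (s - \<zeta>))"
      using that by (intro contour_integral_lmul contour_integrable_inversediff) auto
    also have "contour_integral (linepath a b) (\<lambda>s. 1 / (s - \<zeta>)) = 2 * of_real pi * \<i> * winding_number (linepath a b) \<zeta>"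
      using that by (subst winding_number_valid_path) auto
    finally show ?thesis by simp
  qed
  have Pint: "\<bar>Im (logint (P A) (linepath a b))\<bar> \<le> pi * real (\<Sum>\<zeta>\<in>A. m \<zeta>)" if "A \<subseteq> Z" for A
    using finite_subset[OF that Z(1)] that
  proof (induction A rule: finite_induct)
    case empty
    show ?case by (simp add: P_def)
  next
    case (insert \<zeta> A)
    have \<zeta>: "\<zeta> \<notin> closed_segment a b" using notin insert by auto
    have "P (insert \<zeta> A) = (\<lambda>s. ((s - \<zeta>) / c) ^ m \<zeta> * P A s)"
      using insert by (auto simp: P_def)
    hence "logint (P (insert \<zeta> A)) (linepath a b) = logint (\<lambda>s. ((s - \<zeta>) / c) ^ m \<zeta> * P A s) (linepath a b)"
      by (simp only:)
    also have "\<dots> = logint (\<lambda>s. ((s - \<zeta>) / c) ^ m \<zeta>) (linepath a b) + logint (P A) (linepath a b)"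
    proof (rule logint_mult[OF _ Phol open_UNIV])
      show "(\<lambda>s. ((s - \<zeta>) / c) ^ m \<zeta>) holomorphic_on UNIV" using c by (intro holomorphic_intros) auto
      fix s assume "s \<in> path_image (linepath a b)"
      hence s: "s \<in> closed_segment a b" by simp
      show "((s - \<zeta>) / c) ^ m \<zeta> \<noteq> 0" using s \<zeta> c by auto
      show "P A s \<noteq> 0" using s notin insert.prems c insert.hyps(1) by (auto simp: P_def)
    qed auto
    finally have "Im (logint (P (insert \<zeta> A)) (linepath a b)) =
        real (m \<zeta>) * (2 * pi * Re (winding_number (linepath a b) \<zeta>)) + Im (logint (P A) (linepath a b))"
      using single[OF \<zeta>, of "m \<zeta>"] by simp
    moreover have "\<bar>2 * pi * Re (winding_number (linepath a b) \<zeta>)\<bar> \<le> pi"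
      using winding_number_lt_half_linepath[OF \<zeta>] by (simp add: abs_mult)
    hence "\<bar>real (m \<zeta>) * (2 * pi * Re (winding_number (linepath a b) \<zeta>))\<bar> \<le> real (m \<zeta>) * pi"
      unfolding abs_mult[of "real (m \<zeta>)"] abs_of_nat by (rule mult_left_mono) simp
    moreover have "\<bar>Im (logint (P A) (linepath a b))\<bar> \<le> pi * real (\<Sum>\<zeta>\<in>A. m \<zeta>)" using insert by simp
    ultimately have "\<bar>Im (logint (P (insert \<zeta> A)) (linepath a b))\<bar> \<le> real (m \<zeta>) * pi + pi * real (\<Sum>\<zeta>\<in>A. m \<zeta>)"
      by linarith
    thus ?case using insert.hyps by (simp add: algebra_simps)
  qed
  have "logint F (linepath a b) = logint (\<lambda>s. P Z s * exp (h s)) (linepath a b)"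
    using F ab by (intro logint_cong_open[OF h(2)]) (auto simp: P_def)
  also have "\<dots> = logint (P Z) (linepath a b) + logint (\<lambda>s. exp (h s)) (linepath a b)"
    using ab h notin Z c by (intro logint_mult[OF Phol _ h(2)] holomorphic_intros) (auto simp: P_def)
  also have "logint (\<lambda>s. exp (h s)) (linepath a b) = h b - h a"
    using ab h by (subst logint_exp[OF h]) auto
  finally have "\<bar>Im (logint F (linepath a b))\<bar> \<le> \<bar>Im (logint (P Z) (linepath a b))\<bar> + \<bar>Im (h b - h a)\<bar>" by simp
  thus ?thesis using Pint[OF order.refl] abs_Im_le_cmod[of "h b - h a"] by linarith
qed

lemma rect_argument_principle:
  fixes g :: "complex \<Rightarrow> complex"
  assumes g: "g holomorphic_on UNIV" and le: "x1 < x2" "y1 < y2"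
    and nz: "\<And>s. s \<in> cbox (Complex x1 y1) (Complex x2 y2) - box (Complex x1 y1) (Complex x2 y2) \<Longrightarrow> g s \<noteq> 0"
  shows "2 * pi * real_of_int (zero_count g (box (Complex x1 y1) (Complex x2 y2))) =
    Im (logint g (linepath (Complex x1 y1) (Complex x2 y1))) + Im (logint g (linepath (Complex x2 y1) (Complex x2 y2)))
    + Im (logint g (linepath (Complex x2 y2) (Complex x1 y2))) + Im (logint g (linepath (Complex x1 y2) (Complex x1 y1)))"
proof -
  define a b where "a = Complex x1 y1" and "b = Complex x2 y2"
  have "a \<in> cbox a b - box a b" using le by (auto simp: a_def b_def in_cbox_complex_iff in_box_complex_iff)
  hence gnz: "\<exists>s. g s \<noteq> 0" using nz unfolding a_def b_def by blast
  have path_img: "path_image (rectpath a b) = cbox a b - box a b"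
    using le by (intro path_image_rectpath_cbox_minus_box) (auto simp: a_def b_def)
  \<comment> \<open>A bounded, connected open set around the closed rectangle, as the argument
    principle demands, in which g has finitely many zeros. The factor 2 covers the sum of the two
    side lengths.\<close>
  define B where "B = ball a (1 + 2 * norm (b - a))"
  have cB: "cbox a b \<subseteq> B"
  proof
    fix s assume "s \<in> cbox a b"
    hence "\<bar>Re (s - a)\<bar> \<le> \<bar>Re (b - a)\<bar>" "\<bar>Im (s - a)\<bar> \<le> \<bar>Im (b - a)\<bar>" by (auto simp: in_cbox_complex_iff)
    hence "norm (s - a) \<le> 2 * norm (b - a)"
      using cmod_le[of "s - a"] abs_Re_le_cmod[of "b - a"] abs_Im_le_cmod[of "b - a"] by linarith
    thus "s \<in> B" by (simp add: B_def dist_norm norm_minus_commute)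
  qed
  define pz where "pz = {s \<in> B. g s = 0 \<or> s \<in> {}}"
  have fin: "finite pz"
    using entire_finite_zeros[OF g gnz, of B] by (simp add: pz_def B_def)
  have wn_out: "winding_number (rectpath a b) z = 0" if "z \<notin> cbox a b" for z
    using that le by (intro winding_number_rectpath_outside) (auto simp: a_def b_def)
  have wn_B: "winding_number (rectpath a b) z = 0" if "z \<notin> B" for z
    using wn_out that cB by blast
  have wn_in: "winding_number (rectpath a b) z = 1" if "z \<in> box a b" for z
    using that by (rule winding_number_rectpath)
  have "contour_integral (rectpath a b) (\<lambda>x. deriv g x * 1 / g x) =
      2 * pi * \<i> * (\<Sum>s\<in>pz. winding_number (rectpath a b) s * 1 * zorder g s)"
    unfolding pz_def
    by (rule argument_principle)
       (use cB path_img nz fin wn_B holomorphic_on_subset[OF g] in \<open>auto simp: B_def pz_def a_def b_def\<close>)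
  also have "(\<Sum>s\<in>pz. winding_number (rectpath a b) s * 1 * zorder g s) = (\<Sum>s\<in>{s \<in> box a b. g s = 0}. of_int (zorder g s))"
  proof (rule sum.mono_neutral_cong_right[OF fin])
    show "{s \<in> box a b. g s = 0} \<subseteq> pz" using cB box_subset_cbox unfolding pz_def by fastforce
    show "\<forall>s\<in>pz - {s \<in> box a b. g s = 0}. winding_number (rectpath a b) s * 1 * zorder g s = 0"
      using wn_out nz unfolding pz_def a_def b_def by fastforce
  qed (use wn_in in auto)
  also have "\<dots> = of_int (zero_count g (box a b))" by (simp add: zero_count_def)
  finally have 1: "contour_integral (rectpath a b) (\<lambda>x. deriv g x / g x) = 2 * pi * \<i> * of_int (zero_count g (box a b))" by simp
  have seg: "closed_segment u v \<subseteq> path_image (rectpath a b)"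
    if "(u, v) \<in> {(a, Complex x2 y1), (Complex x2 y1, b), (b, Complex x1 y2), (Complex x1 y2, a)}" for u v
    using that by (auto simp: rectpath_def Let_def path_image_join a_def b_def)
  have ci: "(\<lambda>x. deriv g x / g x) contour_integrable_on linepath u v"
    if "(u, v) \<in> {(a, Complex x2 y1), (Complex x2 y1, b), (b, Complex x1 y2), (Complex x1 y2, a)}" for u v
    by (rule logderiv_contour_integrable[OF g open_UNIV]) (use seg[OF that] path_img nz in \<open>auto simp: a_def b_def\<close>)
  have "contour_integral (rectpath a b) (\<lambda>x. deriv g x / g x) =
     logint g (linepath a (Complex x2 y1)) + (logint g (linepath (Complex x2 y1) b)
    + (logint g (linepath b (Complex x1 y2)) + logint g (linepath (Complex x1 y2) a)))"
  proof -
    have e: "rectpath a b = linepath a (Complex x2 y1) +++ linepath (Complex x2 y1) b +++ linepath b (Complex x1 y2) +++ linepath (Complex x1 y2) a"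
      by (simp add: rectpath_def a_def b_def Let_def)
    show ?thesis unfolding e using ci
      by (simp add: contour_integral_join contour_integrable_joinI valid_path_join)
  qed
  from arg_cong[OF this, of Im] show ?thesis
    unfolding 1 by (simp add: a_def b_def)
qed

subsection \<open>Counting zeros\<close>

lemma zero_count_nonneg:
  assumes "F holomorphic_on UNIV" "\<exists>s. F s \<noteq> 0"
  shows "zero_count F A \<ge> 0"
  unfolding zero_count_def using zorder_entire_pos[OF assms] by (intro sum_nonneg) (auto intro: less_imp_le)

text \<open>Containment is asked only at zeros of F. Thus a closed region may be compared with an
  open box as soon as the boundary of the box is free of zeros.\<close>

lemma zero_count_mono:
  assumes "F holomorphic_on UNIV" "\<exists>s. F s \<noteq> 0" "bounded B" "\<And>s. s \<in> A \<Longrightarrow> F s = 0 \<Longrightarrow> s \<in> B"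
  shows "zero_count F A \<le> zero_count F B"
  unfolding zero_count_def
  by (rule sum_mono2) (use assms entire_finite_zeros[OF assms(1-3)] zorder_entire_pos[OF assms(1,2)] in \<open>auto intro: less_imp_le\<close>)

lemma zero_count_Un_disjoint:
  assumes "F holomorphic_on UNIV" "\<exists>s. F s \<noteq> 0" "bounded A" "bounded B" "A \<inter> B = {}"
  shows "zero_count F (A \<union> B) = zero_count F A + zero_count F B"
proof -
  have "{z \<in> A \<union> B. F z = 0} = {z \<in> A. F z = 0} \<union> {z \<in> B. F z = 0}" by auto
  thus ?thesis unfolding zero_count_def
    using assms entire_finite_zeros[OF assms(1,2)] by (simp, subst sum.union_disjoint) auto
qed

lemma zero_count_Un_le:
  assumes "F holomorphic_on UNIV" "\<exists>s. F s \<noteq> 0" "bounded A" "bounded B"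
  shows "zero_count F (A \<union> B) \<le> zero_count F A + zero_count F B"
proof -
  have "zero_count F (A \<union> B) = zero_count F (A \<union> (B - A))" by simp
  also have "\<dots> = zero_count F A + zero_count F (B - A)"
    using assms by (intro zero_count_Un_disjoint) (auto intro: bounded_subset)
  also have "zero_count F (B - A) \<le> zero_count F B" using assms by (intro zero_count_mono) auto
  finally show ?thesis by simp
qed

lemma zero_count_UN_le:
  assumes "F holomorphic_on UNIV" "\<exists>s. F s \<noteq> 0" "finite I" "\<And>i. i \<in> I \<Longrightarrow> bounded (A i)"
  shows "zero_count F (\<Union>i\<in>I. A i) \<le> (\<Sum>i\<in>I. zero_count F (A i))"
  using assms(3,4)
proof (induction I rule: finite_induct)
  case empty
  show ?case by (simp add: zero_count_def)
next
  case (insert i I)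
  have "zero_count F (\<Union>i\<in>insert i I. A i) \<le> zero_count F (A i) + zero_count F (\<Union>i\<in>I. A i)"
    using insert by (simp, intro zero_count_Un_le assms(1,2)) auto
  thus ?case using insert by fastforce
qed

text \<open>The derivative of exp never vanishes, so exp is locally biholomorphic and
  \<open>exp x - exp s\<close> has a simple zero at s. This transfers multiplicities between f and
  its logarithmic form.\<close>

lemma zorder_compose_exp:
  assumes "f holomorphic_on UNIV" "\<exists>z. f z \<noteq> 0"
  shows "zorder (\<lambda>s. f (exp s)) s = zorder f (exp s)"
proof -
  obtain z0 where z0: "f z0 \<noteq> 0" using assms by blast
  have an: "f analytic_on {exp s}" using holomorphic_on_imp_analytic_at[OF assms(1)] by simp
  have "zorder (f \<circ> exp) s = zorder f (exp s) * zorder (\<lambda>x. exp x - exp s) s"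
  proof (rule zorder_compose')
    show "isolated_singularity_at f (exp s)" using an by (rule isolated_singularity_at_analytic)
    show "not_essential f (exp s)" using an by (rule not_essential_analytic)
    show "exp analytic_on {s}" by (intro analytic_intros)
    show "\<forall>\<^sub>F w in at (exp s). f w \<noteq> 0"
      using non_zero_neighbour_alt[OF assms(1) open_UNIV connected_UNIV UNIV_I UNIV_I z0] by (auto elim: eventually_mono)
    \<comment> \<open>The value here is -2 exp s, which witnesses that the difference is not
      identically zero.\<close>
    have nz1: "exp (s + \<i> * pi) - exp s \<noteq> 0" by (simp add: exp_add)
    have "(\<lambda>x. exp x - exp s) holomorphic_on UNIV" by (intro holomorphic_intros)
    from non_zero_neighbour_alt[OF this open_UNIV connected_UNIV UNIV_I UNIV_I nz1, of s]
    show "\<forall>\<^sub>F w in at s. exp w \<noteq> exp s" by (auto elim: eventually_mono)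
  qed
  moreover have "zorder (\<lambda>x. exp x - exp s) s = 1"
  proof (rule zorder_zero_eqI[of _ UNIV])
    have "((\<lambda>x. exp x - exp s) has_field_derivative exp s) (at s)" by (auto intro!: derivative_eq_intros)
    hence "deriv (\<lambda>x. exp x - exp s) s = exp s" by (rule DERIV_imp_deriv)
    thus "(deriv ^^ nat 1) (\<lambda>x. exp x - exp s) s \<noteq> 0" by simp
  qed (auto intro!: holomorphic_intros)
  ultimately show ?thesis by (simp add: o_def)
qed

lemma zero_count_exp_image:
  assumes "f holomorphic_on UNIV" "\<exists>z. f z \<noteq> 0" "inj_on exp S"
  shows "zero_count f (exp ` S) = zero_count (\<lambda>s. f (exp s)) S"
proof -
  have "{z \<in> exp ` S. f z = 0} = exp ` {s \<in> S. f (exp s) = 0}" by auto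
  moreover have "inj_on exp {s \<in> S. f (exp s) = 0}" using assms(3) by (rule inj_on_subset) auto
  ultimately show ?thesis
    unfolding zero_count_def by (simp add: sum.reindex o_def zorder_compose_exp[OF assms(1,2)])
qed

lemma inj_on_exp_strip:
  assumes "\<And>s s'. s \<in> S \<Longrightarrow> s' \<in> S \<Longrightarrow> \<bar>Im s - Im s'\<bar> < 2 * pi"
  shows "inj_on exp (S :: complex set)"
  by (rule inj_onI) (use assms exp_complex_eqI in blast)

text \<open>Pigeonhole: among \<open>card Z + 1\<close> candidates spaced 2\<delta> apart, each
  value \<open>\<phi> \<zeta>\<close> comes closer than \<delta> to at most one, so some candidate
  is far from all of them.\<close>

lemma exists_far_point:
  fixes \<phi> :: "'a \<Rightarrow> real"
  assumes "finite Z" "\<beta> > 0"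
  obtains t where "a \<le> t" "t \<le> a + \<beta>" "\<And>\<zeta>. \<zeta> \<in> Z \<Longrightarrow> \<beta> / (2 * (real (card Z) + 1)) \<le> \<bar>t - \<phi> \<zeta>\<bar>"
proof -
  define n where "n = card Z + 1"
  define \<delta> where "\<delta> = \<beta> / (2 * (real (card Z) + 1))"
  have \<delta>: "\<delta> > 0" "\<beta> = 2 * real n * \<delta>" using assms by (auto simp: \<delta>_def n_def field_simps)
  define t where "t i = a + \<delta> * (2 * real i + 1)" for i
  have "\<exists>i<n. \<forall>\<zeta>\<in>Z. \<delta> \<le> \<bar>t i - \<phi> \<zeta>\<bar>"
  proof (rule ccontr)
    assume "\<not> ?thesis"
    hence "\<forall>i\<in>{..<n}. \<exists>\<zeta>\<in>Z. \<bar>t i - \<phi> \<zeta>\<bar> < \<delta>" by (auto simp: not_le)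
    hence "\<forall>i\<in>{..<n}. \<exists>\<zeta>. \<zeta> \<in> Z \<and> \<bar>t i - \<phi> \<zeta>\<bar> < \<delta>" by blast
    from bchoice[OF this] obtain z where z: "\<And>i. i < n \<Longrightarrow> z i \<in> Z \<and> \<bar>t i - \<phi> (z i)\<bar> < \<delta>" by auto
    have "inj_on z {..<n}"
    proof (rule inj_onI)
      fix i j assume ij: "i \<in> {..<n}" "j \<in> {..<n}" "z i = z j"
      hence "\<bar>t i - t j\<bar> < 2 * \<delta>" using z[of i] z[of j] by auto
      moreover have "t i - t j = (2 * \<delta>) * (real i - real j)" by (simp add: t_def algebra_simps)
      ultimately have "(2 * \<delta>) * \<bar>real i - real j\<bar> < (2 * \<delta>) * 1" using \<delta> by (simp add: abs_mult)
      hence "\<bar>real i - real j\<bar> < 1" using \<delta> mult_less_cancel_left_pos[of "2 * \<delta>"] by auto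
      thus "i = j" by linarith
    qed
    hence "n \<le> card Z" using card_inj_on_le[of z "{..<n}" Z] z assms(1) by auto
    thus False by (simp add: n_def)
  qed
  then obtain i where i: "i < n" "\<forall>\<zeta>\<in>Z. \<delta> \<le> \<bar>t i - \<phi> \<zeta>\<bar>" by blast
  have "\<delta> * (2 * real i + 1) \<le> \<delta> * (2 * real n)" using i \<delta> by (intro mult_left_mono) auto
  hence "t i \<le> a + \<beta>" "a \<le> t i" using \<delta> by (auto simp: t_def algebra_simps)
  thus ?thesis using that[of "t i"] i unfolding \<delta>_def by auto
qed

text \<open>The product of the four rotations of \<open>F\<close> about \<open>z0\<close> would be too small on the whole circle,
  contradicting the maximum principle at \<open>z0\<close>.\<close>

lemma large_value_on_arc:
  fixes F :: "complex \<Rightarrow> complex"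
  assumes F: "F holomorphic_on UNIV" and nz: "F z0 \<noteq> 0" and R: "R > 0"
    and M: "\<And>z. dist z0 z = R \<Longrightarrow> norm (F z) \<le> exp M"
  obtains t where "\<bar>t - y\<bar> \<le> 1" "norm (F (z0 + of_real R * cis t)) \<ge> norm (F z0) ^ 4 / 2 * exp (- 3 * M)"
proof -
  define B where "B = norm (F z0) ^ 4 / 2 * exp (- 3 * M)"
  have "\<exists>t. \<bar>t - y\<bar> \<le> 1 \<and> norm (F (z0 + of_real R * cis t)) \<ge> B"
  proof (rule ccontr)
    assume "\<not> ?thesis"
    hence small: "norm (F (z0 + of_real R * cis t)) < B" if "\<bar>t - y\<bar> \<le> 1" for t
      using that not_le by blast
    define \<Phi> where "\<Phi> z = (\<Prod>k<4. F (z0 + \<i> ^ k * z))" for z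
    have \<Phi>hol: "\<Phi> holomorphic_on A" for A
      unfolding \<Phi>_def
      by (intro holomorphic_intros holomorphic_on_compose_gen[OF _ F, unfolded o_def]) auto
    have "norm (\<Phi> 0) \<le> B * exp (3 * M)"
    proof (rule maximum_modulus_frontier[of \<Phi> "cball 0 R"])
      fix z :: complex assume "z \<in> frontier (cball 0 R)"
      hence nz: "norm z = R" using R by (simp add: frontier_cball)
      define \<tau> where "\<tau> = Arg z"
      have z: "z = of_real R * cis \<tau>" using rcis_cmod_Arg[of z] nz by (simp add: rcis_def \<tau>_def)
      \<comment> \<open>Some multiple of pi/2 rotates \<tau> to within pi/4 < 1 of y, so one of the
        four points \<open>\<i> ^ k * z\<close> falls on the arc where F was assumed small; the
        other three factors are bounded by exp M.\<close>
      define N where "N = round ((y - \<tau>) / (pi / 2))"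
      have "\<bar>real_of_int N - (y - \<tau>) / (pi / 2)\<bar> \<le> 1 / 2" unfolding N_def by (rule of_int_round_abs_le)
      hence "\<bar>real_of_int N - (y - \<tau>) / (pi / 2)\<bar> * (pi / 2) \<le> 1 / 2 * (pi / 2)" by (intro mult_right_mono) auto
      hence "\<bar>(real_of_int N - (y - \<tau>) / (pi / 2)) * (pi / 2)\<bar> \<le> pi / 4" by (simp add: abs_mult)
      moreover have "(real_of_int N - (y - \<tau>) / (pi / 2)) * (pi / 2) = \<tau> + real_of_int N * (pi / 2) - y"
        by (simp add: field_simps)
      ultimately have "\<bar>\<tau> + real_of_int N * (pi / 2) - y\<bar> \<le> pi / 4" by (simp only:)
      hence t: "\<bar>\<tau> + real_of_int N * (pi / 2) - y\<bar> \<le> 1" using pi_less_4 by linarith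
      define k where "k = nat (N mod 4)"
      have k4: "k < 4" by (simp add: k_def nat_less_iff)
      have Nk: "real_of_int N = 4 * real_of_int (N div 4) + real k"
      proof -
        have "int k = N mod 4" by (simp add: k_def)
        hence "N = 4 * (N div 4) + int k" by simp
        thus ?thesis by (metis of_int_add of_int_mult of_int_numeral of_int_of_nat_eq)
      qed
      have "real_of_int N * (pi / 2) = 2 * pi * real_of_int (N div 4) + real k * (pi / 2)"
        unfolding Nk by (simp add: algebra_simps)
      hence "cis (real_of_int N * (pi / 2)) = cis (2 * pi * real_of_int (N div 4)) * cis (real k * (pi / 2))"
        by (simp only: cis_mult)
      also have "cis (2 * pi * real_of_int (N div 4)) = 1" by (simp add: cis_multiple_2pi)
      also have "1 * cis (real k * (pi / 2)) = \<i> ^ k" using Complex.DeMoivre[of "pi / 2" k] by simp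
      finally have "z0 + \<i> ^ k * z = z0 + of_real R * cis (\<tau> + real_of_int N * (pi / 2))"
        unfolding z by (simp add: cis_mult[symmetric] mult_ac)
      hence kB: "norm (F (z0 + \<i> ^ k * z)) \<le> B" using small[OF t] by simp
      have "norm (\<Phi> z) = (\<Prod>j<4. norm (F (z0 + \<i> ^ j * z)))" by (simp add: \<Phi>_def prod_norm)
      also have "\<dots> = norm (F (z0 + \<i> ^ k * z)) * (\<Prod>j\<in>{..<4}-{k}. norm (F (z0 + \<i> ^ j * z)))"
        using k4 by (intro prod.remove) auto
      also have "\<dots> \<le> B * (\<Prod>j\<in>{..<4::nat}-{k}. exp M)"
        using nz kB by (intro mult_mono prod_mono conjI M prod_nonneg) (auto simp: dist_norm norm_mult norm_power B_def)
      also have "(\<Prod>j\<in>{..<4::nat}-{k}. exp M) = exp (3 * M)"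
        using k4 by (simp add: exp_of_nat_mult[symmetric])
      finally show "norm (\<Phi> z) \<le> B * exp (3 * M)" .
    qed (use R \<Phi>hol holomorphic_on_imp_continuous_on[OF \<Phi>hol] in auto)
    moreover have "norm (\<Phi> 0) = norm (F z0) ^ 4" by (simp add: \<Phi>_def norm_power)
    \<comment> \<open>The factor 1/2 built into B makes the contradiction strict: a positive number
      would be at most half of itself.\<close>
    moreover have "B * exp (3 * M) = norm (F z0) ^ 4 / 2" by (simp add: B_def mult.assoc exp_add[symmetric])
    ultimately show False using nz by simp
  qed
  thus ?thesis using that unfolding B_def by blast
qed

subsection \<open>Exponential polynomials\<close>

lemma poly_growth:
  fixes P :: "complex poly"
  assumes "degree P \<le> n"
  obtains C where "C > 0" "\<And>z. norm z \<ge> 1 \<Longrightarrow> norm (poly P z) \<le> C * norm z ^ n"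
proof
  show "(\<Sum>i\<le>degree P. norm (coeff P i)) + 1 > 0" by (intro add_nonneg_pos sum_nonneg) auto
  fix z :: complex assume z: "norm z \<ge> 1"
  have "norm (poly P z) \<le> (\<Sum>i\<le>degree P. norm (coeff P i) * norm z ^ i)"
    unfolding poly_altdef by (rule order.trans[OF norm_sum]) (simp add: norm_mult norm_power)
  also have "\<dots> \<le> (\<Sum>i\<le>degree P. norm (coeff P i) * norm z ^ n)"
    using z assms by (intro sum_mono mult_left_mono power_increasing) auto
  also have "\<dots> \<le> ((\<Sum>i\<le>degree P. norm (coeff P i)) + 1) * norm z ^ n"
    by (simp add: sum_distrib_right distrib_right)
  finally show "norm (poly P z) \<le> ((\<Sum>i\<le>degree P. norm (coeff P i)) + 1) * norm z ^ n" .
qed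

lemma sum_exp_bound:
  fixes F :: "'a \<Rightarrow> 'b \<Rightarrow> real" and x :: "'b \<Rightarrow> real"
  assumes "finite I" "\<And>i. i \<in> I \<Longrightarrow> \<exists>C>0. \<forall>z. x z \<ge> 1 \<longrightarrow> F i z \<le> exp (C * x z)"
  shows "\<exists>C>0. \<forall>z. x z \<ge> 1 \<longrightarrow> (\<Sum>i\<in>I. F i z) \<le> exp (C * x z)"
  using assms
proof (induction I rule: finite_induct)
  case empty
  show ?case by (rule exI[of _ 1]) auto
next
  case (insert i I)
  obtain C1 where C1: "C1 > 0" "\<And>z. x z \<ge> 1 \<Longrightarrow> F i z \<le> exp (C1 * x z)" using insert by blast
  obtain C2 where C2: "C2 > 0" "\<And>z. x z \<ge> 1 \<Longrightarrow> (\<Sum>i\<in>I. F i z) \<le> exp (C2 * x z)" using insert by blast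
  show ?case
  proof (rule exI[of _ "C1 + C2 + 1"], intro conjI allI impI)
    fix z assume x: "x z \<ge> 1"
    have "(\<Sum>i\<in>insert i I. F i z) \<le> exp (C1 * x z) + exp (C2 * x z)"
      using insert.hyps C1(2)[OF x] C2(2)[OF x] by simp
    also have "\<dots> \<le> exp ((C1 + C2) * x z) + exp ((C1 + C2) * x z)"
      using C1(1) C2(1) x by (intro add_mono) auto
    also have "\<dots> = 2 * exp ((C1 + C2) * x z)" by simp
    \<comment> \<open>The factor 2 from adding two terms is absorbed by exp (x z), at the price of 1
      in the constant.\<close>
    also have "\<dots> \<le> exp (x z) * exp ((C1 + C2) * x z)"
    proof (intro mult_right_mono)
      show "2 \<le> exp (x z)" using exp_ge_add_one_self[of "x z"] x by linarith
    qed auto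
    also have "\<dots> = exp ((C1 + C2 + 1) * x z)" by (simp add: exp_add[symmetric] algebra_simps)
    finally show "(\<Sum>i\<in>insert i I. F i z) \<le> exp ((C1 + C2 + 1) * x z)" .
  qed (use C1 C2 in auto)
qed

lemma exp_poly_entire: "exp_poly_has_order f d \<Longrightarrow> f holomorphic_on A"
proof -
  assume "exp_poly_has_order f d"
  then obtain n :: nat and P Q :: "nat \<Rightarrow> complex poly" where "\<forall>z. f z = (\<Sum>j\<le>n. poly (P j) z * exp (poly (Q j) z))"
    unfolding exp_poly_has_order_def by blast
  hence "f = (\<lambda>z. \<Sum>j\<le>n. poly (P j) z * exp (poly (Q j) z))" by blast
  thus ?thesis by (auto intro!: holomorphic_intros)
qed

text \<open>For d \<ge> 1 the polynomial factors are harmless, because |z|^k \<le> exp (k |z|) \<le>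
  exp (k |z|^d). This breaks down for d = 0, which is handled separately below.\<close>

lemma exp_poly_growth:
  assumes "exp_poly_has_order f d'" "d' \<le> d" "d \<ge> 1"
  shows "\<exists>C>0. \<forall>z. norm z \<ge> 1 \<longrightarrow> norm (f z) \<le> exp (C * norm z ^ d)"
proof -
  obtain n :: nat and P Q :: "nat \<Rightarrow> complex poly" where f: "\<And>z. f z = (\<Sum>j\<le>n. poly (P j) z * exp (poly (Q j) z))"
    and d': "d' = Max ((\<lambda>j. degree (Q j)) ` {..n})"
    using assms(1) unfolding exp_poly_has_order_def by blast
  have ge1: "norm z \<ge> 1 \<longleftrightarrow> norm z ^ d \<ge> 1" for z :: complex
    using assms(3) by (metis norm_ge_zero one_le_power power_less_one_iff not_less zero_less_one less_le_trans not_one_le_zero)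
  have "\<exists>C>0. \<forall>z. norm z ^ d \<ge> 1 \<longrightarrow> norm (poly (P j) z * exp (poly (Q j) z)) \<le> exp (C * norm z ^ d)"
    if "j \<in> {..n}" for j
  proof -
    have "degree (Q j) \<le> d" using that assms(2) unfolding d' by (subst (asm) Max_le_iff) auto
    then obtain C1 where C1: "C1 > 0" "\<And>z. norm z \<ge> 1 \<Longrightarrow> norm (poly (Q j) z) \<le> C1 * norm z ^ d"
      by (rule poly_growth) auto
    obtain C2 where C2: "C2 > 0" "\<And>z. norm z \<ge> 1 \<Longrightarrow> norm (poly (P j) z) \<le> C2 * norm z ^ degree (P j)"
      by (rule poly_growth[OF order.refl]) auto
    define k where "k = degree (P j)"
    show ?thesis
    proof (rule exI[of _ "C2 + k + C1"], intro conjI allI impI)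
      fix z :: complex assume z': "norm z ^ d \<ge> 1"
      hence z: "norm z \<ge> 1" by (simp add: ge1)
      have zd: "norm z \<le> norm z ^ d" using z assms(3) power_increasing[of 1 d "norm z"] by simp
      have "norm (poly (P j) z) \<le> C2 * norm z ^ k" using C2(2)[OF z] by (simp add: k_def)
      also have "\<dots> \<le> exp C2 * exp (norm z) ^ k"
        using exp_ge_add_one_self[of C2] exp_ge_add_one_self[of "norm z"] C2(1)
        by (intro mult_mono power_mono) (auto intro: order.trans[rotated] simp del: exp_ge_add_one_self)
      also have "\<dots> = exp (C2 + k * norm z)" by (simp add: exp_add exp_of_nat_mult)
      also have "\<dots> \<le> exp (C2 * norm z ^ d + k * norm z ^ d)"
        using z' C2(1) zd by (auto intro!: add_mono mult_left_mono)
      finally have 1: "norm (poly (P j) z) \<le> exp (C2 * norm z ^ d + k * norm z ^ d)" .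
      have "norm (exp (poly (Q j) z)) \<le> exp (C1 * norm z ^ d)"
        using C1(2)[OF z] norm_exp[of "poly (Q j) z"] by (meson exp_le_cancel_iff order.trans)
      with 1 have "norm (poly (P j) z * exp (poly (Q j) z)) \<le> exp (C2 * norm z ^ d + k * norm z ^ d) * exp (C1 * norm z ^ d)"
        unfolding norm_mult by (intro mult_mono) auto
      thus "norm (poly (P j) z * exp (poly (Q j) z)) \<le> exp ((C2 + k + C1) * norm z ^ d)"
        by (simp add: exp_add[symmetric] algebra_simps)
    qed (use C1 C2 in auto)
  qed
  from sum_exp_bound[OF finite_atMost[of n], where x = "\<lambda>z. norm z ^ d" and F = "\<lambda>j z. norm (poly (P j) z * exp (poly (Q j) z))", OF this]
  obtain C where C: "C > 0" "\<And>z. norm z ^ d \<ge> 1 \<Longrightarrow> (\<Sum>j\<le>n. norm (poly (P j) z * exp (poly (Q j) z))) \<le> exp (C * norm z ^ d)"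
    by blast
  have "norm (f z) \<le> exp (C * norm z ^ d)" if "norm z \<ge> 1" for z
    using C(2)[of z] that ge1 norm_sum[of "\<lambda>j. poly (P j) z * exp (poly (Q j) z)" "{..n}"] unfolding f by force
  thus ?thesis using C(1) by blast
qed

text \<open>The normalization \<open>poly (Q j) 0 = 0\<close> forces constant exponents to be zero,
  so all exponentials equal 1.\<close>

lemma exp_poly_order_0:
  assumes "exp_poly_has_order f 0"
  obtains P where "\<And>z. f z = poly P z"
proof -
  obtain n :: nat and P Q :: "nat \<Rightarrow> complex poly" where f: "\<And>z. f z = (\<Sum>j\<le>n. poly (P j) z * exp (poly (Q j) z))"
    and d': "0 = Max ((\<lambda>j. degree (Q j)) ` {..n})" and Q0: "\<forall>j\<le>n. poly (Q j) 0 = 0"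
    using assms(1) unfolding exp_poly_has_order_def by blast
  have "poly (Q j) z = 0" if "j \<le> n" for j z
  proof -
    have "degree (Q j) \<le> 0" using that unfolding d' by (intro Max_ge) auto
    then obtain c where c: "Q j = [:c:]" by (metis degree_eq_zeroE le_zero_eq)
    thus ?thesis using Q0 that by force
  qed
  hence "f z = poly (\<Sum>j\<le>n. P j) z" for z by (simp add: f poly_sum)
  thus ?thesis using that by blast
qed

text \<open>After removal of \<open>exp (k * s)\<close> the upper bound, and the lower bound near
  every prescribed point, are both exp of order \<open>exp (d * X)\<close>, without a factor X. For
  d = 0, k is the degree and the quotient tends to the leading coefficient. For d \<ge> 1, k = 0 and
  \<open>large_value_on_arc\<close> supplies the point.\<close>

lemma exp_poly_large_values:
  assumes H: "exp_poly_order_le H d" and nz: "\<exists>z. H z \<noteq> 0"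
  obtains k :: nat and C X0 where "C > 0"
    "\<And>s. Re s \<ge> X0 \<Longrightarrow> norm (H (exp s) * exp (- of_nat k * s)) \<le> exp (C * exp (real d * Re s))"
    "\<And>X y. X \<ge> X0 \<Longrightarrow> \<exists>a. \<bar>Re a - X\<bar> \<le> 1 \<and> \<bar>Im a - y\<bar> \<le> 2 \<and>
        norm (H (exp a) * exp (- of_nat k * a)) \<ge> exp (- C * exp (real d * X))"
proof (cases "d = 0")
  case True
  then obtain P where P: "\<And>z. H z = poly P z"
    using H exp_poly_order_0 unfolding exp_poly_order_le_def by (metis le_zero_eq)
  define k where "k = degree P"
  \<comment> \<open>H (z) / z^k as a polynomial in w = 1/z; its value at w = 0 is the leading
    coefficient.\<close>
  define G where "G w = poly (reflect_poly P) w" for w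
  have HG: "H (exp s) * exp (- of_nat k * s) = G (exp (- s))" for s
  proof -
    have "exp (- of_nat k * s) = exp (- s) ^ k" by (simp flip: exp_of_nat_mult)
    thus ?thesis unfolding G_def P k_def by (subst poly_reflect_poly_nz) (auto simp: exp_minus)
  qed
  have P0: "lead_coeff P \<noteq> 0" using nz P by auto
  have "compact (G ` cball 0 1)" unfolding G_def by (intro compact_continuous_image continuous_intros) auto
  then obtain B where B: "B > 0" "\<And>w. norm w \<le> 1 \<Longrightarrow> norm (G w) \<le> B"
    using compact_imp_bounded[of "G ` cball 0 1"] unfolding bounded_pos by auto
  define L where "L = norm (lead_coeff P) / 2"
  have L: "L > 0" using P0 by (simp add: L_def)
  have "isCont G 0" unfolding G_def by (intro continuous_intros)
  then obtain \<delta> where \<delta>: "\<delta> > 0" "\<And>w. norm w < \<delta> \<Longrightarrow> dist (G w) (G 0) < L"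
    using L unfolding continuous_at_eps_delta by (metis dist_0_norm dist_commute)
  have G0: "norm (G 0) = 2 * L" by (simp add: G_def L_def)
  have low: "norm (G w) \<ge> L" if "norm w < \<delta>" for w
    using \<delta>(2)[OF that] norm_triangle_ineq2[of "G 0" "G w"] G0 by (simp add: dist_norm norm_minus_commute)
  define C where "C = \<bar>ln B\<bar> + \<bar>ln L\<bar> + 1"
  have "B \<le> exp C" "exp (- C) \<le> L"
    using B(1) L exp_ln[of B] exp_ln[of L] by (smt (verit) C_def exp_le_cancel_iff)+
  moreover have "C > 0" by (auto simp: C_def)
  ultimately show ?thesis
  proof (intro that[of C "\<bar>ln \<delta>\<bar> + 1" k])
    fix s :: complex assume "Re s \<ge> \<bar>ln \<delta>\<bar> + 1"
    hence "norm (exp (- s)) \<le> 1" by simp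
    from B(2)[OF this] show "norm (H (exp s) * exp (- of_nat k * s)) \<le> exp (C * exp (real d * Re s))"
      unfolding HG using \<open>B \<le> exp C\<close> True by simp
  next
    fix X y :: real assume X: "X \<ge> \<bar>ln \<delta>\<bar> + 1"
    hence "exp (- X) < exp (ln \<delta>)" by (subst exp_less_cancel_iff) auto
    hence "norm (exp (- Complex X y)) < \<delta>" using \<delta> by simp
    from low[OF this] show "\<exists>a. \<bar>Re a - X\<bar> \<le> 1 \<and> \<bar>Im a - y\<bar> \<le> 2 \<and>
        norm (H (exp a) * exp (- of_nat k * a)) \<ge> exp (- C * exp (real d * X))"
      unfolding HG using \<open>exp (- C) \<le> L\<close> True by (intro exI[of _ "Complex X y"]) simp
  qed
next
  case False
  hence d: "d \<ge> 1" by simp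
  obtain d' where d': "exp_poly_has_order H d'" "d' \<le> d" using H unfolding exp_poly_order_le_def by blast
  obtain C where C: "C > 0" "\<And>z. norm z \<ge> 1 \<Longrightarrow> norm (H z) \<le> exp (C * norm z ^ d)"
    using exp_poly_growth[OF d' d] by blast
  have ent: "H holomorphic_on UNIV" using exp_poly_entire d' by blast
  obtain z0 where z0: "H z0 \<noteq> 0" using nz by blast
  define L where "L = norm (H z0) ^ 4 / 2"
  have L: "L > 0" using z0 by (simp add: L_def)
  \<comment> \<open>C serves the upper bound; |ln L| and the last summand absorb the two factors L
    and exp (-3M) of \<open>large_value_on_arc\<close>, with M = C (2R)^d since the circle lies in
    |z| \<le> 2R.\<close>
  define C' where "C' = C + \<bar>ln L\<bar> + 3 * (C * 2 ^ d)"
  define X0 where "X0 = ln (2 * norm z0 + 2)"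
  have X0: "X0 \<ge> 0" unfolding X0_def by simp
  have expX: "exp X \<ge> 2 * norm z0 + 2" if "X \<ge> X0" for X
  proof -
    have "exp X0 \<le> exp X" using that by simp
    moreover have "2 * norm z0 + 2 > 0" by (intro add_nonneg_pos) auto
    ultimately show ?thesis by (simp add: X0_def)
  qed
  have expd: "exp (real d * x) = exp x ^ d" for x :: real by (simp add: exp_of_nat_mult)
  show ?thesis
  proof (rule that[of C' X0 0])
    show "C' > 0" using C by (simp add: C'_def add_pos_nonneg)
    fix s :: complex assume s: "Re s \<ge> X0"
    hence "norm (H (exp s)) \<le> exp (C * exp (Re s) ^ d)" using C(2)[of "exp s"] X0 by simp
    also have "\<dots> \<le> exp (C' * exp (Re s) ^ d)" using C by (simp add: C'_def)
    finally show "norm (H (exp s) * exp (- of_nat 0 * s)) \<le> exp (C' * exp (real d * Re s))" by (simp add: expd)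
  next
    fix X y :: real assume X: "X \<ge> X0"
    define R where "R = exp X"
    have R: "R \<ge> 2 * norm z0 + 2" "R > 0" using expX[OF X] by (auto simp: R_def)
    have "norm (H z) \<le> exp (C * 2 ^ d * R ^ d)" if "dist z0 z = R" for z
    proof -
      have "norm z \<ge> 1" "norm z \<le> 2 * R"
        using that R norm_triangle_ineq[of z0 "z - z0"] norm_triangle_ineq2[of "z - z0" "- z0"]
        by (auto simp: dist_norm norm_minus_commute)
      hence "C * norm z ^ d \<le> C * (2 * R) ^ d" using C by (intro mult_left_mono power_mono) auto
      hence "exp (C * norm z ^ d) \<le> exp (C * 2 ^ d * R ^ d)" by (simp add: power_mult_distrib mult.assoc)
      with C(2)[OF \<open>norm z \<ge> 1\<close>] show ?thesis by linarith
    qed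
    from large_value_on_arc[OF ent z0 R(2) this, of y]
    obtain t where t: "\<bar>t - y\<bar> \<le> 1" "norm (H (z0 + of_real R * cis t)) \<ge> L * exp (- 3 * (C * 2 ^ d * R ^ d))"
      unfolding L_def by blast
    \<comment> \<open>The large value lies on a circle about z0 and not about 0. Writing the point
      as R cis t (1 + u) with |u| < 1/2, its logarithm differs from X + it by Ln (1 + u), of modulus
      at most 1; this explains the tolerances 1 for the real part and 2 = 1 + 1 for the imaginary
      part.\<close>
    define u where "u = z0 / (of_real R * cis t)"
    have u: "norm u < 1 / 2" using R by (simp add: u_def norm_divide norm_mult field_simps)
    define a where "a = Complex X t + Ln (1 + u)"
    have "norm (Ln (1 + u)) \<le> 1" using norm_Ln_le[OF u] u by simp
    hence a: "\<bar>Re a - X\<bar> \<le> 1" "\<bar>Im a - t\<bar> \<le> 1"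
      using abs_Re_le_cmod[of "Ln (1 + u)"] abs_Im_le_cmod[of "Ln (1 + u)"] by (auto simp: a_def)
    have "1 + u \<noteq> 0"
    proof
      assume "1 + u = 0"
      hence "u = - 1" using add.inverse_unique[of 1 u] by simp
      thus False using u by simp
    qed
    hence "exp (Ln (1 + u)) = 1 + u" by (rule exp_Ln)
    moreover have "exp (Complex X t) = of_real R * cis t" by (simp add: exp_eq_polar R_def)
    ultimately have "exp a = of_real R * cis t * (1 + u)" by (simp only: a_def exp_add)
    also have "\<dots> = z0 + of_real R * cis t" using R by (simp add: u_def field_simps)
    finally have ea: "exp a = z0 + of_real R * cis t" .
    have R1: "R ^ d \<ge> 1" using R norm_ge_zero[of z0] by (intro one_le_power) linarith
    have "exp (- C' * R ^ d) \<le> exp (- \<bar>ln L\<bar> * 1) * exp (- 3 * (C * 2 ^ d * R ^ d))"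
    proof -
      have "\<bar>ln L\<bar> * 1 \<le> \<bar>ln L\<bar> * R ^ d" using R1 by (intro mult_left_mono) auto
      hence "- C' * R ^ d \<le> - \<bar>ln L\<bar> * 1 + - 3 * (C * 2 ^ d * R ^ d)"
      proof -
        have "C * R ^ d \<ge> 0" using C(1) R1 by simp
        moreover have "C' * R ^ d = C * R ^ d + \<bar>ln L\<bar> * R ^ d + 3 * (C * 2 ^ d * R ^ d)"
          by (simp add: C'_def algebra_simps)
        ultimately show ?thesis using \<open>\<bar>ln L\<bar> * 1 \<le> \<bar>ln L\<bar> * R ^ d\<close> by simp
      qed
      thus ?thesis by (simp only: exp_le_cancel_iff exp_add[symmetric])
    qed
    also have "exp (- \<bar>ln L\<bar> * 1) \<le> exp (ln L)" by (subst exp_le_cancel_iff) auto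
    also have "exp (ln L) = L" using L by simp
    finally have "exp (- C' * R ^ d) \<le> norm (H (exp a))" using t(2) unfolding ea by simp
    thus "\<exists>a. \<bar>Re a - X\<bar> \<le> 1 \<and> \<bar>Im a - y\<bar> \<le> 2 \<and>
        norm (H (exp a) * exp (- of_nat 0 * a)) \<ge> exp (- C' * exp (real d * X))"
      using a t(1) by (intro exI[of _ a]) (auto simp: expd R_def)
  qed
qed

text \<open>The constants come from \<open>local_factorization\<close> with radius 5 about a point at distance at most 3 from \<open>a\<close>:
  \<open>30 = 6 * 5\<close> and \<open>7 = 2 * 5 - 3\<close>.\<close>

definition log_factor_data ::
  "(complex \<Rightarrow> complex) \<Rightarrow> real \<Rightarrow> complex \<Rightarrow> complex set \<Rightarrow> (complex \<Rightarrow> nat) \<Rightarrow> (complex \<Rightarrow> complex) \<Rightarrow> bool" where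
  "log_factor_data G M a Z m h \<longleftrightarrow> finite Z \<and> (\<forall>\<zeta>\<in>Z. m \<zeta> > 0) \<and> real (\<Sum>\<zeta>\<in>Z. m \<zeta>) \<le> M \<and>
     h holomorphic_on ball a 7 \<and>
     (\<forall>s\<in>ball a 7. G s = (\<Prod>\<zeta>\<in>Z. ((s - \<zeta>) / 30) ^ m \<zeta>) * exp (h s)) \<and>
     (\<forall>s\<in>ball a 7. \<forall>s'\<in>ball a 7. norm (h s - h s') \<le> M) \<and> (\<forall>s\<in>ball a 7. Re (h s) \<ge> - M)"

definition log_factored :: "(complex \<Rightarrow> complex) \<Rightarrow> real \<Rightarrow> complex \<Rightarrow> bool" where
  "log_factored G M a \<longleftrightarrow> (\<exists>Z m h. log_factor_data G M a Z m h)"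

lemma log_factor_dataD:
  assumes "log_factor_data G M a Z m h"
  shows "finite Z" "\<And>\<zeta>. \<zeta> \<in> Z \<Longrightarrow> m \<zeta> > 0" "real (\<Sum>\<zeta>\<in>Z. m \<zeta>) \<le> M" "h holomorphic_on ball a 7"
    "\<And>s. s \<in> ball a 7 \<Longrightarrow> G s = (\<Prod>\<zeta>\<in>Z. ((s - \<zeta>) / 30) ^ m \<zeta>) * exp (h s)"
    "\<And>s s'. s \<in> ball a 7 \<Longrightarrow> s' \<in> ball a 7 \<Longrightarrow> norm (h s - h s') \<le> M"
    "\<And>s. s \<in> ball a 7 \<Longrightarrow> Re (h s) \<ge> - M"
  using assms unfolding log_factor_data_def by (simp_all only: simp_thms)

text \<open>The factorization is applied to H (exp s) exp (-k s), and k s is put back into the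
  exponent, where it changes the oscillation on a disc of radius 7 by at most 14k. In the upper
  bound the same factor is of size exp (k X), hence the X there and only there.\<close>

lemma exp_poly_log_factored:
  assumes H: "exp_poly_order_le H d" and nz: "\<exists>z. H z \<noteq> 0"
  obtains C X0 where "C > 0" "X0 \<ge> 1"
    "\<And>X s. X \<ge> X0 \<Longrightarrow> \<bar>Re s - X\<bar> \<le> 4 \<Longrightarrow> norm (H (exp s)) \<le> exp (C * (X * exp (real d * X)))"
    "\<And>X y. X \<ge> X0 \<Longrightarrow> log_factored (\<lambda>s. H (exp s)) (C * exp (real d * X)) (Complex X y)"
proof -
  have ent: "H holomorphic_on UNIV" using H exp_poly_entire unfolding exp_poly_order_le_def by blast
  obtain k :: nat and C X0 where C: "C > 0"
    and up: "\<And>s. Re s \<ge> X0 \<Longrightarrow> norm (H (exp s) * exp (- of_nat k * s)) \<le> exp (C * exp (real d * Re s))"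
    and lo: "\<And>X y. X \<ge> X0 \<Longrightarrow> \<exists>a. \<bar>Re a - X\<bar> \<le> 1 \<and> \<bar>Im a - y\<bar> \<le> 2 \<and>
        norm (H (exp a) * exp (- of_nat k * a)) \<ge> exp (- C * exp (real d * X))"
    by (rule exp_poly_large_values[OF H nz]) blast
  define F where "F s = H (exp s) * exp (- of_nat k * s)" for s
  have Fhol: "F holomorphic_on UNIV" unfolding F_def
    by (intro holomorphic_intros holomorphic_on_compose_gen[OF _ ent, unfolded o_def]) auto
  \<comment> \<open>46 = 9 * 5 + 1: the disc of radius 45 on which an upper bound is needed has its
    centre at horizontal distance at most 1 from X.\<close>
  define D where "D = exp (real d * 46)"
  have D: "D \<ge> 1" by (simp add: D_def)
  \<comment> \<open>The first two summands pay for the oscillation 24M + 14k of the new exponent,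
    the last two for the upper bound on H.\<close>
  define C' where "C' = 24 * C * D + 14 * k + 5 * k + C * D"
  define X1 where "X1 = \<bar>X0\<bar> + 50"
  have ge1: "exp (real d * X) \<ge> 1" if "X \<ge> X1" for X using that by (simp add: X1_def)
  show ?thesis
  proof (rule that[of C' X1])
    show "C' > 0" using C D by (simp add: C'_def add_pos_nonneg)
    show "X1 \<ge> 1" by (simp add: X1_def)
  next
    fix X :: real and s :: complex assume X: "X \<ge> X1" and s: "\<bar>Re s - X\<bar> \<le> 4"
    have "norm (H (exp s)) = norm (H (exp s) * exp (- of_nat k * s)) * exp (real k * Re s)"
      by (simp add: norm_mult mult.assoc exp_add[symmetric])
    also have "\<dots> \<le> exp (C * exp (real d * Re s)) * exp (real k * Re s)"
      using X s by (intro mult_right_mono up) (auto simp: X1_def)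
    also have "\<dots> \<le> exp (C * (D * exp (real d * X)) * X) * exp (real k * (5 * X) * exp (real d * X))"
    proof (intro mult_mono)
      have "exp (real d * Re s) \<le> exp (real d * 46 + real d * X)"
      proof -
        have "real d * Re s \<le> real d * (46 + X)" using s by (intro mult_left_mono) auto
        thus ?thesis by (simp add: algebra_simps)
      qed
      also have "\<dots> = D * exp (real d * X)" by (simp add: D_def exp_add)
      finally have 1: "C * exp (real d * Re s) \<le> C * (D * exp (real d * X))" using C by simp
      have "C * (D * exp (real d * X)) * 1 \<le> C * (D * exp (real d * X)) * X"
        using X C D by (intro mult_left_mono) (auto simp: X1_def)
      with 1 show "exp (C * exp (real d * Re s)) \<le> exp (C * (D * exp (real d * X)) * X)" by simp
      have "real k * Re s * 1 \<le> real k * (5 * X) * exp (real d * X)"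
        using s X ge1[OF X] by (intro mult_mono) (auto simp: X1_def)
      thus "exp (real k * Re s) \<le> exp (real k * (5 * X) * exp (real d * X))" by simp
    qed auto
    also have "\<dots> = exp ((C * D + 5 * k) * (X * exp (real d * X)))"
      by (simp add: exp_add[symmetric] algebra_simps)
    also have "\<dots> \<le> exp (C' * (X * exp (real d * X)))"
    proof -
      have "C * D + 5 * k \<le> C'" using C D by (simp add: C'_def add_increasing2 add_increasing)
      hence "(C * D + 5 * k) * (X * exp (real d * X)) \<le> C' * (X * exp (real d * X))"
        using X by (intro mult_right_mono) (auto simp: X1_def)
      thus ?thesis by simp
    qed
    finally show "norm (H (exp s)) \<le> exp (C' * (X * exp (real d * X)))" .
  next
    fix X y :: real assume X: "X \<ge> X1"
    obtain a where a: "\<bar>Re a - X\<bar> \<le> 1" "\<bar>Im a - y\<bar> \<le> 2" "norm (F a) \<ge> exp (- C * exp (real d * X))"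
    proof -
      have "X0 \<le> X" using X by (simp add: X1_def)
      from lo[OF this, of y] show ?thesis using that unfolding F_def by blast
    qed
    have da: "dist a (Complex X y) \<le> 3"
      using cmod_le[of "a - Complex X y"] a by (simp add: dist_norm)
    define M where "M = C * D * exp (real d * X)"
    have M: "M > 0" using C D by (simp add: M_def)
    obtain Z m h where Z: "finite Z" "\<And>\<zeta>. \<zeta> \<in> Z \<Longrightarrow> m \<zeta> > (0::nat)" "real (\<Sum>\<zeta>\<in>Z. m \<zeta>) \<le> 3 * M"
      and h: "h holomorphic_on ball a (3 * 5)"
      and fac: "\<And>s. s \<in> ball a (3 * 5) \<Longrightarrow> F s = (\<Prod>\<zeta>\<in>Z. ((s - \<zeta>) / of_real (6 * 5)) ^ m \<zeta>) * exp (h s)"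
      and hd: "\<And>s s'. dist a s \<le> 2 * 5 \<Longrightarrow> dist a s' \<le> 2 * 5 \<Longrightarrow> norm (h s - h s') \<le> 24 * M"
      and hR: "\<And>s. dist a s \<le> 2 * 5 \<Longrightarrow> Re (h s) \<ge> - 13 * M"
    proof (rule local_factorization[of F 5 M a])
      fix s assume "dist a s \<le> 9 * 5"
      hence "\<bar>Re s - Re a\<bar> \<le> 45" using abs_Re_le_cmod[of "s - a"] by (simp add: dist_norm norm_minus_commute)
      hence s: "Re s \<le> X + 46" "Re s \<ge> X0" using a X by (auto simp: X1_def)
      have "norm (F s) \<le> exp (C * exp (real d * Re s))" unfolding F_def by (rule up[OF s(2)])
      also have "exp (real d * Re s) \<le> exp (real d * (46 + X))" using s by (simp add: mult_left_mono)
      also have "\<dots> = D * exp (real d * X)" by (simp add: D_def exp_add algebra_simps)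
      finally show "norm (F s) \<le> exp M" using C by (simp add: M_def mult.assoc)
    next
      have "C * 1 * exp (real d * X) \<le> M" unfolding M_def using C D by (intro mult_right_mono mult_left_mono) auto
      hence "exp (- M) \<le> exp (- C * exp (real d * X))" by simp
      thus "exp (- M) \<le> norm (F a)" using a(3) by linarith
    qed (use Fhol M in \<open>auto\<close>)
    have ball: "dist a s \<le> 2 * 5" "s \<in> ball a (3 * 5)" if "s \<in> ball (Complex X y) 7" for s
      using that da dist_triangle[of a s "Complex X y"] by (auto simp: dist_commute)
    define h' where "h' s = h s + of_nat k * s" for s
    define M' where "M' = C' * exp (real d * X)"
    have M': "24 * M + 14 * k \<le> M'"
    proof -
      have "14 * real k * 1 \<le> 14 * real k * exp (real d * X)" using ge1[OF X] by (intro mult_left_mono) auto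
      moreover have "5 * real k * exp (real d * X) + C * D * exp (real d * X) \<ge> 0" using C D by simp
      ultimately show ?thesis by (simp add: M'_def M_def C'_def algebra_simps)
    qed
    show "log_factored (\<lambda>s. H (exp s)) (C' * exp (real d * X)) (Complex X y)"
      unfolding log_factored_def log_factor_data_def M'_def[symmetric]
    proof (intro exI[of _ Z] exI[of _ m] exI[of _ h'] conjI ballI)
      show "real (\<Sum>\<zeta>\<in>Z. m \<zeta>) \<le> M'" using Z(3) M' M by linarith
      show "h' holomorphic_on ball (Complex X y) 7" unfolding h'_def
        by (intro holomorphic_intros holomorphic_on_subset[OF h]) (use ball in auto)
      fix s assume s: "s \<in> ball (Complex X y) 7"
      have "H (exp s) = F s * exp (of_nat k * s)" by (simp add: F_def mult.assoc exp_add[symmetric])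
      also have "\<dots> = (\<Prod>\<zeta>\<in>Z. ((s - \<zeta>) / 30) ^ m \<zeta>) * exp (h' s)"
        unfolding fac[OF ball(2)[OF s]] h'_def by (simp add: exp_add)
      finally show "H (exp s) = (\<Prod>\<zeta>\<in>Z. ((s - \<zeta>) / 30) ^ m \<zeta>) * exp (h' s)" .
      have "\<bar>Re s - X\<bar> \<le> 7" using s abs_Re_le_cmod[of "s - Complex X y"] by (simp add: dist_norm norm_minus_commute)
      hence "Re s \<ge> 0" using X by (simp add: X1_def)
      hence "Re (h' s) \<ge> - 13 * M" using hR[OF ball(1)[OF s]] by (simp add: h'_def add_increasing2)
      thus "- M' \<le> Re (h' s)" using M' M by linarith
      fix s' assume s': "s' \<in> ball (Complex X y) 7"
      have "norm (s - s') \<le> 14" using s s' dist_triangle2[of s s' "Complex X y"] by (simp add: dist_norm norm_minus_commute)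
      hence "norm (of_nat k * (s - s') :: complex) \<le> real k * 14" unfolding norm_mult by (simp add: mult_left_mono)
      moreover have "h' s - h' s' = (h s - h s') + of_nat k * (s - s')" by (simp add: h'_def algebra_simps)
      ultimately show "norm (h' s - h' s') \<le> M'"
        using norm_triangle_ineq[of "h s - h s'" "of_nat k * (s - s')"] hd[OF ball(1)[OF s] ball(1)[OF s']] M' by simp
    qed (use Z in auto)
  qed
qed

subsection \<open>Dominant terms\<close>

lemma log_factored_mono: "log_factored G M a \<Longrightarrow> M \<le> M' \<Longrightarrow> log_factored G M' a"
proof -
  assume "log_factored G M a" and M: "M \<le> M'"
  then obtain Z m h where D: "log_factor_data G M a Z m h" unfolding log_factored_def by blast
  have "log_factor_data G M' a Z m h"
    unfolding log_factor_data_def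
    using log_factor_dataD[OF D] M by (intro conjI ballI; fastforce)
  thus ?thesis unfolding log_factored_def by blast
qed

text \<open>A 1-Lipschitz \<phi> covers both Re and Im, so that horizontal and vertical lines are
  found by the same argument. On a level line far from every value \<open>\<phi> \<zeta>\<close>,
  each linear factor is bounded below and the total multiplicity is at most M.\<close>

lemma log_factored_good_line:
  assumes G: "log_factored G M a" and \<beta>: "0 < \<beta>" "\<beta> \<le> 1" and M: "M \<ge> 0"
    and \<phi>: "\<And>s s'. \<bar>\<phi> s - \<phi> s'\<bar> \<le> norm (s - s')"
  obtains t where "b \<le> t" "t \<le> b + \<beta>"
    "\<And>s. s \<in> ball a 7 \<Longrightarrow> \<phi> s = t \<Longrightarrow> norm (G s) \<ge> exp (- M * (1 + ln (60 * (M + 1) / \<beta>)))"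
proof -
  obtain Z m h where D: "log_factor_data G M a Z m h" using G unfolding log_factored_def by blast
  note Z = log_factor_dataD(1-3)[OF D] and fac = log_factor_dataD(5)[OF D] and h = log_factor_dataD(7)[OF D]
  obtain t where t: "b \<le> t" "t \<le> b + \<beta>" "\<And>\<zeta>. \<zeta> \<in> Z \<Longrightarrow> \<beta> / (2 * (real (card Z) + 1)) \<le> \<bar>t - \<phi> \<zeta>\<bar>"
    using exists_far_point[OF Z(1) \<beta>(1), of b \<phi>] by blast
  have "card Z \<le> (\<Sum>\<zeta>\<in>Z. m \<zeta>)"
    using sum_mono[of Z "\<lambda>_. 1" m] Z(2) by (force simp: Suc_leI)
  hence card: "real (card Z) \<le> M" using Z(3) by linarith
  \<comment> \<open>Lower bound for one factor |s - \<zeta>| / 30: the distance \<beta> / (2 (card Z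
    + 1)) divided by 30, with \<open>card Z\<close> at most M.\<close>
  define c where "c = \<beta> / (60 * (M + 1))"
  have c: "c > 0" "c \<le> 1" using \<beta> M by (auto simp: c_def field_simps)
  have "norm (G s) \<ge> exp (- M * (1 + ln (60 * (M + 1) / \<beta>)))" if s: "s \<in> ball a 7" "\<phi> s = t" for s
  proof -
    have "exp (- M * ln (1 / c)) \<le> exp (- real (\<Sum>\<zeta>\<in>Z. m \<zeta>) * ln (1 / c))"
      using c Z(3) by (simp add: mult_right_mono)
    also have "\<dots> = c ^ (\<Sum>\<zeta>\<in>Z. m \<zeta>)"
      using c by (simp add: ln_div flip: powr_realpow) (simp add: powr_def)
    also have "\<dots> = (\<Prod>\<zeta>\<in>Z. c ^ m \<zeta>)" by (simp add: power_sum)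
    also have "\<dots> \<le> (\<Prod>\<zeta>\<in>Z. norm (((s - \<zeta>) / 30) ^ m \<zeta>))"
    proof (intro prod_mono conjI)
      fix \<zeta> assume "\<zeta> \<in> Z"
      have "c \<le> \<beta> / (2 * (real (card Z) + 1)) / 30"
        unfolding c_def divide_divide_eq_left using \<beta> card by (intro divide_left_mono) auto
      also have "\<beta> / (2 * (real (card Z) + 1)) \<le> norm (s - \<zeta>)"
        using t(3)[OF \<open>\<zeta> \<in> Z\<close>] \<phi>[of s \<zeta>] s(2) by linarith
      hence "\<beta> / (2 * (real (card Z) + 1)) / 30 \<le> norm ((s - \<zeta>) / 30)"
        unfolding norm_divide norm_numeral by (rule divide_right_mono) simp
      finally show "c ^ m \<zeta> \<le> norm (((s - \<zeta>) / 30) ^ m \<zeta>)"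
        using c by (simp only: norm_power power_mono less_imp_le)
    qed (use c in auto)
    finally have "exp (- M * ln (1 / c)) * exp (- M) \<le> (\<Prod>\<zeta>\<in>Z. norm (((s - \<zeta>) / 30) ^ m \<zeta>)) * exp (Re (h s))"
      using h[OF s(1)] by (intro mult_mono prod_nonneg) auto
    also have "\<dots> = norm (G s)" unfolding fac[OF s(1)] by (simp add: norm_mult prod_norm)
    finally show ?thesis by (simp add: c_def exp_add[symmetric] algebra_simps)
  qed
  with t show ?thesis using that by blast
qed

section \<open>The normalized sum in logarithmic coordinates\<close>

locale normalized_sum =
  fixes q p m :: nat and w :: "nat \<Rightarrow> complex"
    and H :: "nat \<Rightarrow> complex \<Rightarrow> complex" and f :: "complex \<Rightarrow> complex"
  assumes q: "1 \<le> q" and p: "1 \<le> p" and pq: "p \<le> q" and m: "1 \<le> m"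
    and w_inj: "inj_on w {..m}"
    and H_order: "\<And>j. j \<le> m \<Longrightarrow> exp_poly_order_le (H j) (q - p)"
    and H_nz: "\<And>j. 1 \<le> j \<Longrightarrow> j \<le> m \<Longrightarrow> \<exists>z. H j z \<noteq> 0"
    and f_eq: "\<And>z. f z = (\<Sum>j\<le>m. H j z * exp (w j * z ^ q))"
begin

abbreviation A :: "nat set" where "A \<equiv> active_indices m H"

text \<open>With \<open>r = exp X\<close>, \<open>growth X\<close> and \<open>width X\<close> are \<open>r ^ (q - p)\<close> and \<open>log r / r ^ p\<close>.\<close>

definition growth :: "real \<Rightarrow> real" where "growth X = exp (real (q - p) * X)"

definition width :: "real \<Rightarrow> real" where "width X = X * exp (- real p * X)"

definition g :: "complex \<Rightarrow> complex" where "g s = f (exp s)"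

text \<open>Difference of two of the sinusoids whose maximum is the indicator; multiplied by
  \<open>exp (q * Re s)\<close> it is the logarithm of the modulus of the ratio of the two
  exponentials.\<close>

definition gap :: "nat \<Rightarrow> nat \<Rightarrow> real \<Rightarrow> real" where "gap l j y = Re ((w l - w j) * cis (real q * y))"

definition wexp :: "nat \<Rightarrow> complex \<Rightarrow> complex" where "wexp j s = exp (w j * exp (of_nat q * s))"

lemma A_fin: "finite A" and A_le: "j \<in> A \<Longrightarrow> j \<le> m" and one_in_A: "1 \<in> A"
  using H_nz m by (auto simp: active_indices_def)

lemma card_A: "card A \<ge> 1"
  using A_fin one_in_A by (metis One_nat_def Suc_leI card_gt_0_iff empty_iff)

lemma H_entire: "j \<le> m \<Longrightarrow> H j holomorphic_on B"
  using H_order exp_poly_entire unfolding exp_poly_order_le_def by blast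

lemma Hexp_entire: "j \<le> m \<Longrightarrow> (\<lambda>s. H j (exp s)) holomorphic_on B"
  by (intro holomorphic_on_compose_gen[OF _ H_entire[where B = UNIV], unfolded o_def] holomorphic_intros) auto

lemma f_entire: "f holomorphic_on B"
proof -
  have "f = (\<lambda>z. \<Sum>j\<le>m. H j z * exp (w j * z ^ q))" using f_eq by blast
  thus ?thesis by (auto intro!: holomorphic_intros H_entire)
qed

lemma g_entire: "g holomorphic_on B"
  unfolding g_def by (intro holomorphic_on_compose_gen[OF _ f_entire[where B = UNIV], unfolded o_def] holomorphic_intros) auto

lemma g_eq: "g s = (\<Sum>j\<in>A. H j (exp s) * wexp j s)"
proof -
  have "g s = (\<Sum>j\<le>m. H j (exp s) * wexp j s)"
    by (simp add: g_def f_eq wexp_def exp_of_nat_mult)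
  also have "\<dots> = (\<Sum>j\<in>A. H j (exp s) * wexp j s)"
    by (rule sum.mono_neutral_right) (auto simp: active_indices_def)
  finally show ?thesis .
qed

lemma wexp_entire: "wexp j holomorphic_on B" unfolding wexp_def by (intro holomorphic_intros)

lemma wexp_ratio: "wexp l s / wexp j s = exp ((w l - w j) * exp (of_nat q * s))"
  by (simp add: wexp_def exp_diff[symmetric] algebra_simps)

lemma norm_wexp_ratio: "norm (wexp l s / wexp j s) = exp (exp (real q * Re s) * gap l j (Im s))"
proof -
  have "exp (of_nat q * s) = of_real (exp (real q * Re s)) * cis (real q * Im s)"
    by (simp add: exp_eq_polar)
  thus ?thesis by (simp add: wexp_ratio gap_def mult.left_commute[of _ "of_real _"])
qed

lemma growth_ge1: "X \<ge> 0 \<Longrightarrow> growth X \<ge> 1" by (simp add: growth_def)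

text \<open>The identity behind the shape of the strip: at distance \<open>width X\<close> from a
  critical ray the exponentials separate by an exponent of order \<open>X * growth X\<close>, the
  order of the logarithmic bounds for the coefficients.\<close>

lemma exp_q_width: "exp (real q * X) * width X = X * growth X"
proof -
  have "real (q - p) * X = real q * X + - real p * X" using pq by (simp add: of_nat_diff algebra_simps)
  hence "growth X = exp (real q * X) * exp (- real p * X)" by (simp only: growth_def exp_add)
  thus ?thesis by (simp add: width_def)
qed

lemma width_pos: "X > 0 \<Longrightarrow> width X > 0" by (simp add: width_def)

lemma width_le1: "X \<ge> 0 \<Longrightarrow> width X \<le> 1"
proof -
  assume X: "X \<ge> 0"
  have "X * 1 \<le> X * real p" using p X by (intro mult_left_mono) auto
  hence "X \<le> exp (real p * X)" using exp_ge_add_one_self[of "real p * X"] by (simp only: mult.commute mult_1_right)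
  thus ?thesis by (simp add: width_def exp_minus divide_simps)
qed

lemma uniform_constants:
  obtains C X0 where "C > 0" "X0 \<ge> 1"
    "\<And>j X s. j \<in> A \<Longrightarrow> X \<ge> X0 \<Longrightarrow> \<bar>Re s - X\<bar> \<le> 4 \<Longrightarrow> norm (H j (exp s)) \<le> exp (C * (X * growth X))"
    "\<And>j X y. j \<in> A \<Longrightarrow> X \<ge> X0 \<Longrightarrow> log_factored (\<lambda>s. H j (exp s)) (C * growth X) (Complex X y)"
proof -
  define ok where "ok j c x \<longleftrightarrow> c > 0 \<and> x \<ge> 1 \<and>
    (\<forall>X s. X \<ge> x \<longrightarrow> \<bar>Re s - X\<bar> \<le> 4 \<longrightarrow> norm (H j (exp s)) \<le> exp (c * (X * growth X))) \<and>
    (\<forall>X y. X \<ge> x \<longrightarrow> log_factored (\<lambda>s. H j (exp s)) (c * growth X) (Complex X y))" for j c x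
  have "\<exists>c x. ok j c x" if "j \<in> A" for j
  proof -
    have j: "j \<le> m" "\<exists>z. H j z \<noteq> 0" using that by (auto simp: active_indices_def)
    show ?thesis
      by (rule exp_poly_log_factored[OF H_order[OF j(1)] j(2)]) (unfold ok_def growth_def, blast)
  qed
  then obtain c x where "\<And>j. j \<in> A \<Longrightarrow> ok j (c j) (x j)" by metis
  hence c: "\<And>j. j \<in> A \<Longrightarrow> c j > (0::real)" and x: "\<And>j. j \<in> A \<Longrightarrow> x j \<ge> (1::real)"
    and up: "\<And>j X s. j \<in> A \<Longrightarrow> X \<ge> x j \<Longrightarrow> \<bar>Re s - X\<bar> \<le> 4 \<Longrightarrow> norm (H j (exp s)) \<le> exp (c j * (X * growth X))"
    and lf: "\<And>j X y. j \<in> A \<Longrightarrow> X \<ge> x j \<Longrightarrow> log_factored (\<lambda>s. H j (exp s)) (c j * growth X) (Complex X y)"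
    unfolding ok_def by blast+
  \<comment> \<open>A sum of positive constants dominates each of them, so one pair serves all
    active indices.\<close>
  define C where "C = (\<Sum>j\<in>A. c j)"
  define X0 where "X0 = (\<Sum>j\<in>A. x j)"
  have Cj: "c j \<le> C" if "j \<in> A" for j
    unfolding C_def using A_fin that c by (intro member_le_sum) (auto intro: less_imp_le)
  have Xj: "x j \<le> X0" if "j \<in> A" for j
    unfolding X0_def using A_fin that x by (intro member_le_sum) (auto intro: order.trans[of 0 1])
  show ?thesis
  proof (rule that[of C X0])
    show "C > 0" using c[OF one_in_A] Cj[OF one_in_A] by linarith
    show X0: "X0 \<ge> 1" using x[OF one_in_A] Xj[OF one_in_A] by linarith
    fix j X assume j: "j \<in> A" and X: "X \<ge> X0"
    hence X': "X \<ge> x j" "X \<ge> 1" using Xj[OF j] X0 by auto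
    show "norm (H j (exp s)) \<le> exp (C * (X * growth X))" if "\<bar>Re s - X\<bar> \<le> 4" for s
    proof -
      have "c j * (X * growth X) \<le> C * (X * growth X)"
        using Cj[OF j] X' growth_ge1[of X] by (intro mult_right_mono mult_nonneg_nonneg) auto
      thus ?thesis using up[OF j X'(1) that] by (meson exp_le_cancel_iff order.trans)
    qed
    show "log_factored (\<lambda>s. H j (exp s)) (C * growth X) (Complex X y)" for y
      using log_factored_mono[OF lf[OF j X'(1)]] Cj[OF j] X' growth_ge1[of X] by (simp add: mult_right_mono)
  qed
qed

end

locale normalized_sum_constants = normalized_sum +
  fixes C X0 :: real
  assumes C: "C > 0" and X0: "X0 \<ge> 1"
    and H_up: "\<And>j X s. j \<in> A \<Longrightarrow> X \<ge> X0 \<Longrightarrow> \<bar>Re s - X\<bar> \<le> 4 \<Longrightarrow> norm (H j (exp s)) \<le> exp (C * (X * growth X))"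
    and H_fac: "\<And>j X y. j \<in> A \<Longrightarrow> X \<ge> X0 \<Longrightarrow> log_factored (\<lambda>s. H j (exp s)) (C * growth X) (Complex X y)"
begin

text \<open>The exponent M (1 + ln (60 (M + 1) / \<beta>)) of a good line, with M = C growth X and
  \<beta> \<ge> width X, is at most C1 X growth X, because 60 (M + 1) / \<beta> \<le> 60 (C + 1) exp
  (q X).\<close>

definition C1 :: real where "C1 = C * (1 + ln (60 * (C + 1)) + real q)"

lemma ln60: "ln (60 * (C + 1)) \<ge> 0" using C by simp

lemma C1_pos: "C1 > 0" using C ln60 by (auto simp: C1_def intro!: mult_pos_pos add_pos_nonneg)

text \<open>The room \<beta> for moving the line may shrink to \<open>width X\<close>: since ln (1 /
  \<beta>) is then O(X), the lower bound loses only a factor X in its exponent.\<close>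

lemma good_line:
  assumes j: "j \<in> A" and X: "X \<ge> X0" and \<beta>: "width X \<le> \<beta>" "\<beta> \<le> 1"
    and \<phi>: "\<And>s s'. \<bar>\<phi> s - \<phi> s'\<bar> \<le> norm (s - s' :: complex)"
  obtains t where "b \<le> t" "t \<le> b + \<beta>"
    "\<And>s. s \<in> ball (Complex X y) 7 \<Longrightarrow> \<phi> s = t \<Longrightarrow> norm (H j (exp s)) \<ge> exp (- C1 * (X * growth X))"
proof -
  have X1: "X \<ge> 1" using X X0 by simp
  define M where "M = C * growth X"
  have E1: "growth X \<ge> 1" using growth_ge1 X1 by simp
  have M: "M \<ge> 0" using C E1 by (simp add: M_def)
  have bp: "\<beta> > 0" using width_pos[of X] X1 \<beta> by linarith
  obtain t where t: "b \<le> t" "t \<le> b + \<beta>"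
    "\<And>s. s \<in> ball (Complex X y) 7 \<Longrightarrow> \<phi> s = t \<Longrightarrow> norm (H j (exp s)) \<ge> exp (- M * (1 + ln (60 * (M + 1) / \<beta>)))"
    using log_factored_good_line[OF H_fac[OF j X, folded M_def] bp \<beta>(2) M \<phi>] by blast
  have "60 * (M + 1) / \<beta> \<le> 60 * (C + 1) * growth X / width X"
  proof (intro frac_le)
    show "60 * (M + 1) \<le> 60 * (C + 1) * growth X" using E1 by (simp add: M_def algebra_simps)
  qed (use \<beta> width_pos X1 C E1 in auto)
  also have "\<dots> \<le> 60 * (C + 1) * exp (real q * X)"
  proof -
    have "growth X \<le> exp (real q * X) * width X" unfolding exp_q_width using X1 E1 by simp
    hence "60 * (C + 1) * growth X \<le> 60 * (C + 1) * (exp (real q * X) * width X)" using C by (intro mult_left_mono) auto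
    thus ?thesis using width_pos[of X] X1 by (simp add: divide_simps mult_ac)
  qed
  finally have "ln (60 * (M + 1) / \<beta>) \<le> ln (60 * (C + 1) * exp (real q * X))"
    using bp M C by (subst ln_le_cancel_iff) auto
  also have "\<dots> = ln (60 * (C + 1)) + real q * X" using C by (subst ln_mult) auto
  also have "\<dots> \<le> ln (60 * (C + 1)) * X + real q * X" using ln60 X1 by (simp add: mult_le_cancel_left1)
  finally have "1 + ln (60 * (M + 1) / \<beta>) \<le> X * (1 + ln (60 * (C + 1)) + real q)"
    using X1 by (simp add: algebra_simps)
  hence "M * (1 + ln (60 * (M + 1) / \<beta>)) \<le> M * (X * (1 + ln (60 * (C + 1)) + real q))" by (rule mult_left_mono[OF _ M])
  also have "\<dots> = C1 * (X * growth X)" by (simp add: M_def C1_def)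
  finally have "exp (- C1 * (X * growth X)) \<le> exp (- M * (1 + ln (60 * (M + 1) / \<beta>)))" by simp
  with t show ?thesis using that by (meson order.trans)
qed

text \<open>A gap of -K \<open>width X\<close> leaves every other term at most 1 / (2 card A) of the
  dominant one. The factor exp (2q) compensates for Re s \<ge> X - 2, C + C1 pays for the quotient
  of coefficients, and the logarithm for the final factor.\<close>

definition K :: real where "K = exp (2 * real q) * (C + C1 + ln (2 * real (card A)))"

lemma K_pos: "K > 0"
  unfolding K_def using C C1_pos card_A by (intro mult_pos_pos add_pos_nonneg) auto

text \<open>The two requirements have different sources: the first is secured by the choice of a
  good line, the second depends on the angle alone.\<close>

definition dominated :: "nat \<Rightarrow> real \<Rightarrow> complex \<Rightarrow> bool" where
  "dominated j X s \<longleftrightarrow> norm (H j (exp s)) \<ge> exp (- C1 * (X * growth X)) \<and> (\<forall>l\<in>A - {j}. gap l j (Im s) \<le> - K * width X)"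

lemma dominated_ratio:
  assumes j: "j \<in> A" and X: "X \<ge> X0" and s: "\<bar>Re s - X\<bar> \<le> 2" and dom: "dominated j X s"
  shows "H j (exp s) \<noteq> 0" "norm (g s / (H j (exp s) * wexp j s) - 1) \<le> 1 / 2" "g s \<noteq> 0"
proof -
  have X1: "X \<ge> 1" using X X0 by simp
  have E1: "growth X \<ge> 1" using growth_ge1 X1 by simp
  have XE: "X * growth X \<ge> 1" using mult_mono[of 1 X 1 "growth X"] X1 E1 by simp
  have lowj: "norm (H j (exp s)) \<ge> exp (- C1 * (X * growth X))" using dom by (simp add: dominated_def)
  thus Hj: "H j (exp s) \<noteq> 0" by (metis exp_gt_zero norm_zero not_less)
  have ewnz: "wexp j s \<noteq> 0" by (simp add: wexp_def)
  define N where "N = real (card A)"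
  have N: "N \<ge> 1" using card_A by (simp add: N_def)
  have "g s / (H j (exp s) * wexp j s) = (\<Sum>l\<in>A. (H l (exp s) / H j (exp s)) * (wexp l s / wexp j s))"
    by (simp add: g_eq sum_divide_distrib)
  also have "\<dots> = 1 + (\<Sum>l\<in>A - {j}. (H l (exp s) / H j (exp s)) * (wexp l s / wexp j s))"
    using Hj ewnz A_fin j by (subst sum.remove[of _ j]) auto
  finally have "g s / (H j (exp s) * wexp j s) - 1 = (\<Sum>l\<in>A - {j}. (H l (exp s) / H j (exp s)) * (wexp l s / wexp j s))" by simp
  also have "norm \<dots> \<le> (\<Sum>l\<in>A - {j}. 1 / (2 * N))"
  proof (rule sum_norm_le)
    fix l assume l: "l \<in> A - {j}"
    have "norm (H l (exp s) / H j (exp s)) \<le> exp (C * (X * growth X)) / exp (- C1 * (X * growth X))"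
      unfolding norm_divide using lowj H_up[of l X s] l X s by (intro frac_le) auto
    also have "\<dots> = exp ((C + C1) * (X * growth X))" by (simp add: exp_diff[symmetric] algebra_simps)
    finally have 1: "norm (H l (exp s) / H j (exp s)) \<le> exp ((C + C1) * (X * growth X))" .
    have "gap l j (Im s) \<le> - K * width X" using dom l by (simp add: dominated_def)
    hence "exp (real q * Re s) * gap l j (Im s) \<le> exp (real q * Re s) * (- K * width X)" by (intro mult_left_mono) auto
    also have "exp (real q * Re s) * (K * width X) \<ge> exp (real q * (X - 2)) * (K * width X)"
    proof (rule mult_right_mono)
      have "real q * (X - 2) \<le> real q * Re s" using s by (intro mult_left_mono) auto
      thus "exp (real q * (X - 2)) \<le> exp (real q * Re s)" by simp
    qed (use K_pos width_pos[of X] X1 in auto)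
    hence "exp (real q * Re s) * (- K * width X) \<le> - (exp (real q * (X - 2)) * (K * width X))" by simp
    also have "exp (real q * (X - 2)) * (K * width X) = (C + C1 + ln (2 * N)) * (exp (real q * X) * width X)"
      by (simp add: K_def N_def right_diff_distrib exp_diff mult_ac)
    also have "\<dots> = (C + C1 + ln (2 * N)) * (X * growth X)" by (simp only: exp_q_width)
    finally have 2: "norm (wexp l s / wexp j s) \<le> exp (- ((C + C1 + ln (2 * N)) * (X * growth X)))"
      unfolding norm_wexp_ratio by simp
    have "norm ((H l (exp s) / H j (exp s)) * (wexp l s / wexp j s))
        \<le> exp ((C + C1) * (X * growth X)) * exp (- ((C + C1 + ln (2 * N)) * (X * growth X)))"
      unfolding norm_mult using 1 2 by (intro mult_mono) auto
    also have "\<dots> = exp (- (ln (2 * N) * (X * growth X)))" by (simp add: exp_add[symmetric] algebra_simps)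
    also have "\<dots> \<le> exp (- ln (2 * N))"
      using N XE mult_left_mono[OF XE, of "ln (2 * N)"] by simp
    also have "\<dots> = 1 / (2 * N)" using N by (simp add: exp_minus inverse_eq_divide)
    finally show "norm ((H l (exp s) / H j (exp s)) * (wexp l s / wexp j s)) \<le> 1 / (2 * N)" .
  qed
  also have "\<dots> \<le> N * (1 / (2 * N))"
    using A_fin N by (simp add: N_def card_Diff1_le divide_right_mono)
  also have "\<dots> = 1 / 2" using N by simp
  finally show half: "norm (g s / (H j (exp s) * wexp j s) - 1) \<le> 1 / 2" .
  show "g s \<noteq> 0" using half by auto
qed

text \<open>pi C for the zeros of the coefficient, C for the oscillation of its exponent, and 2 pi
  for the factor close to 1.\<close>

definition C2 :: real where "C2 = (pi + 1) * C + 2 * pi"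

text \<open>g is split as coefficient times exponential times a factor within 1/2 of 1. The
  exponential contributes an exact increment, kept on the left so that it can cancel or accumulate
  around a rectangle. The rest is O(growth X), although the coefficient may be as small as exp (- C1
  X growth X).\<close>

lemma edge:
  assumes j: "j \<in> A" and X: "X \<ge> X0"
    and ab: "closed_segment a b \<subseteq> ball (Complex X y) 7"
    and dom: "\<And>s. s \<in> closed_segment a b \<Longrightarrow> \<bar>Re s - X\<bar> \<le> 2 \<and> dominated j X s"
  shows "\<bar>Im (logint g (linepath a b)) - Im (w j * (exp (of_nat q * b) - exp (of_nat q * a)))\<bar> \<le> C2 * growth X"
proof -
  have X1: "X \<ge> 1" using X X0 by simp
  have E1: "growth X \<ge> 1" using growth_ge1 X1 by simp
  have jm: "j \<le> m" using A_le j by blast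
  define B where "B = ball (Complex X y) 7"
  define Hj where "Hj s = H j (exp s)" for s
  have Hjhol: "Hj holomorphic_on S" for S unfolding Hj_def using Hexp_entire[OF jm] .
  obtain Z mm h where D: "log_factor_data Hj (C * growth X) (Complex X y) Z mm h"
    using H_fac[OF j X, of y] unfolding log_factored_def Hj_def by blast
  note Z = log_factor_dataD(1-3)[OF D] and h = log_factor_dataD(4)[OF D, folded B_def]
    and fac = log_factor_dataD(5)[OF D, folded B_def] and hd = log_factor_dataD(6)[OF D, folded B_def]
  note dr = dominated_ratio[OF j X]
  have Hjnz: "Hj s \<noteq> 0" if "s \<in> closed_segment a b" for s using dr(1) dom[OF that] by (simp add: Hj_def)
  define U where "U = {s. Hj s \<noteq> 0}"
  have U: "open U" unfolding U_def
    by (intro open_Collect_neq holomorphic_on_imp_continuous_on Hjhol continuous_intros)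
  define F1 where "F1 s = g s / (Hj s * wexp j s)" for s
  have F1: "F1 holomorphic_on U" unfolding F1_def
    by (intro holomorphic_intros g_entire Hjhol wexp_entire) (auto simp: U_def wexp_def)
  have segU: "path_image (linepath a b) \<subseteq> U" using Hjnz by (auto simp: U_def)
  have near: "norm (F1 s - 1) \<le> 1 / 2" if "s \<in> path_image (linepath a b)" for s
    using dr(2)[of s] dom[of s] that by (simp add: F1_def Hj_def)
  have F1nz: "F1 s \<noteq> 0" if "s \<in> path_image (linepath a b)" for s
    using near[OF that] by auto
  have "logint g (linepath a b) = logint (\<lambda>s. Hj s * (wexp j s * F1 s)) (linepath a b)"
    by (rule logint_cong_open[OF U segU]) (auto simp: F1_def U_def wexp_def)
  also have "\<dots> = logint Hj (linepath a b) + logint (\<lambda>s. wexp j s * F1 s) (linepath a b)"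
  proof (rule logint_mult[OF Hjhol _ U])
    show "(\<lambda>s. wexp j s * F1 s) holomorphic_on U" by (intro holomorphic_intros wexp_entire F1)
    show "Hj s \<noteq> 0" if "s \<in> path_image (linepath a b)" for s using Hjnz that by simp
    show "wexp j s * F1 s \<noteq> 0" if "s \<in> path_image (linepath a b)" for s using near[OF that] by (auto simp: wexp_def)
  qed (use segU in auto)
  also have "logint (\<lambda>s. wexp j s * F1 s) (linepath a b) = logint (wexp j) (linepath a b) + logint F1 (linepath a b)"
    using F1nz segU by (intro logint_mult[OF wexp_entire F1 U]) (auto simp: wexp_def)
  also have "logint (wexp j) (linepath a b) = w j * (exp (of_nat q * b) - exp (of_nat q * a))"
  proof -
    have "logint (\<lambda>s. exp (w j * exp (of_nat q * s))) (linepath a b)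
        = w j * exp (of_nat q * pathfinish (linepath a b)) - w j * exp (of_nat q * pathstart (linepath a b))"
      by (rule logint_exp[of _ UNIV]) (auto intro!: holomorphic_intros)
    thus ?thesis unfolding wexp_def[abs_def] by (simp add: algebra_simps)
  qed
  finally have eq: "Im (logint g (linepath a b)) - Im (w j * (exp (of_nat q * b) - exp (of_nat q * a)))
     = Im (logint Hj (linepath a b)) + Im (logint F1 (linepath a b))" by simp
  have "\<bar>Im (logint Hj (linepath a b))\<bar> \<le> pi * real (\<Sum>\<zeta>\<in>Z. mm \<zeta>) + norm (h b - h a)"
    by (rule logint_factored[OF Z(1,2) h]) (use ab fac Hjnz in \<open>auto simp: B_def\<close>)
  also have "\<dots> \<le> pi * (C * growth X) + C * growth X"
    using Z(3) hd[of b a] ab ends_in_segment[of a b] unfolding B_def by (intro add_mono mult_left_mono) (auto simp del: mem_ball)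
  finally have "\<bar>Im (logint Hj (linepath a b))\<bar> \<le> (pi + 1) * C * growth X" by (simp add: algebra_simps)
  moreover have "\<bar>Im (logint F1 (linepath a b))\<bar> \<le> 2 * pi"
    using near segU by (intro logint_near_one[OF F1 U]) auto
  moreover have "2 * pi * 1 \<le> 2 * pi * growth X" using E1 by (intro mult_left_mono) auto
  ultimately have "\<bar>Im (logint Hj (linepath a b)) + Im (logint F1 (linepath a b))\<bar> \<le> (pi + 1) * C * growth X + 2 * pi * growth X"
    by linarith
  thus ?thesis unfolding eq C2_def by (simp only: distrib_right)
qed

end

lemma horizontal_segment: "s \<in> closed_segment (Complex a y) (Complex b y) \<longleftrightarrow> Im s = y \<and> Re s \<in> closed_segment a b"
  by (simp add: closed_segment_same_Im)

lemma vertical_segment: "s \<in> closed_segment (Complex x a) (Complex x b) \<longleftrightarrow> Re s = x \<and> Im s \<in> closed_segment a b"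
  by (simp add: closed_segment_same_Re)

lemma norm_cis_diff_le: "norm (cis a - cis b) \<le> \<bar>a - b\<bar>"
proof -
  have "cis a - cis b = cis b * (exp (\<i> * of_real (a - b)) - 1)"
    by (simp add: cis_conv_exp algebra_simps exp_add[symmetric])
  hence "norm (cis a - cis b) = 2 * \<bar>sin ((a - b) / 2)\<bar>"
    by (simp only: norm_mult norm_cis mult_1_left dist_exp_i_1)
  also have "\<dots> \<le> \<bar>a - b\<bar>" using abs_sin_x_le_abs_x[of "(a - b) / 2"] by simp
  finally show ?thesis .
qed

section \<open>Rectangles away from the critical rays and around them\<close>

context normalized_sum_constants
begin

lemma C2_pos: "C2 > 0" unfolding C2_def using C by (intro add_nonneg_pos) auto

text \<open>The sides are moved to good lines: by at most \<open>width X\<close> at the two heights,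
  and by at most 1 to the left of X and to the right of X + 1. One and the same term dominates on
  all four, so the exact increments cancel around the rectangle and only four edge errors
  remain.\<close>

lemma window:
  assumes j: "j \<in> A" and X: "X \<ge> X0" and y: "y1 + 2 * width X < y2" "y2 \<le> y1 + 3"
    and gap: "\<And>l y. l \<in> A - {j} \<Longrightarrow> y1 \<le> y \<Longrightarrow> y \<le> y2 \<Longrightarrow> gap l j y \<le> - K * width X"
  shows "real_of_int (zero_count g {s. X \<le> Re s \<and> Re s \<le> X + 1 \<and> y1 + width X \<le> Im s \<and> Im s \<le> y2 - width X}) \<le> 4 * C2 * growth X"
    and "\<exists>s. g s \<noteq> 0"
proof -
  have X1: "X \<ge> 1" using X X0 by simp
  define \<beta> where "\<beta> = width X"
  have \<beta>: "0 < \<beta>" "\<beta> \<le> 1" using X1 width_pos[of X] width_le1[of X] by (auto simp: \<beta>_def)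
  define D where "D = ball (Complex X y1) 7"
  define good where "good s \<longleftrightarrow> norm (H j (exp s)) \<ge> exp (- C1 * (X * growth X))" for s
  have lip: "\<bar>Im s - Im s'\<bar> \<le> norm (s - s')" "\<bar>Re s - Re s'\<bar> \<le> norm (s - s')" for s s'
    using abs_Im_le_cmod[of "s - s'"] abs_Re_le_cmod[of "s - s'"] by auto
  note gl = good_line[OF j X, where y = y1, folded good_def D_def]
  obtain t1 where t1: "y1 \<le> t1" "t1 \<le> y1 + \<beta>" "\<And>s. s \<in> D \<Longrightarrow> Im s = t1 \<Longrightarrow> good s"
    using gl[of \<beta> Im y1] lip \<beta> unfolding \<beta>_def by blast
  obtain t2 where t2: "y2 - \<beta> \<le> t2" "t2 \<le> y2 - \<beta> + \<beta>" "\<And>s. s \<in> D \<Longrightarrow> Im s = t2 \<Longrightarrow> good s"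
    using gl[of \<beta> Im "y2 - \<beta>"] lip \<beta> unfolding \<beta>_def by blast
  obtain x1 where x1: "X - 1 \<le> x1" "x1 \<le> X - 1 + 1" "\<And>s. s \<in> D \<Longrightarrow> Re s = x1 \<Longrightarrow> good s"
    using gl[of 1 Re "X - 1"] lip \<beta> unfolding \<beta>_def by blast
  obtain x2 where x2: "X + 1 \<le> x2" "x2 \<le> X + 1 + 1" "\<And>s. s \<in> D \<Longrightarrow> Re s = x2 \<Longrightarrow> good s"
    using gl[of 1 Re "X + 1"] lip \<beta> unfolding \<beta>_def by blast
  have lt: "x1 < x2" "t1 < t2" using x1 x2 t1 t2 y by (auto simp: \<beta>_def)
  have bd: "s \<in> D \<and> \<bar>Re s - X\<bar> \<le> 2 \<and> dominated j X s"
    if s: "Re s \<in> {x1..x2}" "Im s \<in> {t1..t2}" "Re s = x1 \<or> Re s = x2 \<or> Im s = t1 \<or> Im s = t2" for s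
  proof -
    have 1: "\<bar>Re s - X\<bar> \<le> 2" "\<bar>Im s - y1\<bar> \<le> 3" using s x1 x2 t1 t2 y by (auto simp: \<beta>_def)
    hence D: "s \<in> D" using cmod_le[of "s - Complex X y1"] by (simp add: D_def dist_norm norm_minus_commute)
    moreover have "good s" using s(3) t1(3) t2(3) x1(3) x2(3) D by blast
    moreover have "gap l j (Im s) \<le> - K * width X" if "l \<in> A - {j}" for l
      using gap[OF that] s t1 t2 by auto
    ultimately show ?thesis using 1 unfolding dominated_def good_def by blast
  qed
  have nz: "g s \<noteq> 0" if "s \<in> cbox (Complex x1 t1) (Complex x2 t2) - box (Complex x1 t1) (Complex x2 t2)" for s
  proof -
    have "Re s \<in> {x1..x2}" "Im s \<in> {t1..t2}" "Re s = x1 \<or> Re s = x2 \<or> Im s = t1 \<or> Im s = t2"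
      using that by (auto simp: in_cbox_complex_iff in_box_complex_iff)
    thus ?thesis using bd dominated_ratio(3)[OF j X] by blast
  qed
  have e: "\<bar>Im (logint g (linepath a b)) - Im (w j * (exp (of_nat q * b) - exp (of_nat q * a)))\<bar> \<le> C2 * growth X"
    if "\<And>s. s \<in> closed_segment a b \<Longrightarrow> Re s \<in> {x1..x2} \<and> Im s \<in> {t1..t2} \<and> (Re s = x1 \<or> Re s = x2 \<or> Im s = t1 \<or> Im s = t2)" for a b
    by (rule edge[OF j X, where y = y1]) (use that bd in \<open>auto simp: D_def\<close>)
  have seg: "closed_segment x1 x2 = {x1..x2}" "closed_segment x2 x1 = {x1..x2}"
    "closed_segment t1 t2 = {t1..t2}" "closed_segment t2 t1 = {t1..t2}"
    using lt by (auto simp: closed_segment_eq_real_ivl)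
  \<comment> \<open>Potential of the dominant exponential; its differences over the four sides add
    up to zero.\<close>
  define \<Phi> where "\<Phi> s = Im (w j * exp (of_nat q * s))" for s
  have e': "\<bar>Im (logint g (linepath a b)) - (\<Phi> b - \<Phi> a)\<bar> \<le> C2 * growth X"
    if "\<And>s. s \<in> closed_segment a b \<Longrightarrow> Re s \<in> {x1..x2} \<and> Im s \<in> {t1..t2} \<and> (Re s = x1 \<or> Re s = x2 \<or> Im s = t1 \<or> Im s = t2)" for a b
    using e[OF that] by (simp add: \<Phi>_def right_diff_distrib)
  have "\<bar>Im (logint g (linepath (Complex x1 t1) (Complex x2 t1))) - (\<Phi> (Complex x2 t1) - \<Phi> (Complex x1 t1))\<bar> \<le> C2 * growth X"
    "\<bar>Im (logint g (linepath (Complex x2 t1) (Complex x2 t2))) - (\<Phi> (Complex x2 t2) - \<Phi> (Complex x2 t1))\<bar> \<le> C2 * growth X"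
    "\<bar>Im (logint g (linepath (Complex x2 t2) (Complex x1 t2))) - (\<Phi> (Complex x1 t2) - \<Phi> (Complex x2 t2))\<bar> \<le> C2 * growth X"
    "\<bar>Im (logint g (linepath (Complex x1 t2) (Complex x1 t1))) - (\<Phi> (Complex x1 t1) - \<Phi> (Complex x1 t2))\<bar> \<le> C2 * growth X"
    by (intro e'; use lt in \<open>auto simp: horizontal_segment vertical_segment seg\<close>)+
  moreover have "2 * pi * real_of_int (zero_count g (box (Complex x1 t1) (Complex x2 t2))) =
    Im (logint g (linepath (Complex x1 t1) (Complex x2 t1))) + Im (logint g (linepath (Complex x2 t1) (Complex x2 t2)))
    + Im (logint g (linepath (Complex x2 t2) (Complex x1 t2))) + Im (logint g (linepath (Complex x1 t2) (Complex x1 t1)))"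
    by (rule rect_argument_principle[OF g_entire lt nz])
  ultimately have "2 * pi * real_of_int (zero_count g (box (Complex x1 t1) (Complex x2 t2))) \<le> 4 * (C2 * growth X)"
    by linarith
  moreover show gnz: "\<exists>s. g s \<noteq> 0"
    using nz[of "Complex x1 t1"] lt by (auto simp: in_cbox_complex_iff in_box_complex_iff)
  have "zero_count g (box (Complex x1 t1) (Complex x2 t2)) \<ge> 0" by (rule zero_count_nonneg[OF g_entire gnz])
  hence "1 * real_of_int (zero_count g (box (Complex x1 t1) (Complex x2 t2))) \<le> 2 * pi * real_of_int (zero_count g (box (Complex x1 t1) (Complex x2 t2)))"
    using pi_gt3 by (intro mult_right_mono) auto
  moreover have "zero_count g {s. X \<le> Re s \<and> Re s \<le> X + 1 \<and> y1 + width X \<le> Im s \<and> Im s \<le> y2 - width X}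
      \<le> zero_count g (box (Complex x1 t1) (Complex x2 t2))"
  proof (rule zero_count_mono[OF g_entire gnz bounded_box])
    fix s assume s: "s \<in> {s. X \<le> Re s \<and> Re s \<le> X + 1 \<and> y1 + width X \<le> Im s \<and> Im s \<le> y2 - width X}" "g s = 0"
    have "s \<in> cbox (Complex x1 t1) (Complex x2 t2)"
      using s(1) x1 x2 t1 t2 by (auto simp: in_cbox_complex_iff \<beta>_def)
    thus "s \<in> box (Complex x1 t1) (Complex x2 t2)" using nz s(2) by blast
  qed
  ultimately show "real_of_int (zero_count g {s. X \<le> Re s \<and> Re s \<le> X + 1 \<and> y1 + width X \<le> Im s \<and> Im s \<le> y2 - width X}) \<le> 4 * C2 * growth X"
    by linarith
qed

text \<open>The two terms \<open>j\<close> and \<open>k\<close> are both maximal in the direction \<open>\<theta>\<close>; \<open>j\<close> dominates for slightly larger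
  angles and \<open>k\<close> for slightly smaller ones.\<close>

definition crit :: "real \<Rightarrow> nat \<Rightarrow> nat \<Rightarrow> real \<Rightarrow> real \<Rightarrow> bool" where
  "crit \<theta> j k \<delta> \<kappa> \<longleftrightarrow> j \<in> A \<and> k \<in> A \<and> 0 < \<delta> \<and> \<delta> \<le> 1 \<and> 0 < \<kappa> \<and> (\<forall>l\<in>A. gap l j \<theta> \<le> 0) \<and>
     (w k - w j) * cis (real q * \<theta>) = \<i> * of_real (norm (w j - w k)) \<and>
     (\<forall>t l. 0 < t \<longrightarrow> t \<le> 2 * \<delta> \<longrightarrow> l \<in> A - {j} \<longrightarrow> gap l j (\<theta> + t) \<le> - \<kappa> * t) \<and>
     (\<forall>t l. 0 < t \<longrightarrow> t \<le> 2 * \<delta> \<longrightarrow> l \<in> A - {k} \<longrightarrow> gap l k (\<theta> - t) \<le> - \<kappa> * t)"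

definition W :: real where "W = 2 * (\<Sum>l\<le>m. norm (w l))"

lemma W_bounds:
  assumes "l \<in> A" "j \<in> A"
  shows "norm (w l - w j) \<le> W" "norm (w j) \<le> W" "W \<ge> 0"
proof -
  have 1: "norm (w i) \<le> W / 2" if "i \<in> A" for i
    unfolding W_def using A_le[OF that] by (simp, intro member_le_sum) auto
  show "norm (w l - w j) \<le> W" using norm_triangle_ineq4[of "w l" "w j"] 1[OF assms(1)] 1[OF assms(2)] by linarith
  show "W \<ge> 0" unfolding W_def by (simp add: sum_nonneg)
  thus "norm (w j) \<le> W" using 1[OF assms(2)] by linarith
qed

lemma exp_q_Complex: "exp (of_nat q * s) = of_real (exp (real q * Re s)) * cis (real q * Im s)"
  by (simp add: exp_eq_polar)

text \<open>The logarithmic bound in \<open>vertical_edge\<close>: card A for the number of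
  summands, C for the coefficients, C1 + 1 for the lower bound at the centre (the 1 pays for a
  factor 1/2), and the last term for the growth of the exponential ratios over a distance 20 B
  \<open>width X\<close>.\<close>

definition C5 :: "real \<Rightarrow> real" where
  "C5 B = real (card A) + C + C1 + 1 + 20 * exp (2 * real q) * W * real q * B"

text \<open>Across a critical ray no term dominates, so the argument of g / \<open>wexp j\<close> is
  controlled by its zeros in a disc centred at a point where j does dominate. All gaps are
  nonpositive at \<theta> and Lipschitz in the angle; keeping the radius proportional to
  \<open>width X\<close> thus keeps the logarithmic bound at O(X growth X) instead of O(exp (q
  X)).\<close>

lemma vertical_edge:
  assumes j: "j \<in> A" and X: "X \<ge> X0" and gap0: "\<And>l. l \<in> A \<Longrightarrow> gap l j \<theta> \<le> 0"
    and B: "B > 0" "20 * B * width X \<le> 1" and x: "\<bar>x - X\<bar> \<le> 1"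
    and t: "\<bar>t - \<theta>\<bar> \<le> B * width X" and dom: "dominated j X (Complex x t)"
    and uv: "\<bar>u - \<theta>\<bar> \<le> B * width X" "\<bar>v - \<theta>\<bar> \<le> B * width X"
    and nz: "\<And>s. s \<in> closed_segment (Complex x u) (Complex x v) \<Longrightarrow> g s \<noteq> 0"
  shows "\<bar>Im (logint g (linepath (Complex x u) (Complex x v)))\<bar> \<le> (3 * pi + 25) * C5 B * (X * growth X)"
proof -
  have X1: "X \<ge> 1" using X X0 by simp
  have E1: "growth X \<ge> 1" using growth_ge1 X1 by simp
  define XE where "XE = X * growth X"
  have XE: "XE \<ge> 1" using mult_mono[of 1 X 1 "growth X"] X1 E1 by (simp add: XE_def)
  define \<beta> where "\<beta> = width X"
  have \<beta>: "0 < \<beta>" using X1 width_pos[of X] by (auto simp: \<beta>_def)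
  have qb: "exp (real q * X) * \<beta> = XE" unfolding \<beta>_def XE_def by (rule exp_q_width)
  \<comment> \<open>The centre and both end points lie within B\<beta> of height \<theta>, so the
    side is within 2B\<beta> of the centre.\<close>
  define \<rho> where "\<rho> = 2 * B * \<beta>"
  have \<rho>: "\<rho> > 0" using B \<beta> by (simp add: \<rho>_def)
  define a where "a = Complex x t"
  define F where "F s = g s * exp (- w j * exp (of_nat q * s))" for s
  have F_alt: "F s = g s / wexp j s" for s by (simp add: F_def wexp_def exp_minus field_simps)
  have Fhol: "F holomorphic_on S" for S unfolding F_def by (intro holomorphic_intros g_entire)
  define N where "N = real (card A)"
  have N: "N \<ge> 1" using card_A by (simp add: N_def)
  have W0: "W \<ge> 0" using W_bounds[OF j j] by simp
  define G where "G = W * real q * (20 * B * \<beta>)"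
  have G0: "G \<ge> 0" using W0 B \<beta> by (simp add: G_def)
  define M where "M = C5 B * XE"
  have M_eq: "M = N * XE + C * XE + (C1 + 1) * XE + exp (2 * real q) * (exp (real q * X) * G)"
    by (simp add: M_def C5_def N_def G_def qb[symmetric] algebra_simps)
  have parts: "0 \<le> exp (2 * real q) * (exp (real q * X) * G)" "N * XE \<ge> N" "(C1 + 1) * XE \<ge> 0" "C * XE \<ge> 0"
    using G0 N XE C1_pos C by (auto simp: mult_le_cancel_left1)
  have M: "M > 0" using M_eq parts N by linarith
  have up: "norm (F s) \<le> exp M" if s: "dist a s \<le> 9 * \<rho>" for s
  proof -
    have d: "\<bar>Re s - x\<bar> \<le> 18 * B * \<beta>" "\<bar>Im s - t\<bar> \<le> 18 * B * \<beta>"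
      using s abs_Re_le_cmod[of "s - a"] abs_Im_le_cmod[of "s - a"]
      by (auto simp: dist_norm norm_minus_commute a_def \<rho>_def)
    have B\<beta>: "B * \<beta> > 0" using B \<beta> by simp
    \<comment> \<open>18 B\<beta> from the disc plus B\<beta> from its centre; the hypothesis 20 B
      \<open>width X\<close> \<le> 1 likewise keeps Re s within 2 of X.\<close>
    have ims: "\<bar>Im s - \<theta>\<bar> \<le> 20 * B * \<beta>" using d t B\<beta> unfolding \<beta>_def[symmetric] by linarith
    have res: "\<bar>Re s - X\<bar> \<le> 2" using d x B(2) B\<beta> unfolding \<beta>_def[symmetric] by linarith
    have "norm (H l (exp s) * (wexp l s / wexp j s)) \<le> exp (C * XE) * exp (exp (2 * real q) * (exp (real q * X) * G))"
      if l: "l \<in> A" for l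
      unfolding norm_mult
    proof (intro mult_mono)
      show "norm (H l (exp s)) \<le> exp (C * XE)" using H_up[OF l X, of s] res by (simp add: XE_def)
      have "gap l j (Im s) - gap l j \<theta> = Re ((w l - w j) * (cis (real q * Im s) - cis (real q * \<theta>)))"
        by (simp add: gap_def algebra_simps)
      also have "\<dots> \<le> norm (w l - w j) * norm (cis (real q * Im s) - cis (real q * \<theta>))"
        using complex_Re_le_cmod by (metis norm_mult)
      also have "\<dots> \<le> W * (real q * (20 * B * \<beta>))"
      proof (intro mult_mono)
        have "norm (cis (real q * Im s) - cis (real q * \<theta>)) \<le> \<bar>real q * Im s - real q * \<theta>\<bar>" by (rule norm_cis_diff_le)
        also have "\<dots> = real q * \<bar>Im s - \<theta>\<bar>" by (simp add: abs_mult flip: right_diff_distrib)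
        also have "\<dots> \<le> real q * (20 * B * \<beta>)" using ims by (intro mult_left_mono) auto
        finally show "norm (cis (real q * Im s) - cis (real q * \<theta>)) \<le> real q * (20 * B * \<beta>)" .
      qed (use W_bounds[OF l j] in auto)
      finally have "gap l j (Im s) \<le> G" using gap0[OF l] by (simp add: G_def mult.assoc)
      hence "exp (real q * Re s) * gap l j (Im s) \<le> exp (real q * Re s) * G" by (intro mult_left_mono) auto
      also have "\<dots> \<le> exp (real q * (2 + X)) * G"
      proof (rule mult_right_mono[OF _ G0])
        have "real q * Re s \<le> real q * (2 + X)" using res by (intro mult_left_mono) auto
        thus "exp (real q * Re s) \<le> exp (real q * (2 + X))" by simp
      qed
      also have "\<dots> = exp (2 * real q) * (exp (real q * X) * G)" by (simp add: distrib_left exp_add mult_ac)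
      finally show "norm (wexp l s / wexp j s) \<le> exp (exp (2 * real q) * (exp (real q * X) * G))"
        unfolding norm_wexp_ratio by simp
    qed auto
    hence "norm (\<Sum>l\<in>A. H l (exp s) * (wexp l s / wexp j s)) \<le> (\<Sum>l\<in>A. exp (C * XE) * exp (exp (2 * real q) * (exp (real q * X) * G)))"
      by (rule sum_norm_le)
    also have "(\<Sum>l\<in>A. H l (exp s) * (wexp l s / wexp j s)) = F s" by (simp add: F_alt g_eq sum_divide_distrib)
    also have "(\<Sum>l\<in>A. exp (C * XE) * exp (exp (2 * real q) * (exp (real q * X) * G)))
        = N * (exp (C * XE) * exp (exp (2 * real q) * (exp (real q * X) * G)))" by (simp add: N_def)
    also have "\<dots> \<le> exp (N * XE) * (exp (C * XE) * exp (exp (2 * real q) * (exp (real q * X) * G)))"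
      using exp_ge_add_one_self[of "N * XE"] parts by (intro mult_right_mono) (linarith, simp)
    also have "\<dots> = exp (N * XE + C * XE + exp (2 * real q) * (exp (real q * X) * G))" by (simp add: exp_add)
    also have "\<dots> \<le> exp M" unfolding M_eq using parts by simp
    finally show ?thesis .
  qed
  have xa: "\<bar>Re a - X\<bar> \<le> 2" using x by (simp add: a_def)
  note dr = dominated_ratio[OF j X xa dom[folded a_def]]
  have lo: "exp (- M) \<le> norm (F a)"
  proof -
    have "(C1 + 1) * XE \<le> M" unfolding M_eq using parts N by linarith
    hence "exp (- M) \<le> exp (- (C1 + 1) * XE)" unfolding mult_minus_left exp_le_cancel_iff by linarith
    also have "\<dots> = exp (- C1 * XE) * exp (- XE)" by (simp add: exp_add[symmetric] algebra_simps)
    also have "2 \<le> exp XE" using exp_ge_add_one_self[of XE] XE by linarith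
    hence "exp (- XE) \<le> 1 / 2" by (simp add: exp_minus field_simps)
    also have "exp (- C1 * XE) \<le> norm (H j (exp a))" using dom by (simp add: dominated_def a_def XE_def)
    also have "1 / 2 \<le> norm (g a / (H j (exp a) * wexp j a))"
      using dr(2) norm_triangle_ineq2[of 1 "g a / (H j (exp a) * wexp j a)"] by (simp add: norm_minus_commute)
    also have "norm (H j (exp a)) * \<dots> = norm (F a)" using dr(1) by (simp add: F_alt norm_mult[symmetric])
    finally show ?thesis by (simp add: mult_left_mono mult_right_mono)
  qed
  obtain Z mm h where Z: "finite Z" "\<And>\<zeta>. \<zeta> \<in> Z \<Longrightarrow> F \<zeta> = 0" "\<And>\<zeta>. \<zeta> \<in> Z \<Longrightarrow> mm \<zeta> > (0::nat)"
    "real (\<Sum>\<zeta>\<in>Z. mm \<zeta>) \<le> 3 * M" and h: "h holomorphic_on ball a (3 * \<rho>)"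
    and fac: "\<And>s. s \<in> ball a (3 * \<rho>) \<Longrightarrow> F s = (\<Prod>\<zeta>\<in>Z. ((s - \<zeta>) / of_real (6 * \<rho>)) ^ mm \<zeta>) * exp (h s)"
    and hd: "\<And>s s'. dist a s \<le> 2 * \<rho> \<Longrightarrow> dist a s' \<le> 2 * \<rho> \<Longrightarrow> norm (h s - h s') \<le> 24 * M"
    by (rule local_factorization[OF Fhol \<rho> M up lo], assumption, (rule that; assumption))
  have near: "dist a (Complex x v') \<le> \<rho>" if "\<bar>v' - \<theta>\<bar> \<le> B * width X" for v'
  proof -
    have "norm (a - Complex x v') = \<bar>t - v'\<bar>" by (simp add: a_def cmod_def)
    thus ?thesis using that t by (simp add: dist_norm \<rho>_def \<beta>_def)
  qed
  have segb: "closed_segment (Complex x u) (Complex x v) \<subseteq> ball a (3 * \<rho>)"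
    using near[OF uv(1)] near[OF uv(2)] \<rho> by (intro closed_segment_subset) auto
  define P where "P = linepath (Complex x u) (Complex x v)"
  have "\<bar>Im (logint F P)\<bar> \<le> pi * real (\<Sum>\<zeta>\<in>Z. mm \<zeta>) + norm (h (Complex x v) - h (Complex x u))"
    unfolding P_def
    by (rule logint_factored[OF Z(1,3) h open_ball segb _ fac]) (use \<rho> nz in \<open>auto simp: F_def\<close>)
  also have "\<dots> \<le> pi * (3 * M) + 24 * M"
    using Z(4) near[OF uv(1)] near[OF uv(2)] \<rho> by (intro add_mono mult_left_mono hd) auto
  finally have 1: "\<bar>Im (logint F P)\<bar> \<le> (3 * pi + 24) * M" by (simp add: algebra_simps)
  have "logint g P = logint (\<lambda>s. F s * wexp j s) P"
    by (rule logint_cong_open[OF open_UNIV]) (auto simp: F_alt wexp_def)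
  also have "\<dots> = logint F P + logint (wexp j) P"
    by (rule logint_mult[OF Fhol wexp_entire open_UNIV]) (use nz in \<open>auto simp: F_def wexp_def P_def\<close>)
  also have "logint (wexp j) P = w j * (exp (of_nat q * Complex x v) - exp (of_nat q * Complex x u))"
  proof -
    have "logint (\<lambda>s. exp (w j * exp (of_nat q * s))) P
        = w j * exp (of_nat q * pathfinish P) - w j * exp (of_nat q * pathstart P)"
      unfolding P_def by (rule logint_exp[of _ UNIV]) (auto intro!: holomorphic_intros)
    thus ?thesis unfolding wexp_def[abs_def] P_def by (simp add: algebra_simps)
  qed
  finally have 2: "logint g P = logint F P + w j * (exp (of_nat q * Complex x v) - exp (of_nat q * Complex x u))" .
  \<comment> \<open>The increment of the removed exponential does not cancel here, but the side is
    only O(\<open>width X\<close>) long, so it is bounded by M and turns the constant 24 into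
    25.\<close>
  have "norm (w j * (exp (of_nat q * Complex x v) - exp (of_nat q * Complex x u)))
      = norm (w j) * (exp (real q * x) * norm (cis (real q * v) - cis (real q * u)))"
    unfolding exp_q_Complex by (simp add: norm_mult flip: right_diff_distrib)
  also have "\<dots> \<le> W * (exp (real q * (1 + X)) * (real q * (2 * B * \<beta>)))"
  proof (intro mult_mono)
    have "real q * x \<le> real q * (1 + X)" using x by (intro mult_left_mono) auto
    thus "exp (real q * x) \<le> exp (real q * (1 + X))" by simp
    have "norm (cis (real q * v) - cis (real q * u)) \<le> \<bar>real q * v - real q * u\<bar>" by (rule norm_cis_diff_le)
    also have "\<dots> = real q * \<bar>v - u\<bar>" by (simp add: abs_mult flip: right_diff_distrib)
    also have "\<dots> \<le> real q * (2 * B * \<beta>)" using uv by (intro mult_left_mono) (auto simp: \<beta>_def)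
    finally show "norm (cis (real q * v) - cis (real q * u)) \<le> real q * (2 * B * \<beta>)" .
  qed (use W_bounds[OF j j] B \<beta> in auto)
  also have "\<dots> = exp (real q) * (exp (real q * X) * (W * real q * (2 * B * \<beta>)))"
    by (simp add: distrib_left exp_add mult_ac)
  also have "\<dots> \<le> exp (2 * real q) * (exp (real q * X) * G)"
    unfolding G_def using W0 B \<beta> by (intro mult_mono mult_left_mono mult_nonneg_nonneg) auto
  also have "\<dots> \<le> M" unfolding M_eq using parts N by linarith
  finally have 3: "norm (w j * (exp (of_nat q * Complex x v) - exp (of_nat q * Complex x u))) \<le> M" .
  have "\<bar>Im (logint g P)\<bar> \<le> (3 * pi + 24) * M + M"
    using 1 3 abs_Im_le_cmod[of "w j * (exp (of_nat q * Complex x v) - exp (of_nat q * Complex x u))"]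
    unfolding 2 plus_complex.sel by linarith
  thus ?thesis by (simp add: P_def M_def XE_def algebra_simps)
qed


text \<open>Strips narrow inside a block by a factor of at most exp (-p). Comparing the curved strip
  with a rectangle therefore costs exp p, the origin of the thresholds c \<ge> exp p * B.\<close>

lemma width_decreasing:
  assumes "X \<ge> 1" "X \<le> x" "x \<le> X + 1"
  shows "width x \<le> width X" "exp (- real p) * width X \<le> width x"
proof -
  have "x / X = 1 + (x - X) / X" using assms by (simp add: field_simps)
  also have "(x - X) / X \<le> real p * (x - X)"
  proof -
    have "(x - X) / X \<le> (x - X) / 1" using assms by (intro divide_left_mono) auto
    also have "\<dots> \<le> real p * (x - X)" using assms p by (simp add: mult_le_cancel_right1)
    finally show ?thesis .
  qed
  also have "1 + real p * (x - X) \<le> exp (real p * (x - X))" by (rule exp_ge_add_one_self)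
  finally have "x \<le> X * exp (real p * (x - X))" using assms by (simp add: field_simps)
  hence "x * exp (- real p * x) \<le> X * exp (real p * (x - X)) * exp (- real p * x)" by (intro mult_right_mono) auto
  also have "\<dots> = width X" by (simp add: width_def mult.assoc exp_add[symmetric] algebra_simps)
  finally show "width x \<le> width X" by (simp add: width_def)
  have "exp (- real p) * width X = X * exp (- real p * (X + 1))"
    by (simp add: width_def algebra_simps exp_add[symmetric])
  also have "\<dots> \<le> x * exp (- real p * x)"
  proof (intro mult_mono)
    have "real p * x \<le> real p * (X + 1)" using assms by (intro mult_left_mono) auto
    thus "exp (- real p * (X + 1)) \<le> exp (- real p * x)" by simp
  qed (use assms in auto)
  finally show "exp (- real p) * width X \<le> width x" by (simp add: width_def)
qed

lemma width_small:
  assumes "\<epsilon> > 0"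
  obtains X1 where "X1 \<ge> 1" "\<And>X. X \<ge> X1 \<Longrightarrow> width X \<le> \<epsilon>"
proof
  show "max 1 (2 / \<epsilon>) \<ge> 1" by simp
  fix X assume X: "X \<ge> max 1 (2 / \<epsilon>)"
  have "X * X / 2 \<le> exp X" using exp_lower_Taylor_quadratic[of X] X by (simp add: power2_eq_square)
  also have "\<dots> \<le> exp (real p * X)" using p X by (simp add: mult_le_cancel_right1)
  finally have "width X \<le> 2 / X" using X by (simp add: width_def exp_minus field_simps)
  also have "2 / X \<le> \<epsilon>" using X assms by (simp add: field_simps)
  finally show "width X \<le> \<epsilon>" .
qed

text \<open>Two horizontal sides at C2 each, two vertical sides at (3 pi + 25) C5 each, and one
  further C5 for replacing the angles of the horizontal sides by \<theta>.\<close>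

definition C6 :: "real \<Rightarrow> real" where
  "C6 B = 2 * C2 + (6 * pi + 51) * C5 B"

text \<open>The linear decrease \<kappa> t reaches K \<open>width X\<close> at t = (K / \<kappa>)
  \<open>width X\<close>; from there on a single term wins on each side of the ray.\<close>

lemma crit_dominated:
  assumes cr: "crit \<theta> j k \<delta> \<kappa>" and X: "X \<ge> X0"
  shows "\<And>l t. l \<in> A - {j} \<Longrightarrow> K / \<kappa> * width X \<le> t \<Longrightarrow> t \<le> 2 * \<delta> \<Longrightarrow> gap l j (\<theta> + t) \<le> - K * width X"
    "\<And>l t. l \<in> A - {k} \<Longrightarrow> K / \<kappa> * width X \<le> t \<Longrightarrow> t \<le> 2 * \<delta> \<Longrightarrow> gap l k (\<theta> - t) \<le> - K * width X"
proof -
  have \<kappa>: "\<kappa> > 0" using cr by (simp add: crit_def)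
  have \<beta>: "width X > 0" using width_pos X X0 by simp
  have t: "0 < t" "- \<kappa> * t \<le> - K * width X" if "K / \<kappa> * width X \<le> t" for t
  proof -
    have "0 < K / \<kappa> * width X" using K_pos \<kappa> \<beta> by simp
    thus "0 < t" using that by linarith
    show "- \<kappa> * t \<le> - K * width X" using that \<kappa> by (simp add: field_simps)
  qed
  show "gap l j (\<theta> + t) \<le> - K * width X" if "l \<in> A - {j}" "K / \<kappa> * width X \<le> t" "t \<le> 2 * \<delta>" for l t
    using cr t[OF that(2)] that(1,3) unfolding crit_def by (meson order.trans)
  show "gap l k (\<theta> - t) \<le> - K * width X" if "l \<in> A - {k}" "K / \<kappa> * width X \<le> t" "t \<le> 2 * \<delta>" for l t
    using cr t[OF that(2)] that(1,3) unfolding crit_def by (meson order.trans)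
qed

lemma strip_rect:
  assumes cr: "crit \<theta> j k \<delta> \<kappa>" and B: "B = K / \<kappa> + 2" and X: "X \<ge> X0"
    and small: "20 * B * width X \<le> 1" "B * width X \<le> 2 * \<delta>"
    and nz: "\<And>s. Re s = X \<or> Re s = X + 1 \<Longrightarrow> \<bar>Im s - \<theta>\<bar> \<le> B * width X \<Longrightarrow> g s \<noteq> 0"
  obtains t1 t2 where "\<theta> + (B - 1) * width X \<le> t2" "t2 \<le> \<theta> + B * width X"
    "\<theta> - B * width X \<le> t1" "t1 \<le> \<theta> - (B - 1) * width X"
    "\<bar>2 * pi * real_of_int (zero_count g (box (Complex X t1) (Complex (X + 1) t2)))
      - norm (w j - w k) * (exp (real q * (X + 1)) - exp (real q * X))\<bar> \<le> C6 B * (X * growth X)"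
proof -
  have j: "j \<in> A" and k: "k \<in> A" and \<kappa>: "\<kappa> > 0" and gap0: "\<And>l. l \<in> A \<Longrightarrow> gap l j \<theta> \<le> 0"
    and wjk: "(w k - w j) * cis (real q * \<theta>) = \<i> * of_real (norm (w j - w k))"
    using cr by (auto simp: crit_def)
  have X1: "X \<ge> 1" using X X0 by simp
  have E1: "growth X \<ge> 1" using growth_ge1 X1 by simp
  define XE where "XE = X * growth X"
  have XE: "XE \<ge> growth X" using E1 X1 by (simp add: XE_def)
  define \<beta> where "\<beta> = width X"
  have \<beta>: "0 < \<beta>" "\<beta> \<le> 1" using X1 width_pos[of X] width_le1[of X] by (auto simp: \<beta>_def)
  have B1: "B - 1 > 0" "B > 0" using B K_pos \<kappa> by (auto intro: add_pos_pos)
  have B\<beta>: "B * \<beta> > 0" "(B - 1) * \<beta> > 0" "B * \<beta> \<le> 1" using B1 \<beta> small(1) by (auto simp: \<beta>_def)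
  define D where "D = ball (Complex X \<theta>) 7"
  define good where "good i s \<longleftrightarrow> norm (H i (exp s)) \<ge> exp (- C1 * (X * growth X))" for i s
  have lip: "\<bar>Im s - Im s'\<bar> \<le> norm (s - s')" for s s' using abs_Im_le_cmod[of "s - s'"] by auto
  obtain t2 where t2: "\<theta> + (B - 1) * \<beta> \<le> t2" "t2 \<le> \<theta> + (B - 1) * \<beta> + \<beta>" "\<And>s. s \<in> D \<Longrightarrow> Im s = t2 \<Longrightarrow> good j s"
    using good_line[OF j X, of \<beta> Im "\<theta> + (B - 1) * \<beta>" \<theta>] lip \<beta> unfolding \<beta>_def good_def D_def by blast
  obtain t1 where t1: "\<theta> - B * \<beta> \<le> t1" "t1 \<le> \<theta> - B * \<beta> + \<beta>" "\<And>s. s \<in> D \<Longrightarrow> Im s = t1 \<Longrightarrow> good k s"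
    using good_line[OF k X, of \<beta> Im "\<theta> - B * \<beta>" \<theta>] lip \<beta> unfolding \<beta>_def good_def D_def by blast
  have t2': "t2 \<le> \<theta> + B * \<beta>" and t1': "t1 \<le> \<theta> - (B - 1) * \<beta>" using t1 t2 by (auto simp: algebra_simps)
  have lt: "X < X + 1" "t1 < t2" using t1' t2(1) B\<beta> by auto
  have inD: "s \<in> D" if "\<bar>Re s - X\<bar> \<le> 1" "\<bar>Im s - \<theta>\<bar> \<le> B * \<beta>" for s
    using that cmod_le[of "s - Complex X \<theta>"] B\<beta> by (simp add: D_def dist_norm norm_minus_commute)
  have KB: "K / \<kappa> * width X \<le> (B - 1) * \<beta>" using \<beta> by (simp add: B \<beta>_def algebra_simps)
  have dom2: "dominated j X s" if "\<bar>Re s - X\<bar> \<le> 1" "Im s = t2" for s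
  proof -
    have "gap l j (Im s) \<le> - K * width X" if "l \<in> A - {j}" for l
      using crit_dominated(1)[OF cr X that, of "t2 - \<theta>"] KB t2(1) t2' small(2) \<open>Im s = t2\<close> by (simp add: \<beta>_def)
    moreover have "good j s" using inD[of s] that t2 t2' B\<beta> by (intro t2(3)) auto
    ultimately show ?thesis by (simp add: dominated_def good_def)
  qed
  have dom1: "dominated k X s" if "\<bar>Re s - X\<bar> \<le> 1" "Im s = t1" for s
  proof -
    have "gap l k (Im s) \<le> - K * width X" if "l \<in> A - {k}" for l
      using crit_dominated(2)[OF cr X that, of "\<theta> - t1"] KB t1(1) t1' small(2) \<open>Im s = t1\<close> by (simp add: \<beta>_def)
    moreover have "good k s" using inD[of s] that t1 t1' B\<beta> by (intro t1(3)) auto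
    ultimately show ?thesis by (simp add: dominated_def good_def)
  qed
  have seg: "closed_segment X (X + 1) = {X..X + 1}" "closed_segment (X + 1) X = {X..X + 1}"
    "closed_segment t1 t2 = {t1..t2}" "closed_segment t2 t1 = {t1..t2}"
    using lt by (auto simp: closed_segment_eq_real_ivl)
  have nzside: "g s \<noteq> 0" if "Re s = X \<or> Re s = X + 1" "t1 \<le> Im s" "Im s \<le> t2" for s
    using nz[of s] that t1(1) t2' by (auto simp: \<beta>_def)
  have nzb: "g s \<noteq> 0" if "s \<in> cbox (Complex X t1) (Complex (X + 1) t2) - box (Complex X t1) (Complex (X + 1) t2)" for s
  proof -
    have s: "X \<le> Re s" "Re s \<le> X + 1" "t1 \<le> Im s" "Im s \<le> t2" "Re s = X \<or> Re s = X + 1 \<or> Im s = t1 \<or> Im s = t2"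
      using that by (auto simp: in_cbox_complex_iff in_box_complex_iff)
    show ?thesis
      using s nzside dominated_ratio(3)[OF j X, of s] dominated_ratio(3)[OF k X, of s] dom1[of s] dom2[of s] by force
  qed
  define L where "L = (\<lambda>a b. Im (logint g (linepath a b)))"
  define R where "R x = exp (real q * x)" for x
  define u where "u = cis (real q * \<theta>)"
  have bot: "\<bar>L (Complex X t1) (Complex (X + 1) t1) - (R (X + 1) - R X) * Im (w k * cis (real q * t1))\<bar> \<le> C2 * XE"
  proof -
    have "\<bar>L (Complex X t1) (Complex (X + 1) t1)
       - Im (w k * (exp (of_nat q * Complex (X + 1) t1) - exp (of_nat q * Complex X t1)))\<bar> \<le> C2 * growth X"
      unfolding L_def
    proof (rule edge[OF k X, where y = \<theta>])
      show "closed_segment (Complex X t1) (Complex (X + 1) t1) \<subseteq> ball (Complex X \<theta>) 7"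
        using inD t1 t1' B\<beta> unfolding D_def[symmetric] by (auto simp: horizontal_segment seg simp del: mem_ball)
      fix s assume "s \<in> closed_segment (Complex X t1) (Complex (X + 1) t1)"
      thus "\<bar>Re s - X\<bar> \<le> 2 \<and> dominated k X s" using dom1[of s] by (auto simp: horizontal_segment seg)
    qed
    also have "C2 * growth X \<le> C2 * XE" using XE C2_pos by simp
    also have "w k * (exp (of_nat q * Complex (X + 1) t1) - exp (of_nat q * Complex X t1))
       = of_real (R (X + 1) - R X) * (w k * cis (real q * t1))"
      unfolding exp_q_Complex R_def by (simp add: algebra_simps)
    finally show ?thesis by simp
  qed
  have top: "\<bar>L (Complex (X + 1) t2) (Complex X t2) + (R (X + 1) - R X) * Im (w j * cis (real q * t2))\<bar> \<le> C2 * XE"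
  proof -
    have "\<bar>L (Complex (X + 1) t2) (Complex X t2)
       - Im (w j * (exp (of_nat q * Complex X t2) - exp (of_nat q * Complex (X + 1) t2)))\<bar> \<le> C2 * growth X"
      unfolding L_def
    proof (rule edge[OF j X, where y = \<theta>])
      show "closed_segment (Complex (X + 1) t2) (Complex X t2) \<subseteq> ball (Complex X \<theta>) 7"
        using inD t2 t2' B\<beta> unfolding D_def[symmetric] by (auto simp: horizontal_segment seg simp del: mem_ball)
      fix s assume "s \<in> closed_segment (Complex (X + 1) t2) (Complex X t2)"
      thus "\<bar>Re s - X\<bar> \<le> 2 \<and> dominated j X s" using dom2[of s] by (auto simp: horizontal_segment seg)
    qed
    also have "C2 * growth X \<le> C2 * XE" using XE C2_pos by simp
    also have "w j * (exp (of_nat q * Complex X t2) - exp (of_nat q * Complex (X + 1) t2))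
       = of_real (- (R (X + 1) - R X)) * (w j * cis (real q * t2))"
      unfolding exp_q_Complex R_def by (simp add: algebra_simps)
    finally have "\<bar>L (Complex (X + 1) t2) (Complex X t2) - Im (of_real (- (R (X + 1) - R X)) * (w j * cis (real q * t2)))\<bar> \<le> C2 * XE" .
    moreover have "Im (of_real r * z) = r * Im z" for r z by simp
    ultimately show ?thesis by (simp only: mult_minus_left diff_minus_eq_add)
  qed
  have B2: "20 * B * width X \<le> 1" using small(1) .
  have b1: "\<bar>t1 - \<theta>\<bar> \<le> B * width X" "\<bar>t2 - \<theta>\<bar> \<le> B * width X"
    using t1 t1' t2 t2' B\<beta> by (auto simp: \<beta>_def)
  have side: "\<bar>L (Complex x a) (Complex x b)\<bar> \<le> (3 * pi + 25) * C5 B * XE"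
    if "x = X \<or> x = X + 1" "(a, b) = (t1, t2) \<or> (a, b) = (t2, t1)" for x a b
    unfolding L_def XE_def
  proof (rule vertical_edge[OF j X gap0 B1(2) B2])
    show "dominated j X (Complex x t2)" using that by (intro dom2) auto
    show "g s \<noteq> 0" if "s \<in> closed_segment (Complex x a) (Complex x b)" for s
      using that \<open>x = X \<or> x = X + 1\<close> \<open>(a, b) = (t1, t2) \<or> (a, b) = (t2, t1)\<close> nzside[of s]
      by (auto simp: vertical_segment seg)
  qed (use that b1 in auto)
  have right: "\<bar>L (Complex (X + 1) t1) (Complex (X + 1) t2)\<bar> \<le> (3 * pi + 25) * C5 B * XE" by (rule side) auto
  have left: "\<bar>L (Complex X t2) (Complex X t1)\<bar> \<le> (3 * pi + 25) * C5 B * XE" by (rule side) auto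
  have total: "2 * pi * real_of_int (zero_count g (box (Complex X t1) (Complex (X + 1) t2))) =
    L (Complex X t1) (Complex (X + 1) t1) + L (Complex (X + 1) t1) (Complex (X + 1) t2)
    + L (Complex (X + 1) t2) (Complex X t2) + L (Complex X t2) (Complex X t1)"
    unfolding L_def by (rule rect_argument_principle[OF g_entire lt nzb])
  \<comment> \<open>Tilting the two angles t1 and t2 to \<theta> costs exp (q X) times
    \<open>width X\<close>, which is X growth X.\<close>
  have main: "\<bar>(R (X + 1) - R X) * Im (w k * cis (real q * t1)) - (R (X + 1) - R X) * Im (w j * cis (real q * t2))
      - norm (w j - w k) * (R (X + 1) - R X)\<bar> \<le> C5 B * XE"
  proof -
    have "Im ((w k - w j) * u) = norm (w j - w k)" unfolding u_def wjk by simp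
    hence "(R (X + 1) - R X) * Im (w k * cis (real q * t1)) - (R (X + 1) - R X) * Im (w j * cis (real q * t2))
      - norm (w j - w k) * (R (X + 1) - R X) =
      (R (X + 1) - R X) * Im (w k * (cis (real q * t1) - u) - w j * (cis (real q * t2) - u))"
      by (simp add: algebra_simps)
    also have "\<bar>\<dots>\<bar> = \<bar>R (X + 1) - R X\<bar> * \<bar>Im (w k * (cis (real q * t1) - u) - w j * (cis (real q * t2) - u))\<bar>"
      by (rule abs_mult)
    also have "\<dots> \<le> R (X + 1) * (2 * (W * (real q * (B * \<beta>))))"
    proof (intro mult_mono)
      have "real q * X \<le> real q * (X + 1)" by (intro mult_left_mono) auto
      hence "R X \<le> R (X + 1)" "R X \<ge> 0" by (auto simp: R_def)
      thus "\<bar>R (X + 1) - R X\<bar> \<le> R (X + 1)" by simp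
      have cd: "norm (cis (real q * t) - u) \<le> real q * (B * \<beta>)" if "\<bar>t - \<theta>\<bar> \<le> B * width X" for t
      proof -
        have "norm (cis (real q * t) - u) \<le> \<bar>real q * t - real q * \<theta>\<bar>" unfolding u_def by (rule norm_cis_diff_le)
        also have "\<dots> = real q * \<bar>t - \<theta>\<bar>" by (simp add: abs_mult flip: right_diff_distrib)
        also have "\<dots> \<le> real q * (B * \<beta>)" using that by (intro mult_left_mono) (auto simp: \<beta>_def)
        finally show ?thesis .
      qed
      have "\<bar>Im (w k * (cis (real q * t1) - u) - w j * (cis (real q * t2) - u))\<bar>
        \<le> norm (w k * (cis (real q * t1) - u)) + norm (w j * (cis (real q * t2) - u))"
        using abs_Im_le_cmod norm_triangle_ineq4 order.trans by blast
      also have "\<dots> \<le> W * (real q * (B * \<beta>)) + W * (real q * (B * \<beta>))"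
        unfolding norm_mult using W_bounds[OF j j] W_bounds[OF k k] cd b1
        by (intro add_mono mult_mono) auto
      finally show "\<bar>Im (w k * (cis (real q * t1) - u) - w j * (cis (real q * t2) - u))\<bar> \<le> 2 * (W * (real q * (B * \<beta>)))"
        unfolding mult_2 .
    qed (auto simp: R_def)
    also have "\<dots> = 2 * exp (real q) * W * real q * B * (exp (real q * X) * \<beta>)"
      by (simp add: R_def distrib_left exp_add)
    also have "exp (real q * X) * \<beta> = XE" unfolding \<beta>_def XE_def by (rule exp_q_width)
    also have "2 * exp (real q) * W * real q * B * XE \<le> C5 B * XE"
    proof (rule mult_right_mono)
      have "2 * exp (real q) * (W * real q * B) \<le> 20 * exp (2 * real q) * (W * real q * B)"
        using W_bounds[OF j j] B1 by (intro mult_right_mono mult_mono mult_nonneg_nonneg) auto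
      thus "2 * exp (real q) * W * real q * B \<le> C5 B"
        unfolding C5_def mult.assoc using C C1_pos of_nat_0_le_iff[of "card A"] by linarith
    qed (use XE E1 in auto)
    finally show ?thesis .
  qed
  have "\<bar>2 * pi * real_of_int (zero_count g (box (Complex X t1) (Complex (X + 1) t2)))
      - norm (w j - w k) * (R (X + 1) - R X)\<bar> \<le> C2 * XE + C2 * XE + 2 * ((3 * pi + 25) * C5 B * XE) + C5 B * XE"
    unfolding total using bot top left right main by linarith
  also have "\<dots> = C6 B * XE" by (simp add: C6_def algebra_simps)
  finally show ?thesis
    using that[of t2 t1] t1 t1' t2 t2' by (simp add: \<beta>_def R_def XE_def)
qed

text \<open>Half-open in Re s, so that consecutive blocks tile the strip; the height follows
  \<open>Re s\<close> because the strip is curved in these coordinates.\<close>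

definition strip_block :: "real \<Rightarrow> real \<Rightarrow> real \<Rightarrow> complex set" where
  "strip_block \<theta> c X = {s. X \<le> Re s \<and> Re s < X + 1 \<and> \<bar>Im s - \<theta>\<bar> < c * width (Re s)}"

text \<open>Origin of the 2 in B = K / \<kappa> + 2: domination starts at height (B - 2)
  \<open>width X\<close> from the ray, and moving to a good line loses one more width. The counted
  windows start at (B - 1) \<open>width X\<close>, no higher than the sides of the rectangle in
  \<open>strip_rect\<close>, so nothing is left uncovered between them.\<close>

lemma crit_windows:
  assumes cr: "crit \<theta> j k \<delta> \<kappa>" and B: "B = K / \<kappa> + 2" and X: "X \<ge> X0"
    and E: "B * width X < E" "E \<le> 2 * \<delta>"
  shows "real_of_int (zero_count g {s. X \<le> Re s \<and> Re s \<le> X + 1 \<and> \<theta> + (B - 1) * width X \<le> Im s \<and> Im s \<le> \<theta> + E - width X}) \<le> 4 * C2 * growth X"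
    "real_of_int (zero_count g {s. X \<le> Re s \<and> Re s \<le> X + 1 \<and> \<theta> - E + width X \<le> Im s \<and> Im s \<le> \<theta> - (B - 1) * width X}) \<le> 4 * C2 * growth X"
    "\<exists>s. g s \<noteq> 0"
proof -
  have j: "j \<in> A" and k: "k \<in> A" and \<kappa>: "\<kappa> > 0" and \<delta>: "\<delta> \<le> 1" using cr by (auto simp: crit_def)
  have \<beta>: "width X > 0" using width_pos X X0 by simp
  have KB: "K / \<kappa> * width X = (B - 2) * width X" by (simp add: B)
  have KB0: "(B - 2) * width X > 0" unfolding KB[symmetric] using K_pos \<kappa> \<beta> by simp
  have g1: "gap l j y \<le> - K * width X" if "l \<in> A - {j}" "\<theta> + (B - 2) * width X \<le> y" "y \<le> \<theta> + E" for l y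
    using crit_dominated(1)[OF cr X that(1), of "y - \<theta>"] that KB E by simp
  have g2: "gap l k y \<le> - K * width X" if "l \<in> A - {k}" "\<theta> - E \<le> y" "y \<le> \<theta> - (B - 2) * width X" for l y
    using crit_dominated(2)[OF cr X that(1), of "\<theta> - y"] that KB E by simp
  have "\<theta> + (B - 2) * width X + 2 * width X < \<theta> + E" "\<theta> + E \<le> \<theta> + (B - 2) * width X + 3"
    using E KB0 \<delta> by (auto simp: algebra_simps)
  note w1 = window[OF j X this g1]
  have "\<theta> - E + 2 * width X < \<theta> - (B - 2) * width X" "\<theta> - (B - 2) * width X \<le> \<theta> - E + 3"
    using E KB0 \<delta> by (auto simp: algebra_simps)
  note w2 = window[OF k X this g2]
  have e: "\<theta> + (B - 2) * width X + width X = \<theta> + (B - 1) * width X" "\<theta> - (B - 2) * width X - width X = \<theta> - (B - 1) * width X"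
    by (simp_all add: algebra_simps)
  show "real_of_int (zero_count g {s. X \<le> Re s \<and> Re s \<le> X + 1 \<and> \<theta> + (B - 1) * width X \<le> Im s \<and> Im s \<le> \<theta> + E - width X}) \<le> 4 * C2 * growth X"
    using w1(1) unfolding e by simp
  show "real_of_int (zero_count g {s. X \<le> Re s \<and> Re s \<le> X + 1 \<and> \<theta> - E + width X \<le> Im s \<and> Im s \<le> \<theta> - (B - 1) * width X}) \<le> 4 * C2 * growth X"
    using w2(1) unfolding e by simp
  show "\<exists>s. g s \<noteq> 0" using w1(2) by simp
qed

end

subsection \<open>Dominance near a given direction\<close>

text \<open>If Re z < 0, continuity gives a fixed negative bound, which beats a linear one for t <
  1. If Re z = 0, the derivative at 0 is - \<sigma> Im z < 0.\<close>

lemma rotated_real_part_decreases: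
  fixes z :: complex
  assumes "Re z < 0 \<or> Re z = 0 \<and> \<sigma> * Im z > 0"
  shows "\<exists>\<kappa>>0. \<forall>\<^sub>F t in at_right 0. Re (z * cis (\<sigma> * t)) \<le> - \<kappa> * t"
  using assms
proof
  assume neg: "Re z < 0"
  have "((\<lambda>t. Re (z * cis (\<sigma> * t))) \<longlongrightarrow> Re (z * cis (\<sigma> * 0))) (at_right 0)"
    unfolding times_complex.sel cis.sel by (intro tendsto_intros)
  hence "\<forall>\<^sub>F t in at_right 0. Re (z * cis (\<sigma> * t)) < Re z / 2"
    using neg by (intro order_tendstoD(2)) auto
  moreover have "\<forall>\<^sub>F t in at_right 0. t \<in> {0<..<1::real}" by (rule eventually_at_right_real) simp
  ultimately have "\<forall>\<^sub>F t in at_right 0. Re (z * cis (\<sigma> * t)) \<le> - (- Re z / 2) * t"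
  proof eventually_elim
    case (elim t)
    have "Re z / 2 * 1 \<le> Re z / 2 * t" using elim neg by (intro mult_left_mono_neg) auto
    thus ?case using elim by simp
  qed
  thus ?thesis using neg by (intro exI[of _ "- Re z / 2"]) auto
next
  assume pos: "Re z = 0 \<and> \<sigma> * Im z > 0"
  have "((\<lambda>t. Re (z * cis (\<sigma> * t))) has_field_derivative - \<sigma> * Im z) (at 0)"
    unfolding times_complex.sel cis.sel by (auto intro!: derivative_eq_intros)
  hence "((\<lambda>t. Re (z * cis (\<sigma> * t)) / t) \<longlongrightarrow> - \<sigma> * Im z) (at 0)"
    using pos by (simp add: has_field_derivative_iff)
  hence "((\<lambda>t. Re (z * cis (\<sigma> * t)) / t) \<longlongrightarrow> - \<sigma> * Im z) (at_right 0)"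
    by (rule filterlim_mono[OF _ order.refl at_le]) auto
  hence "\<forall>\<^sub>F t in at_right 0. Re (z * cis (\<sigma> * t)) / t < - (\<sigma> * Im z) / 2"
    using pos by (intro order_tendstoD(2)) auto
  moreover have "\<forall>\<^sub>F t in at_right 0. t \<in> {0<..<1::real}" by (rule eventually_at_right_real) simp
  ultimately have "\<forall>\<^sub>F t in at_right 0. Re (z * cis (\<sigma> * t)) \<le> - (\<sigma> * Im z / 2) * t"
  proof eventually_elim
    case (elim t)
    hence t: "t > 0" by simp
    from elim(1) have "Re (z * cis (\<sigma> * t)) < - (\<sigma> * Im z) / 2 * t"
      unfolding pos_divide_less_eq[OF t] .
    thus ?case by simp
  qed
  thus ?thesis using pos by (intro exI[of _ "\<sigma> * Im z / 2"]) auto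
qed

lemma uniform_linear_decrease:
  fixes \<phi> :: "'a \<Rightarrow> real \<Rightarrow> real"
  assumes "finite S" "\<And>l. l \<in> S \<Longrightarrow> \<exists>\<kappa>>0. \<forall>\<^sub>F t in at_right 0. \<phi> l t \<le> - \<kappa> * t"
  shows "\<exists>\<kappa>>0. \<forall>\<^sub>F t in at_right 0. \<forall>l\<in>S. \<phi> l t \<le> - \<kappa> * t"
  using assms
proof (induction S rule: finite_induct)
  case empty
  show ?case by (rule exI[of _ 1]) simp
next
  case (insert l S)
  obtain \<kappa>1 where 1: "\<kappa>1 > 0" "\<forall>\<^sub>F t in at_right 0. \<phi> l t \<le> - \<kappa>1 * t" using insert by blast
  obtain \<kappa>2 where 2: "\<kappa>2 > 0" "\<forall>\<^sub>F t in at_right 0. \<forall>l\<in>S. \<phi> l t \<le> - \<kappa>2 * t" using insert by blast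
  have "\<forall>\<^sub>F t in at_right 0. t \<in> {0<..<1::real}" by (rule eventually_at_right_real) simp
  hence "\<forall>\<^sub>F t in at_right 0. \<forall>i\<in>insert l S. \<phi> i t \<le> - min \<kappa>1 \<kappa>2 * t"
    using 1(2) 2(2)
  proof eventually_elim
    case (elim t)
    have "- \<kappa>1 * t \<le> - min \<kappa>1 \<kappa>2 * t" "- \<kappa>2 * t \<le> - min \<kappa>1 \<kappa>2 * t"
      using elim by (auto intro!: mult_right_mono)
    with elim(2,3) show ?case by (intro ballI) (metis insertE order.trans)
  qed
  thus ?case using 1 2 by (intro exI[of _ "min \<kappa>1 \<kappa>2"]) auto
qed

context normalized_sum_constants
begin

definition noncrit :: "real \<Rightarrow> nat \<Rightarrow> real \<Rightarrow> real \<Rightarrow> bool" where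
  "noncrit \<theta> j \<delta> \<kappa> \<longleftrightarrow> j \<in> A \<and> 0 < \<delta> \<and> \<delta> \<le> 1 \<and> 0 < \<kappa> \<and> (\<forall>t l. \<bar>t\<bar> \<le> \<delta> \<longrightarrow> l \<in> A - {j} \<longrightarrow> gap l j (\<theta> + t) \<le> - \<kappa>)"

text \<open>The indices attaining the indicator at \<theta>; their conjugate coefficients are the
  points of W_f on the supporting line of the convex hull with outer normal cis (q
  \<theta>).\<close>

definition maximal :: "real \<Rightarrow> nat set" where
  "maximal \<theta> = {j\<in>A. \<forall>l\<in>A. gap l j \<theta> \<le> 0}"

text \<open>The two ends of the face of the hull in that direction, ordered by the imaginary part
  after rotation; they coincide when the face is a single point.\<close>

definition extremal_pair :: "real \<Rightarrow> nat \<Rightarrow> nat \<Rightarrow> bool" where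
  "extremal_pair \<theta> j k \<longleftrightarrow> j \<in> maximal \<theta> \<and> k \<in> maximal \<theta> \<and>
     (\<forall>l\<in>maximal \<theta>. Im (w j * cis (real q * \<theta>)) \<le> Im (w l * cis (real q * \<theta>)) \<and>
        Im (w l * cis (real q * \<theta>)) \<le> Im (w k * cis (real q * \<theta>)))"

lemma gap_rotate: "gap l j (\<theta> + t) = Re ((w l - w j) * cis (real q * \<theta>) * cis (real q * t))"
  by (simp add: gap_def distrib_left mult.assoc cis_mult)

lemma maximal_nonempty: "maximal \<theta> \<noteq> {}"
proof -
  obtain j where "j \<in> A" "\<And>l. l \<in> A \<Longrightarrow> Re (w l * cis (real q * \<theta>)) \<le> Re (w j * cis (real q * \<theta>))"
    using Max_in[of "(\<lambda>l. Re (w l * cis (real q * \<theta>))) ` A"] Max_ge[of "(\<lambda>l. Re (w l * cis (real q * \<theta>))) ` A"] A_fin one_in_A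
    by fastforce
  hence "j \<in> maximal \<theta>" by (auto simp: maximal_def gap_def left_diff_distrib)
  thus ?thesis by blast
qed

lemma maximal_same_Re:
  assumes "j \<in> maximal \<theta>" "k \<in> maximal \<theta>"
  shows "Re ((w k - w j) * cis (real q * \<theta>)) = 0"
  using assms unfolding maximal_def gap_def left_diff_distrib minus_complex.sel by fastforce

lemma maximal_Im_inj:
  assumes "j \<in> maximal \<theta>" "k \<in> maximal \<theta>" "Im (w k * cis (real q * \<theta>)) = Im (w j * cis (real q * \<theta>))"
  shows "j = k"
proof -
  have "(w k - w j) * cis (real q * \<theta>) = 0"
    using maximal_same_Re[OF assms(1,2)] assms(3) by (simp add: complex_eq_iff left_diff_distrib)
  hence "w k = w j" by simp
  thus ?thesis using w_inj assms(1,2) by (auto simp: inj_on_def maximal_def active_indices_def)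
qed

text \<open>The indicator touches each maximal sinusoid from above, so its derivative would have to equal two
  different slopes.\<close>

lemma critical_if_two_maximal:
  assumes "j \<in> maximal \<theta>" "k \<in> maximal \<theta>" "j \<noteq> k"
  shows "critical_angle q m w H \<theta>"
  unfolding critical_angle_def
proof
  assume "indicator_fun q m w H differentiable (at \<theta>)"
  then obtain D where D: "(indicator_fun q m w H has_field_derivative D) (at \<theta>)"
    by (metis real_differentiable_def)
  have slope: "D = - real q * Im (w i * cis (real q * \<theta>))" if i: "i \<in> maximal \<theta>" for i
  proof -
    define \<psi> where "\<psi> x = indicator_fun q m w H x - Re (w i * cis (real q * x))" for x
    have iA: "i \<in> A" using i by (simp add: maximal_def)
    have ge: "\<psi> x \<ge> 0" for x
      unfolding \<psi>_def indicator_fun_def using A_fin iA by (simp del: times_complex.sel)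
    have z: "\<psi> \<theta> = 0"
    proof -
      have "Max ((\<lambda>l. Re (w l * cis (real q * \<theta>))) ` A) = Re (w i * cis (real q * \<theta>))"
      proof (rule Max_eqI)
        fix y assume "y \<in> (\<lambda>l. Re (w l * cis (real q * \<theta>))) ` A"
        then obtain l where l: "l \<in> A" "y = Re (w l * cis (real q * \<theta>))" by blast
        hence "gap l i \<theta> \<le> 0" using i by (simp add: maximal_def)
        thus "y \<le> Re (w i * cis (real q * \<theta>))" unfolding l(2) gap_def left_diff_distrib minus_complex.sel by linarith
      qed (use A_fin iA in auto)
      thus ?thesis by (simp add: \<psi>_def indicator_fun_def)
    qed
    have "((\<lambda>x. Re (w i * cis (real q * x))) has_field_derivative - real q * Im (w i * cis (real q * \<theta>))) (at \<theta>)"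
      unfolding times_complex.sel cis.sel by (auto intro!: derivative_eq_intros simp: algebra_simps)
    hence "(\<psi> has_field_derivative D - (- real q * Im (w i * cis (real q * \<theta>)))) (at \<theta>)"
      unfolding \<psi>_def by (rule DERIV_diff[OF D])
    hence "D - (- real q * Im (w i * cis (real q * \<theta>))) = 0"
      by (rule DERIV_local_min[of _ _ _ 1]) (use ge z in auto)
    thus ?thesis by simp
  qed
  have "Im (w k * cis (real q * \<theta>)) = Im (w j * cis (real q * \<theta>))"
    using slope[OF assms(1)] slope[OF assms(2)] q by simp
  thus False using maximal_Im_inj[OF assms(1,2)] assms(3) by blast
qed

lemma eventually_at_right_0_obtain:
  assumes "\<forall>\<^sub>F t in at_right (0::real). P t" "\<forall>\<^sub>F t in at_right (0::real). Q t"
  obtains \<delta> where "0 < \<delta>" "\<delta> \<le> 1" "\<And>t. 0 < t \<Longrightarrow> t \<le> 2 * \<delta> \<Longrightarrow> P t \<and> Q t"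
proof -
  obtain b where b: "b > 0" "\<And>t. 0 < t \<Longrightarrow> t < b \<Longrightarrow> P t \<and> Q t"
    using eventually_conj[OF assms] unfolding eventually_at_right_field by auto
  show ?thesis by (rule that[of "min 1 (b / 4)"]) (use b in auto)
qed

text \<open>Increasing the angle changes the real part at a rate proportional to minus the imaginary
  part. Among the maximal terms the smallest imaginary part therefore wins above \<theta> and the
  largest below; non-maximal terms stay below by continuity. Strictness holds because w is
  injective.\<close>

lemma crit_exists:
  assumes "extremal_pair \<theta> j k"
  obtains \<delta> \<kappa> where "crit \<theta> j k \<delta> \<kappa>"
proof -
  have j: "j \<in> maximal \<theta>" and k: "k \<in> maximal \<theta>"
    and extremal: "\<And>l. l \<in> maximal \<theta> \<Longrightarrow> Im (w j * cis (real q * \<theta>)) \<le> Im (w l * cis (real q * \<theta>))"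
      "\<And>l. l \<in> maximal \<theta> \<Longrightarrow> Im (w l * cis (real q * \<theta>)) \<le> Im (w k * cis (real q * \<theta>))"
    using assms by (auto simp: extremal_pair_def)
  define u where "u = cis (real q * \<theta>)"
  have jA: "j \<in> A" and kA: "k \<in> A" using j k by (auto simp: maximal_def)
  have max_iff: "l \<in> maximal \<theta>" if "i \<in> maximal \<theta>" "l \<in> A" "Re ((w l - w i) * u) = 0" for i l
  proof -
    have "gap n l \<theta> = gap n i \<theta>" for n using that(3) by (simp add: gap_def u_def left_diff_distrib)
    thus ?thesis using that by (simp add: maximal_def)
  qed
  have right: "Re ((w l - w j) * u) < 0 \<or> Re ((w l - w j) * u) = 0 \<and> real q * Im ((w l - w j) * u) > 0" if l: "l \<in> A - {j}" for l
  proof (cases "Re ((w l - w j) * u) = 0")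
    case True
    hence lm: "l \<in> maximal \<theta>" using max_iff j l by blast
    have "Im (w j * u) \<noteq> Im (w l * u)" using maximal_Im_inj[OF lm j] l by (auto simp: u_def)
    hence "Im (w j * u) < Im (w l * u)" using extremal(1)[OF lm] by (simp add: u_def)
    thus ?thesis using True q by (simp add: left_diff_distrib)
  next
    case False
    thus ?thesis using j l by (auto simp: maximal_def gap_def u_def)
  qed
  have left: "Re ((w l - w k) * u) < 0 \<or> Re ((w l - w k) * u) = 0 \<and> - real q * Im ((w l - w k) * u) > 0" if l: "l \<in> A - {k}" for l
  proof (cases "Re ((w l - w k) * u) = 0")
    case True
    hence lm: "l \<in> maximal \<theta>" using max_iff k l by blast
    have "Im (w k * u) \<noteq> Im (w l * u)" using maximal_Im_inj[OF lm k] l by (auto simp: u_def)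
    hence "Im (w l * u) < Im (w k * u)" using extremal(2)[OF lm] by (simp add: u_def)
    hence "real q * Im (w l * u) < real q * Im (w k * u)" using q by simp
    thus ?thesis using True by (simp only: left_diff_distrib minus_complex.sel) (simp add: algebra_simps)
  next
    case False
    thus ?thesis using k l by (auto simp: maximal_def gap_def u_def)
  qed
  obtain \<kappa>1 where \<kappa>1: "\<kappa>1 > 0" "\<forall>\<^sub>F t in at_right 0. \<forall>l\<in>A - {j}. Re ((w l - w j) * u * cis (real q * t)) \<le> - \<kappa>1 * t"
    using uniform_linear_decrease[of "A - {j}" "\<lambda>l t. Re ((w l - w j) * u * cis (real q * t))"] A_fin
      rotated_real_part_decreases[OF right] by (auto simp del: times_complex.sel)
  obtain \<kappa>2 where \<kappa>2: "\<kappa>2 > 0" "\<forall>\<^sub>F t in at_right 0. \<forall>l\<in>A - {k}. Re ((w l - w k) * u * cis (- real q * t)) \<le> - \<kappa>2 * t"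
    using uniform_linear_decrease[of "A - {k}" "\<lambda>l t. Re ((w l - w k) * u * cis (- real q * t))"] A_fin
      rotated_real_part_decreases[OF left] by (auto simp del: times_complex.sel)
  obtain \<delta> where \<delta>: "0 < \<delta>" "\<delta> \<le> 1" "\<And>t. 0 < t \<Longrightarrow> t \<le> 2 * \<delta> \<Longrightarrow> (\<forall>l\<in>A - {j}. Re ((w l - w j) * u * cis (real q * t)) \<le> - \<kappa>1 * t)
      \<and> (\<forall>l\<in>A - {k}. Re ((w l - w k) * u * cis (- real q * t)) \<le> - \<kappa>2 * t)"
    by (rule eventually_at_right_0_obtain[OF \<kappa>1(2) \<kappa>2(2)]) (rule that; assumption)
  define \<kappa> where "\<kappa> = min \<kappa>1 \<kappa>2"
  have mono: "- \<kappa>1 * t \<le> - \<kappa> * t" "- \<kappa>2 * t \<le> - \<kappa> * t" if "t > 0" for t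
    using that by (auto simp: \<kappa>_def intro!: mult_right_mono)
  have "(w k - w j) * u = \<i> * of_real (norm (w j - w k))"
  proof -
    have Re0: "Re ((w k - w j) * u) = 0" using maximal_same_Re[OF j k] by (simp add: u_def)
    have Im0: "Im ((w k - w j) * u) \<ge> 0" using extremal(1)[OF k] by (simp add: u_def left_diff_distrib)
    have "norm ((w k - w j) * u) = \<bar>Im ((w k - w j) * u)\<bar>" unfolding cmod_def Re0 by simp
    moreover have "norm ((w k - w j) * u) = norm (w j - w k)" by (simp add: norm_mult u_def norm_minus_commute)
    ultimately have "Im ((w k - w j) * u) = norm (w j - w k)" using Im0 by linarith
    thus ?thesis using Re0 by (intro complex_eqI) (simp_all only: Re_i_times Im_i_times Re_complex_of_real Im_complex_of_real minus_zero)
  qed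
  hence "crit \<theta> j k \<delta> \<kappa>"
    unfolding crit_def
  proof (intro conjI allI impI ballI)
    show "\<kappa> > 0" using \<kappa>1 \<kappa>2 by (simp add: \<kappa>_def)
    show "gap l j \<theta> \<le> 0" if "l \<in> A" for l using j that by (simp add: maximal_def)
    fix t :: real and l assume t: "0 < t" "t \<le> 2 * \<delta>"
    show "gap l j (\<theta> + t) \<le> - \<kappa> * t" if "l \<in> A - {j}"
      unfolding gap_rotate using \<delta>(3)[OF t] that mono[OF t(1)] unfolding u_def by (meson order.trans)
    show "gap l k (\<theta> - t) \<le> - \<kappa> * t" if "l \<in> A - {k}"
    proof -
      have "gap l k (\<theta> - t) = Re ((w l - w k) * u * cis (- real q * t))"
        using gap_rotate[of l k \<theta> "- t"] by (simp add: u_def)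
      thus ?thesis using \<delta>(3)[OF t] that mono[OF t(1)] by (metis order.trans)
    qed
  qed (use jA kA \<delta> in \<open>auto simp: u_def\<close>)
  thus ?thesis by (rule that)
qed

lemma noncrit_exists:
  assumes "maximal \<theta> = {j}"
  obtains \<delta> \<kappa> where "noncrit \<theta> j \<delta> \<kappa>"
proof -
  have j: "j \<in> A" "\<And>l. l \<in> A \<Longrightarrow> gap l j \<theta> \<le> 0" using assms by (auto simp: maximal_def)
  have neg: "gap l j \<theta> < 0" if l: "l \<in> A - {j}" for l
  proof (rule ccontr)
    assume "\<not> ?thesis"
    hence "gap l j \<theta> = 0" using j(2)[of l] l by simp
    hence "gap n l \<theta> = gap n j \<theta>" for n by (simp add: gap_def left_diff_distrib)
    hence "l \<in> maximal \<theta>" using j l by (simp add: maximal_def)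
    thus False using assms l by blast
  qed
  \<comment> \<open>Half of the smallest gap leaves room for continuity; the inserted 1 covers the
    case of a single active index.\<close>
  define \<kappa> where "\<kappa> = Min (insert 1 ((\<lambda>l. - gap l j \<theta> / 2) ` (A - {j})))"
  have \<kappa>: "\<kappa> > 0" unfolding \<kappa>_def using A_fin neg by (subst Min_gr_iff) auto
  have \<kappa>l: "\<kappa> \<le> - gap l j \<theta> / 2" if "l \<in> A - {j}" for l
    unfolding \<kappa>_def using A_fin that by (intro Min_le) auto
  have "\<forall>\<^sub>F t in nhds 0. \<forall>l\<in>A - {j}. gap l j (\<theta> + t) < - \<kappa>"
  proof (rule eventually_ball_finite)
    show "\<forall>l\<in>A - {j}. \<forall>\<^sub>F t in nhds 0. gap l j (\<theta> + t) < - \<kappa>"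
    proof
      fix l assume l: "l \<in> A - {j}"
      have "isCont (\<lambda>t. gap l j (\<theta> + t)) 0" unfolding gap_def times_complex.sel cis.sel by (intro continuous_intros)
      hence "((\<lambda>t. gap l j (\<theta> + t)) \<longlongrightarrow> gap l j (\<theta> + 0)) (nhds 0)"
        unfolding isCont_def by (rule tendsto_at_iff_tendsto_nhds[of "\<lambda>t. gap l j (\<theta> + t)", THEN iffD1])
      moreover have "gap l j (\<theta> + 0) < - \<kappa>" using \<kappa>l[OF l] neg[OF l] \<kappa> by simp
      ultimately show "\<forall>\<^sub>F t in nhds 0. gap l j (\<theta> + t) < - \<kappa>" by (rule order_tendstoD(2))
    qed
  qed (use A_fin in auto)
  then obtain d where d: "d > 0" "\<And>t l. \<bar>t\<bar> < d \<Longrightarrow> l \<in> A - {j} \<Longrightarrow> gap l j (\<theta> + t) < - \<kappa>"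
    unfolding eventually_nhds_metric by (auto simp: dist_real_def)
  have "noncrit \<theta> j (min 1 (d / 2)) \<kappa>"
    unfolding noncrit_def using j d \<kappa> by (auto intro!: less_imp_le)
  thus ?thesis by (rule that)
qed

lemma local_structure:
  obtains (noncrit) j \<delta> \<kappa> where "noncrit \<theta> j \<delta> \<kappa>"
  | (crit) j k \<delta> \<kappa> where "crit \<theta> j k \<delta> \<kappa>" "critical_angle q m w H \<theta>" "extremal_pair \<theta> j k"
proof (cases "\<exists>j. maximal \<theta> = {j}")
  case True
  thus ?thesis using noncrit_exists noncrit by blast
next
  case False
  define v where "v l = Im (w l * cis (real q * \<theta>))" for l
  have fin: "finite (maximal \<theta>)" using A_fin by (simp add: maximal_def)
  have "Min (v ` maximal \<theta>) \<in> v ` maximal \<theta>" "Max (v ` maximal \<theta>) \<in> v ` maximal \<theta>"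
    using fin maximal_nonempty by auto
  then obtain j k where j: "j \<in> maximal \<theta>" "v j = Min (v ` maximal \<theta>)" and k: "k \<in> maximal \<theta>" "v k = Max (v ` maximal \<theta>)"
    by (metis imageE)
  have ext: "v j \<le> v l" "v l \<le> v k" if "l \<in> maximal \<theta>" for l
    unfolding j(2) k(2) using fin that by auto
  have "j \<noteq> k"
  proof
    assume "j = k"
    hence "v l = v j" if "l \<in> maximal \<theta>" for l using ext[OF that] by simp
    hence "l = j" if "l \<in> maximal \<theta>" for l
      using maximal_Im_inj[OF that j(1)] that unfolding v_def by simp
    hence "maximal \<theta> = {j}" using j(1) by blast
    thus False using False by blast
  qed
  have ep: "extremal_pair \<theta> j k" using j(1) k(1) ext by (simp add: extremal_pair_def v_def)
  then obtain \<delta> \<kappa> where "crit \<theta> j k \<delta> \<kappa>" by (rule crit_exists)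
  thus ?thesis by (rule crit[OF _ critical_if_two_maximal[OF j(1) k(1) \<open>j \<noteq> k\<close>] ep])
qed

end

subsection \<open>Zeros in blocks of unit logarithmic length\<close>

context normalized_sum_constants
begin

text \<open>The second summand is 2 pi times the bound 8 C2 for the two windows beside the
  rectangle.\<close>

definition C7 :: "real \<Rightarrow> real" where "C7 B = C6 B + 16 * pi * C2"

text \<open>The increment of |w j - w k| exp (q X), that is, of 2 pi times the main term, over one
  block; it telescopes in the summation.\<close>

definition block_main :: "nat \<Rightarrow> nat \<Rightarrow> real \<Rightarrow> real" where
  "block_main j k X = norm (w j - w k) * (exp (real q * (X + 1)) - exp (real q * X))"

lemma bounded_strip_block:
  assumes "X \<ge> 1" "c \<ge> 0"
  shows "bounded (strip_block \<theta> c X)"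
proof (rule bounded_subset[OF bounded_cbox])
  show "strip_block \<theta> c X \<subseteq> cbox (Complex X (\<theta> - c * width X)) (Complex (X + 1) (\<theta> + c * width X))"
  proof
    fix s assume s: "s \<in> strip_block \<theta> c X"
    hence "c * width (Re s) \<le> c * width X"
      using assms width_decreasing(1)[of X "Re s"] by (intro mult_left_mono) (auto simp: strip_block_def)
    thus "s \<in> cbox (Complex X (\<theta> - c * width X)) (Complex (X + 1) (\<theta> + c * width X))"
      using s by (auto simp: strip_block_def in_cbox_complex_iff)
  qed
qed

text \<open>At zeros of g the block of the strip is squeezed between the rectangle of
  \<open>strip_rect\<close> and its union with one window on each side. The inner inclusion uses c
  \<ge> exp p * B.\<close>

lemma strip_count_generic:
  assumes cr: "crit \<theta> j k \<delta> \<kappa>" and B: "B = K / \<kappa> + 2" and X: "X \<ge> X0" and c: "c \<ge> exp (real p) * B"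
    and small: "20 * B * width X \<le> 1" "(c + 1) * width X \<le> 2 * \<delta>"
    and nz: "\<And>s. Re s = X \<or> Re s = X + 1 \<Longrightarrow> \<bar>Im s - \<theta>\<bar> \<le> 2 \<Longrightarrow> g s \<noteq> 0"
  shows "\<bar>2 * pi * real_of_int (zero_count g (strip_block \<theta> c X)) - block_main j k X\<bar> \<le> C7 B * (X * growth X)"
proof -
  have \<kappa>: "\<kappa> > 0" and \<delta>: "\<delta> \<le> 1" using cr by (auto simp: crit_def)
  have X1: "X \<ge> 1" using X X0 by simp
  have \<beta>: "width X > 0" using width_pos X1 by simp
  have B2: "B > 2" using B K_pos \<kappa> by simp
  have "1 * B \<le> exp (real p) * B" using B2 by (intro mult_right_mono) auto
  hence cB: "c \<ge> B" using c by simp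
  have Bb: "B * width X < (c + 1) * width X" using cB \<beta> by simp
  have cb: "c * width X \<le> 2" using small(2) \<delta> \<beta> by (simp add: algebra_simps)
  obtain t1 t2 where t: "\<theta> + (B - 1) * width X \<le> t2" "t2 \<le> \<theta> + B * width X"
    "\<theta> - B * width X \<le> t1" "t1 \<le> \<theta> - (B - 1) * width X"
    and box: "\<bar>2 * pi * real_of_int (zero_count g (box (Complex X t1) (Complex (X + 1) t2))) - block_main j k X\<bar> \<le> C6 B * (X * growth X)"
  proof (rule strip_rect[OF cr B X small(1)])
    show "B * width X \<le> 2 * \<delta>" using Bb small(2) by linarith
    show "g s \<noteq> 0" if "Re s = X \<or> Re s = X + 1" "\<bar>Im s - \<theta>\<bar> \<le> B * width X" for s
      using nz[OF that(1)] that(2) Bb small(2) \<delta> by linarith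
  qed (auto simp: block_main_def)
  \<comment> \<open>The outer end (c + 1) \<open>width X\<close> is chosen so that after the loss of
    one width the window still reaches the edge c \<open>width X\<close> of the strip.\<close>
  define W1 where "W1 = {s. X \<le> Re s \<and> Re s \<le> X + 1 \<and> \<theta> + (B - 1) * width X \<le> Im s \<and> Im s \<le> \<theta> + (c + 1) * width X - width X}"
  define W2 where "W2 = {s. X \<le> Re s \<and> Re s \<le> X + 1 \<and> \<theta> - (c + 1) * width X + width X \<le> Im s \<and> Im s \<le> \<theta> - (B - 1) * width X}"
  note cw = crit_windows[OF cr B X Bb small(2), folded W1_def W2_def]
  note gnz = cw(3)
  define Bx where "Bx = box (Complex X t1) (Complex (X + 1) t2)"
  have bW: "bounded W1" "bounded W2"
    by (rule bounded_subset[OF bounded_cbox[of "Complex X (\<theta> + (B - 1) * width X)" "Complex (X + 1) (\<theta> + (c + 1) * width X - width X)"]];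
        auto simp: W1_def in_cbox_complex_iff)
       (rule bounded_subset[OF bounded_cbox[of "Complex X (\<theta> - (c + 1) * width X + width X)" "Complex (X + 1) (\<theta> - (B - 1) * width X)"]];
        auto simp: W2_def in_cbox_complex_iff)
  have "zero_count g Bx \<le> zero_count g (strip_block \<theta> c X)"
  proof (rule zero_count_mono[OF g_entire gnz bounded_strip_block])
    fix s assume "s \<in> Bx"
    hence s: "X < Re s" "Re s < X + 1" "\<bar>Im s - \<theta>\<bar> < B * width X" using t by (auto simp: Bx_def in_box_complex_iff)
    have "B * width X = exp (real p) * B * (exp (- real p) * width X)" by (simp add: exp_minus)
    also have "\<dots> \<le> c * width (Re s)"
      using c width_decreasing(2)[OF X1, of "Re s"] s \<beta> B2 cB by (intro mult_mono) auto
    finally show "s \<in> strip_block \<theta> c X" using s by (simp add: strip_block_def)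
  qed (use X1 cB B2 in auto)
  moreover have "zero_count g (strip_block \<theta> c X) \<le> zero_count g (Bx \<union> W1 \<union> W2)"
  proof (rule zero_count_mono[OF g_entire gnz])
    show "bounded (Bx \<union> W1 \<union> W2)" using bW by (simp add: Bx_def bounded_box)
    fix s assume s: "s \<in> strip_block \<theta> c X" and gs: "g s = 0"
    hence s1: "X \<le> Re s" "Re s < X + 1" "\<bar>Im s - \<theta>\<bar> < c * width (Re s)" by (auto simp: strip_block_def)
    have "c * width (Re s) \<le> c * width X" using s1 X1 cB B2 width_decreasing(1)[OF X1, of "Re s"] by (intro mult_left_mono) auto
    hence s2: "\<bar>Im s - \<theta>\<bar> < c * width X" using s1 by linarith
    have "Re s \<noteq> X" using nz[of s] gs s2 cb by auto
    thus "s \<in> Bx \<union> W1 \<union> W2"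
      using s1 s2 t by (auto simp: Bx_def W1_def W2_def in_box_complex_iff algebra_simps)
  qed
  moreover have "zero_count g (Bx \<union> W1 \<union> W2) \<le> zero_count g Bx + zero_count g W1 + zero_count g W2"
    using zero_count_Un_le[OF g_entire gnz, of "Bx \<union> W1" W2] zero_count_Un_le[OF g_entire gnz, of Bx W1] bW
    by (simp add: Bx_def bounded_box)
  ultimately have "real_of_int (zero_count g Bx) \<le> real_of_int (zero_count g (strip_block \<theta> c X))"
    "real_of_int (zero_count g (strip_block \<theta> c X)) \<le> real_of_int (zero_count g Bx) + 8 * C2 * growth X"
    using cw(1,2) by linarith+
  hence "2 * pi * real_of_int (zero_count g Bx) \<le> 2 * pi * real_of_int (zero_count g (strip_block \<theta> c X))"
    "2 * pi * real_of_int (zero_count g (strip_block \<theta> c X)) \<le> 2 * pi * (real_of_int (zero_count g Bx) + 8 * C2 * growth X)"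
    by (intro mult_left_mono; simp)+
  moreover have "16 * pi * C2 * growth X \<le> 16 * pi * C2 * (X * growth X)"
    using C2_pos growth_ge1[of X] X1 by (intro mult_left_mono) auto
  ultimately have "\<bar>2 * pi * real_of_int (zero_count g (strip_block \<theta> c X)) - block_main j k X\<bar> \<le> C6 B * (X * growth X) + 16 * pi * C2 * (X * growth X)"
    using box unfolding Bx_def[symmetric] distrib_left by linarith
  thus ?thesis by (simp add: C7_def distrib_right)
qed

text \<open>Blocks with zeros on their vertical sides are reached as limits of blocks shifted slightly to the
  left, which contain the same zeros of the strip.\<close>

lemma strip_count:
  assumes cr: "crit \<theta> j k \<delta> \<kappa>" and B: "B = K / \<kappa> + 2" and c: "c \<ge> exp (real p) * B"
  obtains X1 where "X1 \<ge> X0" "\<exists>s. g s \<noteq> 0"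
    "\<And>X. X \<ge> X1 \<Longrightarrow> \<bar>2 * pi * real_of_int (zero_count g (strip_block \<theta> c X)) - block_main j k X\<bar> \<le> C7 B * (X * growth X)"
    "\<And>X. X \<ge> X1 \<Longrightarrow> c * width X \<le> 2"
proof -
  have \<kappa>: "\<kappa> > 0" and \<delta>: "\<delta> > 0" "\<delta> \<le> 1" using cr by (auto simp: crit_def)
  have B2: "B > 2" using B K_pos \<kappa> by simp
  have "1 * B \<le> exp (real p) * B" using B2 by (intro mult_right_mono) auto
  hence cB: "c \<ge> B" using c by simp
  define \<epsilon> where "\<epsilon> = min (1 / (20 * B)) (2 * \<delta> / (c + 1))"
  have "\<epsilon> > 0" using B2 \<delta> cB by (simp add: \<epsilon>_def)
  then obtain Xs where Xs: "Xs \<ge> 1" "\<And>X. X \<ge> Xs \<Longrightarrow> width X \<le> \<epsilon>" by (rule width_small) blast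
  define Xc where "Xc = max X0 Xs"
  have small: "X \<ge> X0" "20 * B * width X \<le> 1" "(c + 1) * width X \<le> 2 * \<delta>" "X \<ge> 1" if "X \<ge> Xc" for X
  proof -
    have "width X \<le> 1 / (20 * B)" "width X \<le> 2 * \<delta> / (c + 1)" using Xs(2)[of X] that by (auto simp: Xc_def \<epsilon>_def)
    thus "20 * B * width X \<le> 1" "(c + 1) * width X \<le> 2 * \<delta>" using B2 cB by (auto simp: field_simps)
    show "X \<ge> X0" "X \<ge> 1" using that Xs(1) by (auto simp: Xc_def)
  qed
  have c2: "c * width X \<le> 2" if "X \<ge> Xc" for X
    using small[OF that] \<delta> width_pos[of X] by (simp add: algebra_simps)
  have Bb: "B * width Xc < (c + 1) * width Xc" using cB width_pos[of Xc] small(4)[of Xc] by simp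
  have gnz: "\<exists>s. g s \<noteq> 0"
    by (rule crit_windows(3)[OF cr B small(1)[of Xc] Bb small(3)[of Xc]]) simp_all
  have main: "\<bar>2 * pi * real_of_int (zero_count g (strip_block \<theta> c X)) - block_main j k X\<bar> \<le> C7 B * (X * growth X)"
    if X: "X > Xc" for X
  proof -
    define Zs where "Zs = {s \<in> cbox (Complex (X - 1) (\<theta> - 2)) (Complex (X + 2) (\<theta> + 2)). g s = 0}"
    have fin: "finite Zs" unfolding Zs_def by (rule entire_finite_zeros[OF g_entire gnz bounded_cbox])
    have lim: "((\<lambda>Y. Y) \<longlongrightarrow> X) (at_left X)" by (rule tendsto_ident_at)
    \<comment> \<open>Y is so close to X that no relevant zero has real part in [Y, X) or [Y + 1, X
      + 1); the shifted sides are then free of zeros and the count is unchanged.\<close>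
    have ev1: "\<forall>\<^sub>F Y in at_left X. \<forall>s\<in>Zs. (Re s < X \<longrightarrow> Re s < Y) \<and> (Re s < X + 1 \<longrightarrow> Re s - 1 < Y)"
    proof (rule eventually_ball_finite[OF fin], intro ballI eventually_conj)
      fix s
      show "\<forall>\<^sub>F Y in at_left X. Re s < X \<longrightarrow> Re s < Y"
        by (cases "Re s < X") (auto intro: order_tendstoD(1)[OF lim])
      show "\<forall>\<^sub>F Y in at_left X. Re s < X + 1 \<longrightarrow> Re s - 1 < Y"
        by (cases "Re s < X + 1") (auto intro: order_tendstoD(1)[OF lim])
    qed
    have ev2: "\<forall>\<^sub>F Y in at_left X. Y > Xc" by (rule order_tendstoD(1)[OF lim X])
    have ev3: "\<forall>\<^sub>F Y in at_left X. X - 1 < Y" by (rule order_tendstoD(1)[OF lim]) simp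
    have ev4: "\<forall>\<^sub>F Y in at_left X. Y < X" by (simp add: eventually_at_filter)
    \<comment> \<open>The count stays fixed at X while main and error terms move with Y, so \<phi>
      is continuous and the inequality passes to the limit.\<close>
    define \<phi> where "\<phi> Y = \<bar>2 * pi * real_of_int (zero_count g (strip_block \<theta> c X)) - block_main j k Y\<bar> - C7 B * (Y * growth Y)" for Y
    have "isCont \<phi> X" unfolding \<phi>_def block_main_def growth_def by (intro continuous_intros)
    hence \<phi>lim: "(\<phi> \<longlongrightarrow> \<phi> X) (at_left X)"
      unfolding isCont_def by (rule filterlim_mono[OF _ order.refl at_le]) auto
    have "\<forall>\<^sub>F Y in at_left X. \<phi> Y \<le> 0"
      using ev1 ev2 ev3 ev4
    proof eventually_elim
      case (elim Y)
      have Z: "Re s \<noteq> Y \<and> Re s \<noteq> Y + 1 \<and> (Re s < X \<longrightarrow> Re s < Y) \<and> (Re s < X + 1 \<longrightarrow> Re s < Y + 1)"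
        if "g s = 0" "\<bar>Im s - \<theta>\<bar> \<le> 2" "X - 1 \<le> Re s" "Re s \<le> X + 2" for s
      proof -
        have "s \<in> Zs" using that by (auto simp: Zs_def in_cbox_complex_iff)
        thus ?thesis using elim by fastforce
      qed
      have strip: "\<bar>Im s - \<theta>\<bar> \<le> 2" if "\<bar>Im s - \<theta>\<bar> < c * width (Re s)" "Y \<le> Re s" for s
        using that c2[of "Re s"] elim by simp
      have "{s \<in> strip_block \<theta> c X. g s = 0} = {s \<in> strip_block \<theta> c Y. g s = 0}"
      proof (intro set_eqI iffI)
        fix s assume "s \<in> {s \<in> strip_block \<theta> c X. g s = 0}"
        hence s: "X \<le> Re s" "Re s < X + 1" "\<bar>Im s - \<theta>\<bar> < c * width (Re s)" "g s = 0" by (auto simp: strip_block_def)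
        have "Re s < Y + 1" using Z[OF s(4) strip] s elim by simp
        thus "s \<in> {s \<in> strip_block \<theta> c Y. g s = 0}" using s elim by (simp add: strip_block_def)
      next
        fix s assume "s \<in> {s \<in> strip_block \<theta> c Y. g s = 0}"
        hence s: "Y \<le> Re s" "Re s < Y + 1" "\<bar>Im s - \<theta>\<bar> < c * width (Re s)" "g s = 0" by (auto simp: strip_block_def)
        have "\<not> Re s < X" using Z[OF s(4) strip] s elim by force
        thus "s \<in> {s \<in> strip_block \<theta> c X. g s = 0}" using s elim by (simp add: strip_block_def)
      qed
      hence eq: "zero_count g (strip_block \<theta> c X) = zero_count g (strip_block \<theta> c Y)"
        by (simp add: zero_count_def)
      have "\<bar>2 * pi * real_of_int (zero_count g (strip_block \<theta> c Y)) - block_main j k Y\<bar> \<le> C7 B * (Y * growth Y)"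
      proof (rule strip_count_generic[OF cr B _ c])
        show "g s \<noteq> 0" if "Re s = Y \<or> Re s = Y + 1" "\<bar>Im s - \<theta>\<bar> \<le> 2" for s
          using Z[of s] that elim by fastforce
      qed (use small[of Y] elim in auto)
      thus ?case unfolding \<phi>_def eq by simp
    qed
    from tendsto_upperbound[OF \<phi>lim this] have "\<phi> X \<le> 0" by simp
    thus ?thesis by (simp add: \<phi>_def)
  qed
  show ?thesis
    by (rule that[of "Xc + 1"]) (use main c2 small(1)[of Xc] gnz in auto)
qed

text \<open>Domination is available up to 2\<delta> from the ray, so windows that lose one width
  (eventually at most \<delta>) still cover everything up to distance \<delta>.\<close>

lemma outside_count:
  assumes cr: "crit \<theta> j k \<delta> \<kappa>" and B: "B = K / \<kappa> + 2" and c: "c \<ge> exp (real p) * B"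
  obtains X1 where "X1 \<ge> X0"
    "\<And>X. X \<ge> X1 \<Longrightarrow> real_of_int (zero_count g {s. X \<le> Re s \<and> Re s \<le> X + 1 \<and> \<bar>Im s - \<theta>\<bar> \<le> \<delta> \<and> \<bar>Im s - \<theta>\<bar> \<ge> c * width (Re s)}) \<le> 8 * C2 * growth X"
proof -
  have \<kappa>: "\<kappa> > 0" and \<delta>: "\<delta> > 0" "\<delta> \<le> 1" using cr by (auto simp: crit_def)
  have B2: "B > 2" using B K_pos \<kappa> by simp
  have "\<delta> / B > 0" using B2 \<delta> by simp
  then obtain Xs where Xs: "Xs \<ge> 1" "\<And>X. X \<ge> Xs \<Longrightarrow> width X \<le> \<delta> / B" by (rule width_small) blast
  show ?thesis
  proof (rule that[of "max X0 Xs"])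
    fix X assume X: "X \<ge> max X0 Xs"
    have X1: "X \<ge> 1" "X \<ge> X0" using X X0 by auto
    have \<beta>: "width X > 0" using width_pos X1 by simp
    have Bd: "B * width X \<le> \<delta>" using Xs(2)[of X] X B2 by (simp add: field_simps)
    have "1 * width X \<le> B * width X" using B2 \<beta> by (intro mult_right_mono) auto
    hence b\<delta>: "width X \<le> \<delta>" using Bd by simp
    have Bd': "B * width X < 2 * \<delta>" using Bd \<delta> by simp
    define W1 where "W1 = {s. X \<le> Re s \<and> Re s \<le> X + 1 \<and> \<theta> + (B - 1) * width X \<le> Im s \<and> Im s \<le> \<theta> + 2 * \<delta> - width X}"
    define W2 where "W2 = {s. X \<le> Re s \<and> Re s \<le> X + 1 \<and> \<theta> - 2 * \<delta> + width X \<le> Im s \<and> Im s \<le> \<theta> - (B - 1) * width X}"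
    note cw = crit_windows[OF cr B X1(2) Bd' order.refl, folded W1_def W2_def]
    have bW: "bounded W1" "bounded W2"
      by (rule bounded_subset[OF bounded_cbox[of "Complex X (\<theta> + (B - 1) * width X)" "Complex (X + 1) (\<theta> + 2 * \<delta> - width X)"]];
          auto simp: W1_def in_cbox_complex_iff)
         (rule bounded_subset[OF bounded_cbox[of "Complex X (\<theta> - 2 * \<delta> + width X)" "Complex (X + 1) (\<theta> - (B - 1) * width X)"]];
          auto simp: W2_def in_cbox_complex_iff)
    have "zero_count g {s. X \<le> Re s \<and> Re s \<le> X + 1 \<and> \<bar>Im s - \<theta>\<bar> \<le> \<delta> \<and> \<bar>Im s - \<theta>\<bar> \<ge> c * width (Re s)} \<le> zero_count g (W1 \<union> W2)"
    proof (rule zero_count_mono[OF g_entire cw(3)])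
      fix s assume "s \<in> {s. X \<le> Re s \<and> Re s \<le> X + 1 \<and> \<bar>Im s - \<theta>\<bar> \<le> \<delta> \<and> \<bar>Im s - \<theta>\<bar> \<ge> c * width (Re s)}"
      hence s: "X \<le> Re s" "Re s \<le> X + 1" "\<bar>Im s - \<theta>\<bar> \<le> \<delta>" "\<bar>Im s - \<theta>\<bar> \<ge> c * width (Re s)" by auto
      have "B * width X = exp (real p) * B * (exp (- real p) * width X)" by (simp add: exp_minus)
      also have "\<dots> \<le> c * width (Re s)"
        using c width_decreasing(2)[OF X1(1) s(1,2)] \<beta> B2 order.trans[OF _ c, of 0] by (intro mult_mono) auto
      finally have "\<bar>Im s - \<theta>\<bar> \<ge> (B - 1) * width X" using s \<beta> by (simp add: algebra_simps)
      thus "s \<in> W1 \<union> W2" using s b\<delta> by (auto simp: W1_def W2_def)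
    qed (use bW in auto)
    also have "\<dots> \<le> zero_count g W1 + zero_count g W2" by (rule zero_count_Un_le[OF g_entire cw(3) bW])
    finally show "real_of_int (zero_count g {s. X \<le> Re s \<and> Re s \<le> X + 1 \<and> \<bar>Im s - \<theta>\<bar> \<le> \<delta> \<and> \<bar>Im s - \<theta>\<bar> \<ge> c * width (Re s)}) \<le> 8 * C2 * growth X"
      using cw(1,2) by linarith
  qed simp
qed

text \<open>One term dominates within \<delta> of \<theta>; restricting to \<delta> / 2 leaves room
  for moving to good lines. The constant 8 matches \<open>outside_count\<close>.\<close>

lemma noncrit_count:
  assumes nc: "noncrit \<theta> j \<delta> \<kappa>"
  obtains X1 where "X1 \<ge> X0" "\<exists>s. g s \<noteq> 0"
    "\<And>X. X \<ge> X1 \<Longrightarrow> real_of_int (zero_count g {s. X \<le> Re s \<and> Re s \<le> X + 1 \<and> \<bar>Im s - \<theta>\<bar> \<le> \<delta> / 2}) \<le> 8 * C2 * growth X"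
proof -
  have j: "j \<in> A" and \<kappa>: "\<kappa> > 0" and \<delta>: "\<delta> > 0" "\<delta> \<le> 1"
    and gap: "\<And>t l. \<bar>t\<bar> \<le> \<delta> \<Longrightarrow> l \<in> A - {j} \<Longrightarrow> gap l j (\<theta> + t) \<le> - \<kappa>" using nc by (auto simp: noncrit_def)
  have "min (\<kappa> / K) (\<delta> / 2) > 0" using \<kappa> \<delta> K_pos by simp
  then obtain Xs where Xs: "Xs \<ge> 1" "\<And>X. X \<ge> Xs \<Longrightarrow> width X \<le> min (\<kappa> / K) (\<delta> / 2)" by (rule width_small) blast
  have *: "real_of_int (zero_count g {s. X \<le> Re s \<and> Re s \<le> X + 1 \<and> \<bar>Im s - \<theta>\<bar> \<le> \<delta> / 2}) \<le> 8 * C2 * growth X \<and> (\<exists>s. g s \<noteq> 0)"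
    if X: "X \<ge> max X0 (Xs + 1)" for X
  proof -
    have X1: "X \<ge> X0" "X \<ge> 1" using X X0 by auto
    have b: "width X \<le> \<kappa> / K" "width X \<le> \<delta> / 2" "width X > 0" using Xs(2)[of X] X width_pos[of X] X1 by auto
    have Kb: "K * width X \<le> \<kappa>" using b(1) K_pos by (simp add: field_simps)
    have "gap l j y \<le> - K * width X" if "l \<in> A - {j}" "\<theta> - \<delta> \<le> y" "y \<le> \<theta> + \<delta>" for l y
    proof -
      have "\<bar>y - \<theta>\<bar> \<le> \<delta>" using that by linarith
      from gap[OF this that(1)] show ?thesis using Kb by simp
    qed
    moreover have "width X < \<delta>" using b \<delta> by linarith
    ultimately have w: "real_of_int (zero_count g {s. X \<le> Re s \<and> Re s \<le> X + 1 \<and> \<theta> - \<delta> + width X \<le> Im s \<and> Im s \<le> \<theta> + \<delta> - width X}) \<le> 4 * C2 * growth X"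
      "\<exists>s. g s \<noteq> 0"
      using \<delta> window[OF j X1(1), of "\<theta> - \<delta>" "\<theta> + \<delta>"] by auto
    have "zero_count g {s. X \<le> Re s \<and> Re s \<le> X + 1 \<and> \<bar>Im s - \<theta>\<bar> \<le> \<delta> / 2}
      \<le> zero_count g {s. X \<le> Re s \<and> Re s \<le> X + 1 \<and> \<theta> - \<delta> + width X \<le> Im s \<and> Im s \<le> \<theta> + \<delta> - width X}"
    proof (rule zero_count_mono[OF g_entire w(2)])
      show "bounded {s. X \<le> Re s \<and> Re s \<le> X + 1 \<and> \<theta> - \<delta> + width X \<le> Im s \<and> Im s \<le> \<theta> + \<delta> - width X}"
        by (rule bounded_subset[OF bounded_cbox[of "Complex X (\<theta> - \<delta> + width X)" "Complex (X + 1) (\<theta> + \<delta> - width X)"]])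
           (auto simp: in_cbox_complex_iff)
      fix s assume s: "s \<in> {s. X \<le> Re s \<and> Re s \<le> X + 1 \<and> \<bar>Im s - \<theta>\<bar> \<le> \<delta> / 2}"
      hence "\<bar>Im s - \<theta>\<bar> \<le> \<delta> / 2" by simp
      hence "\<theta> - \<delta> + width X \<le> Im s" "Im s \<le> \<theta> + \<delta> - width X" using b(2) by linarith+
      thus "s \<in> {s. X \<le> Re s \<and> Re s \<le> X + 1 \<and> \<theta> - \<delta> + width X \<le> Im s \<and> Im s \<le> \<theta> + \<delta> - width X}" using s by simp
    qed
    moreover have "C2 * growth X \<ge> 0" using C2_pos growth_ge1[of X] X1 by simp
    ultimately have "real_of_int (zero_count g {s. X \<le> Re s \<and> Re s \<le> X + 1 \<and> \<bar>Im s - \<theta>\<bar> \<le> \<delta> / 2}) \<le> 8 * C2 * growth X"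
      using w(1) by linarith
    thus ?thesis using w(2) by blast
  qed
  show ?thesis
    by (rule that[of "max X0 (Xs + 1)"]) (use *[OF order.refl] * in auto)
qed

end

subsection \<open>Summation over the blocks\<close>

text \<open>The starting point X is Y reduced by an integer into one unit interval, so the base
  bound must hold on that whole interval and not just at one point.\<close>

lemma unit_step_telescope:
  fixes D e :: "real \<Rightarrow> real"
  assumes step: "\<And>X. X \<ge> Xm \<Longrightarrow> D (X + 1) \<le> D X + e X"
    and base: "\<And>X. Xm \<le> X \<Longrightarrow> X \<le> Xm + 1 \<Longrightarrow> D X \<le> Q" and Y: "Y \<ge> Xm"
  obtains k :: nat and X where "Xm \<le> X" "X \<le> Xm + 1" "Y = X + real k" "D Y \<le> Q + (\<Sum>i<k. e (X + real i))"
proof -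
  define k where "k = nat \<lfloor>Y - Xm\<rfloor>"
  define X where "X = Y - real k"
  have k: "real k = of_int \<lfloor>Y - Xm\<rfloor>" using Y by (simp add: k_def)
  have X: "Xm \<le> X" "X \<le> Xm + 1" unfolding X_def k by linarith+
  have "D (X + real n) \<le> Q + (\<Sum>i<n. e (X + real i))" for n
  proof (induction n)
    case 0
    show ?case using base X by simp
  next
    case (Suc n)
    have "D (X + real (Suc n)) \<le> D (X + real n) + e (X + real n)"
      using step[of "X + real n"] X by (simp add: algebra_simps)
    thus ?case using Suc by simp
  qed
  from this[of k] show ?thesis using that X by (simp add: X_def)
qed

context normalized_sum_constants
begin

lemma f_nonzero: "\<exists>s. g s \<noteq> 0 \<Longrightarrow> \<exists>z. f z \<noteq> 0"
  by (auto simp: g_def)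

lemma log_strip_iff: "z \<in> log_strip p \<theta> c \<longleftrightarrow> (\<exists>s. z = exp s \<and> Re s > 0 \<and> \<bar>Im s - \<theta>\<bar> < c * width (Re s))"
proof -
  have width: "ln r / r ^ p = width (ln r)" if "r > 1" for r :: real
  proof -
    have "exp (real p * ln r) = r ^ p" using that by (simp add: exp_of_nat_mult)
    thus ?thesis by (simp add: width_def exp_minus divide_inverse)
  qed
  show ?thesis
  proof
    assume "z \<in> log_strip p \<theta> c"
    then obtain r \<phi> where r: "z = of_real r * cis \<phi>" "r > 1" "\<bar>\<phi> - \<theta>\<bar> < c * (ln r / r ^ p)" by (auto simp: log_strip_def)
    show "\<exists>s. z = exp s \<and> Re s > 0 \<and> \<bar>Im s - \<theta>\<bar> < c * width (Re s)"
      using r width[OF r(2)] by (intro exI[of _ "Complex (ln r) \<phi>"]) (simp add: exp_eq_polar)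
  next
    assume "\<exists>s. z = exp s \<and> Re s > 0 \<and> \<bar>Im s - \<theta>\<bar> < c * width (Re s)"
    then obtain s where s: "z = exp s" "Re s > 0" "\<bar>Im s - \<theta>\<bar> < c * width (Re s)" by blast
    show "z \<in> log_strip p \<theta> c"
      unfolding log_strip_def mem_Collect_eq
      by (rule exI[of _ "exp (Re s)"], rule exI[of _ "Im s"]) (use s width[of "exp (Re s)"] in \<open>simp add: exp_eq_polar\<close>)
  qed
qed

lemma log_strip_block:
  assumes "X > 0"
  shows "exp ` strip_block \<theta> c X = {z \<in> log_strip p \<theta> c. exp X \<le> norm z \<and> norm z < exp (X + 1)}"
  using assms by (auto simp: log_strip_iff strip_block_def)

lemma log_strip_periodic: "log_strip p (\<theta> + 2 * pi * of_int n) c = log_strip p \<theta> c"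
proof -
  have *: "log_strip p \<theta> c \<subseteq> log_strip p (\<theta> + 2 * pi * of_int n) c" for \<theta> n
  proof
    fix z assume "z \<in> log_strip p \<theta> c"
    then obtain r \<phi> where r: "z = of_real r * cis \<phi>" "r > 1" "\<bar>\<phi> - \<theta>\<bar> < c * (ln r / r ^ p)" by (auto simp: log_strip_def)
    have "cis (\<phi> + 2 * pi * of_int n) = cis \<phi>" by (simp add: cis_mult[symmetric] cis_multiple_2pi)
    thus "z \<in> log_strip p (\<theta> + 2 * pi * of_int n) c"
      unfolding log_strip_def mem_Collect_eq using r
      by (intro exI[of _ r] exI[of _ "\<phi> + 2 * pi * of_int n"]) simp
  qed
  show ?thesis
    using *[of \<theta> n] *[of "\<theta> + 2 * pi * of_int n" "- n"] by simp
qed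

lemma cis_q_periodic: "cis (real q * (\<theta> + 2 * pi * of_int n)) = cis (real q * \<theta>)"
proof -
  have "real q * (\<theta> + 2 * pi * of_int n) = real q * \<theta> + 2 * pi * of_int (int q * n)" by (simp add: algebra_simps)
  thus ?thesis by (simp add: cis_mult[symmetric] cis_multiple_2pi del: of_int_mult)
qed

lemma maximal_periodic: "maximal (\<theta> + 2 * pi * of_int n) = maximal \<theta>"
  unfolding maximal_def gap_def cis_q_periodic ..

text \<open>One logarithm is the factor X in the error of a block, the other counts the
  blocks.\<close>

definition strip_asymptotics :: "nat \<Rightarrow> nat \<Rightarrow> real \<Rightarrow> real \<Rightarrow> bool" where
  "strip_asymptotics j k \<theta> c \<longleftrightarrow> (\<exists>C' R. \<forall>r\<ge>R.
     \<bar>real_of_int (zero_count f (log_strip p \<theta> c \<inter> {z. norm z < r})) - norm (w j - w k) * (r ^ q / (2 * pi))\<bar>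
      \<le> C' * (r ^ (q - p) * (ln r)\<^sup>2))"

lemma growth_mono: "x \<le> y \<Longrightarrow> growth x \<le> growth y"
  unfolding growth_def by (simp add: mult_left_mono)

lemma growth_ln: "r > 0 \<Longrightarrow> growth (ln r) = r ^ (q - p)"
  unfolding growth_def by (subst exp_of_nat_mult) simp

lemma strip_asymptotics_if_crit:
  assumes cr: "crit \<theta> j k \<delta> \<kappa>" and B: "B = K / \<kappa> + 2" and c: "c \<ge> exp (real p) * B"
  shows "strip_asymptotics j k \<theta> c"
proof -
  obtain X1 where X1: "X1 \<ge> X0" and gnz: "\<exists>s. g s \<noteq> 0"
    and sc: "\<And>X. X \<ge> X1 \<Longrightarrow> \<bar>2 * pi * real_of_int (zero_count g (strip_block \<theta> c X)) - block_main j k X\<bar> \<le> C7 B * (X * growth X)"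
    and c2: "\<And>X. X \<ge> X1 \<Longrightarrow> c * width X \<le> 2"
    by (rule strip_count[OF cr B c]) blast
  note fnz = f_nonzero[OF gnz]
  have X11: "X1 \<ge> 1" using X1 X0 by simp
  define T where "T X = log_strip p \<theta> c \<inter> {z. norm z < exp X}" for X
  define n where "n X = real_of_int (zero_count f (T X))" for X
  define N where "N = norm (w j - w k)"
  \<comment> \<open>Deviation of the count from the main term, scaled by 2 pi; over one block it
    changes exactly by the error controlled in \<open>strip_count\<close>.\<close>
  define \<Delta> where "\<Delta> X = 2 * pi * n X - N * exp (real q * X)" for X
  have bT: "bounded (T X)" for X
    by (rule bounded_subset[OF bounded_ball[of 0 "exp X"]]) (auto simp: T_def)
  have c0: "c \<ge> 0"
  proof -
    have "B \<ge> 0" using B K_pos cr by (auto simp: crit_def)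
    thus ?thesis using c order.trans[of 0 "exp (real p) * B" c] by simp
  qed
  have step: "\<bar>\<Delta> (X + 1) - \<Delta> X\<bar> \<le> C7 B * (X * growth X)" if X: "X \<ge> X1" for X
  proof -
    define S where "S = exp ` strip_block \<theta> c X"
    have S: "S = {z \<in> log_strip p \<theta> c. exp X \<le> norm z \<and> norm z < exp (X + 1)}"
      unfolding S_def using X X11 by (intro log_strip_block) auto
    have "exp X < exp (X + 1)" by simp
    hence "T (X + 1) = T X \<union> S" "T X \<inter> S = {}"
      unfolding S T_def by (auto intro: less_trans)
    moreover have "bounded S" by (rule bounded_subset[OF bT[of "X + 1"]]) (auto simp: S T_def)
    ultimately have "zero_count f (T (X + 1)) = zero_count f (T X) + zero_count f S"
      using zero_count_Un_disjoint[OF f_entire fnz bT] by simp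
    also have "zero_count f S = zero_count g (strip_block \<theta> c X)"
      unfolding S_def g_def[abs_def]
    \<comment> \<open>The strip has height less than 4 < 2 pi there, so exp is injective on the
      block.\<close>
    proof (rule zero_count_exp_image[OF f_entire fnz inj_on_exp_strip])
      fix s s' assume "s \<in> strip_block \<theta> c X" "s' \<in> strip_block \<theta> c X"
      hence "\<bar>Im s - \<theta>\<bar> < 2" "\<bar>Im s' - \<theta>\<bar> < 2"
        using c2[of "Re s"] c2[of "Re s'"] X by (auto simp: strip_block_def)
      thus "\<bar>Im s - Im s'\<bar> < 2 * pi" using pi_gt3 by linarith
    qed
    finally have "n (X + 1) = n X + real_of_int (zero_count g (strip_block \<theta> c X))" by (simp add: n_def)
    hence "\<Delta> (X + 1) - \<Delta> X = 2 * pi * real_of_int (zero_count g (strip_block \<theta> c X)) - block_main j k X"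
      by (simp add: \<Delta>_def block_main_def N_def algebra_simps)
    thus ?thesis using sc[OF X] by simp
  qed
  define Q where "Q = 2 * pi * n (X1 + 1) + N * exp (real q * (X1 + 1))"
  have n0: "n X \<ge> 0" for X using zero_count_nonneg[OF f_entire fnz] by (simp add: n_def)
  have N0: "N \<ge> 0" by (simp add: N_def)
  have base: "\<bar>\<Delta> X\<bar> \<le> Q" if "X1 \<le> X" "X \<le> X1 + 1" for X
  proof -
    have "exp X \<le> exp (X1 + 1)" using that by simp
    hence "n X \<le> n (X1 + 1)"
      unfolding n_def of_int_le_iff
      by (intro zero_count_mono[OF f_entire fnz bT]) (auto simp: T_def intro: less_le_trans[OF _ \<open>exp X \<le> exp (X1 + 1)\<close>])
    moreover have "exp (real q * X) \<le> exp (real q * (X1 + 1))" using that by (simp add: mult_left_mono)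
    hence "N * exp (real q * X) \<le> N * exp (real q * (X1 + 1))" using N0 by (rule mult_left_mono)
    moreover have "2 * pi * n X \<le> 2 * pi * n (X1 + 1)" using \<open>n X \<le> n (X1 + 1)\<close> by simp
    moreover have "2 * pi * n X \<ge> 0" "N * exp (real q * X) \<ge> 0" using n0 N0 by auto
    ultimately show ?thesis unfolding \<Delta>_def Q_def by linarith
  qed
  have C7: "C7 B \<ge> 0"
  proof -
    have "0 \<le> C7 B * (X1 * growth X1)" using sc[OF order.refl] abs_ge_zero order.trans by blast
    moreover have "X1 * growth X1 > 0" using X11 growth_ge1[of X1] by simp
    ultimately show ?thesis by (simp add: zero_le_mult_iff)
  qed
  have Q0: "Q \<ge> 0" using base[OF order.refl] by simp
  have bound: "\<bar>\<Delta> Y\<bar> \<le> (Q + C7 B) * (growth Y * Y\<^sup>2)" if Y: "Y \<ge> X1" for Y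
  proof -
    obtain k :: nat and X where kX: "X1 \<le> X" "X \<le> X1 + 1" "Y = X + real k"
      "\<bar>\<Delta> Y\<bar> \<le> Q + (\<Sum>i<k. C7 B * ((X + real i) * growth (X + real i)))"
    proof (rule unit_step_telescope[of X1 "\<lambda>X. \<bar>\<Delta> X\<bar>" "\<lambda>X. C7 B * (X * growth X)" Q Y])
      show "\<bar>\<Delta> (X + 1)\<bar> \<le> \<bar>\<Delta> X\<bar> + C7 B * (X * growth X)" if "X \<ge> X1" for X using step[OF that] by linarith
    qed (use base Y in auto)
    have Y1: "Y \<ge> 1" using Y X11 by simp
    have "(\<Sum>i<k. C7 B * ((X + real i) * growth (X + real i))) \<le> (\<Sum>i<k. C7 B * (Y * growth Y))"
    proof (intro sum_mono mult_left_mono C7 mult_mono growth_mono)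
      fix i assume "i \<in> {..<k}"
      thus "X + real i \<le> Y" "X + real i \<le> Y" using kX by auto
    qed (use Y1 in \<open>auto simp: growth_def\<close>)
    also have "\<dots> = real k * (C7 B * (Y * growth Y))" by simp
    also have "\<dots> \<le> Y * (C7 B * (Y * growth Y))"
      using kX X11 C7 Y1 growth_ge1[of Y] by (intro mult_right_mono) auto
    also have "\<dots> = C7 B * (growth Y * Y\<^sup>2)" by (simp add: power2_eq_square)
    finally have "\<bar>\<Delta> Y\<bar> \<le> Q * 1 + C7 B * (growth Y * Y\<^sup>2)" using kX(4) by linarith
    also have "Q * 1 \<le> Q * (growth Y * Y\<^sup>2)"
      using Q0 mult_mono[of 1 "growth Y" 1 "Y\<^sup>2"] growth_ge1[of Y] Y1 by (intro mult_left_mono) auto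
    finally show ?thesis by (simp add: algebra_simps)
  qed
  show ?thesis unfolding strip_asymptotics_def
  proof (rule exI[of _ "(Q + C7 B) / (2 * pi)"], rule exI[of _ "exp X1"], intro allI impI)
    fix r :: real assume r: "r \<ge> exp X1"
    have rpos: "r > 0" using r exp_gt_zero[of X1] by linarith
    have lnr: "ln r \<ge> X1" using r rpos by (simp add: ln_ge_iff)
    have "exp (real q * ln r) = r ^ q" using rpos by (simp add: exp_of_nat_mult)
    hence "\<bar>2 * pi * n (ln r) - N * r ^ q\<bar> \<le> (Q + C7 B) * (r ^ (q - p) * (ln r)\<^sup>2)"
      using bound[OF lnr] rpos by (simp add: \<Delta>_def growth_ln)
    moreover have "2 * pi * n (ln r) - N * r ^ q = 2 * pi * (n (ln r) - N * (r ^ q / (2 * pi)))"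
      by (simp add: field_simps)
    ultimately have "2 * pi * \<bar>n (ln r) - N * (r ^ q / (2 * pi))\<bar> \<le> (Q + C7 B) * (r ^ (q - p) * (ln r)\<^sup>2)"
      by (simp add: abs_mult)
    hence "\<bar>n (ln r) - N * (r ^ q / (2 * pi))\<bar> \<le> (Q + C7 B) / (2 * pi) * (r ^ (q - p) * (ln r)\<^sup>2)"
      by (simp add: field_simps)
    thus "\<bar>real_of_int (zero_count f (log_strip p \<theta> c \<inter> {z. norm z < r})) - norm (w j - w k) * (r ^ q / (2 * pi))\<bar>
      \<le> (Q + C7 B) / (2 * pi) * (r ^ (q - p) * (ln r)\<^sup>2)"
      using rpos by (simp add: n_def T_def N_def)
  qed
qed

section \<open>Zeros outside the strips and uniformity in the angle\<close>

abbreviation strips :: "real \<Rightarrow> complex set" where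
  "strips c \<equiv> (\<Union>\<theta>\<in>{\<theta>. critical_angle q m w H \<theta>}. log_strip p \<theta> c)"

text \<open>A set, and not merely a count, so that the sets for finitely many sectors can be united;
  injectivity of exp on it turns zeros of f into zeros of g.\<close>

definition sparse_cover :: "real \<Rightarrow> real \<Rightarrow> real \<Rightarrow> real \<Rightarrow> complex set \<Rightarrow> bool" where
  "sparse_cover \<theta> \<delta> c X S \<longleftrightarrow> bounded S \<and> inj_on exp S \<and> real_of_int (zero_count g S) \<le> 8 * C2 * growth X \<and>
     (\<forall>s. X \<le> Re s \<longrightarrow> Re s \<le> X + 1 \<longrightarrow> \<bar>Im s - \<theta>\<bar> < \<delta> \<longrightarrow> exp s \<notin> strips c \<longrightarrow> s \<in> S)"

definition sparse_near :: "real \<Rightarrow> real \<Rightarrow> real \<Rightarrow> bool" where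
  "sparse_near \<theta> \<delta> c \<longleftrightarrow> (\<exists>X1\<ge>X0. \<forall>X\<ge>X1. \<exists>S. sparse_cover \<theta> \<delta> c X S)"

text \<open>Everything needed near one angle, arranged for a compactness argument: apart from
  \<theta> itself, all nearby angles have a unique maximal index, so strip asymptotics are recorded
  only at the centre.\<close>

definition controlled :: "real \<Rightarrow> real \<Rightarrow> real \<Rightarrow> bool" where
  "controlled \<theta> \<delta> c\<^sub>0 \<longleftrightarrow> \<delta> > 0 \<and> (\<forall>c\<ge>c\<^sub>0. sparse_near \<theta> \<delta> c) \<and>
     (\<forall>\<theta>'. \<bar>\<theta>' - \<theta>\<bar> < \<delta> \<longrightarrow> \<theta>' \<noteq> \<theta> \<longrightarrow> (\<exists>j. maximal \<theta>' = {j})) \<and>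
     ((\<exists>j. maximal \<theta> = {j}) \<or> (\<exists>j k. extremal_pair \<theta> j k \<and> (\<forall>c\<ge>c\<^sub>0. strip_asymptotics j k \<theta> c)))"

lemma bounded_rect: "bounded {s. a \<le> Re s \<and> Re s \<le> b \<and> \<bar>Im s - c\<bar> \<le> d}"
  by (rule bounded_subset[OF bounded_cbox[of "Complex a (c - d)" "Complex b (c + d)"]])
     (auto simp: in_cbox_complex_iff abs_le_iff)

lemma sparse_coverI:
  assumes "\<delta> \<le> 1" "S = {s. X \<le> Re s \<and> Re s \<le> X + 1 \<and> \<bar>Im s - \<theta>\<bar> \<le> \<delta> \<and> P s}"
    and "real_of_int (zero_count g S) \<le> 8 * C2 * growth X"
    and "\<And>s. X \<le> Re s \<Longrightarrow> exp s \<notin> strips c \<Longrightarrow> P s"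
  shows "sparse_cover \<theta> \<delta> c X S"
proof -
  have "inj_on exp S"
  proof (rule inj_on_exp_strip)
    fix s s' assume "s \<in> S" "s' \<in> S"
    hence "\<bar>Im s - \<theta>\<bar> \<le> \<delta>" "\<bar>Im s' - \<theta>\<bar> \<le> \<delta>" by (auto simp: assms(2))
    thus "\<bar>Im s - Im s'\<bar> < 2 * pi" using assms(1) pi_gt3 by linarith
  qed
  moreover have "bounded S"
    by (rule bounded_subset[OF bounded_rect[of X "X + 1" \<theta> \<delta>]]) (auto simp: assms(2))
  ultimately show ?thesis using assms by (auto simp: sparse_cover_def)
qed

lemma maximal_singletonI:
  assumes "j \<in> A" "\<And>l. l \<in> A - {j} \<Longrightarrow> gap l j \<theta> < 0"
  shows "maximal \<theta> = {j}"
proof -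
  have "gap j j \<theta> = 0" by (simp add: gap_def)
  hence "j \<in> maximal \<theta>" using assms by (force simp: maximal_def)
  moreover have "l = j" if "l \<in> maximal \<theta>" for l
  proof (rule ccontr)
    assume "l \<noteq> j"
    have "gap j l \<theta> = - gap l j \<theta>" unfolding gap_def by (simp add: algebra_simps)
    thus False using assms(2)[of l] that \<open>l \<noteq> j\<close> assms(1) by (force simp: maximal_def)
  qed
  ultimately show ?thesis by blast
qed

lemma exists_controlled: "\<exists>\<delta> c\<^sub>0. controlled \<theta> \<delta> c\<^sub>0"
proof (cases rule: local_structure[of \<theta>])
  case (noncrit j \<delta> \<kappa>)
  have d: "\<delta> > 0" "\<delta> \<le> 1" "\<kappa> > 0" "j \<in> A" using noncrit by (auto simp: noncrit_def)
  have single: "maximal \<theta>' = {j}" if "\<bar>\<theta>' - \<theta>\<bar> \<le> \<delta>" for \<theta>'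
  proof (rule maximal_singletonI[OF d(4)])
    fix l assume "l \<in> A - {j}"
    hence "gap l j (\<theta> + (\<theta>' - \<theta>)) \<le> - \<kappa>" using noncrit that unfolding noncrit_def by blast
    thus "gap l j \<theta>' < 0" using d by simp
  qed
  obtain X1 where X1: "X1 \<ge> X0" "\<And>X. X \<ge> X1 \<Longrightarrow> real_of_int (zero_count g {s. X \<le> Re s \<and> Re s \<le> X + 1 \<and> \<bar>Im s - \<theta>\<bar> \<le> \<delta> / 2}) \<le> 8 * C2 * growth X"
    by (rule noncrit_count[OF noncrit]) blast
  have "sparse_near \<theta> (\<delta> / 2) c" for c
    unfolding sparse_near_def
  proof (rule exI[of _ X1], intro conjI X1(1) allI impI)
    fix X assume X: "X \<ge> X1"
    show "\<exists>S. sparse_cover \<theta> (\<delta> / 2) c X S"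
      by (rule exI, rule sparse_coverI[where P = "\<lambda>_. True", OF _ refl]) (use X1(2)[OF X] d in auto)
  qed
  moreover have "\<exists>j. maximal \<theta>' = {j}" if "\<bar>\<theta>' - \<theta>\<bar> < \<delta> / 2" for \<theta>' using single[of \<theta>'] that d by auto
  ultimately have "controlled \<theta> (\<delta> / 2) 0" unfolding controlled_def using d single[of \<theta>] by auto
  thus ?thesis by blast
next
  case (crit j k \<delta> \<kappa>)
  have d: "\<delta> > 0" "\<delta> \<le> 1" "\<kappa> > 0" "j \<in> A" "k \<in> A" using crit by (auto simp: crit_def)
  define B where "B = K / \<kappa> + 2"
  define c\<^sub>0 where "c\<^sub>0 = exp (real p) * B"
  have "sparse_near \<theta> \<delta> c" if c: "c \<ge> c\<^sub>0" for c
  proof -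
    obtain X1 where X1: "X1 \<ge> X0"
      "\<And>X. X \<ge> X1 \<Longrightarrow> real_of_int (zero_count g {s. X \<le> Re s \<and> Re s \<le> X + 1 \<and> \<bar>Im s - \<theta>\<bar> \<le> \<delta> \<and> \<bar>Im s - \<theta>\<bar> \<ge> c * width (Re s)}) \<le> 8 * C2 * growth X"
      by (rule outside_count[OF crit(1) B_def c[unfolded c\<^sub>0_def]]) blast
    show ?thesis unfolding sparse_near_def
    proof (rule exI[of _ X1], intro conjI X1(1) allI impI)
      fix X assume X: "X \<ge> X1"
      show "\<exists>S. sparse_cover \<theta> \<delta> c X S"
      proof (rule exI, rule sparse_coverI[OF d(2) refl X1(2)[OF X]])
        fix s assume s: "X \<le> Re s" "exp s \<notin> strips c"
        have "Re s > 0" using s X X1(1) X0 by simp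
        \<comment> \<open>Here \<theta> must be critical in the sense of non-differentiability, so
          that its strip is among the removed ones.\<close>
        moreover have "exp s \<notin> log_strip p \<theta> c" using s(2) crit(2) by blast
        ultimately have "\<not> \<bar>Im s - \<theta>\<bar> < c * width (Re s)" unfolding log_strip_iff by blast
        thus "c * width (Re s) \<le> \<bar>Im s - \<theta>\<bar>" by simp
      qed
    qed
  qed
  moreover have "\<exists>j. maximal \<theta>' = {j}" if "\<bar>\<theta>' - \<theta>\<bar> < \<delta>" "\<theta>' \<noteq> \<theta>" for \<theta>'
  proof (cases "\<theta>' > \<theta>")
    case True
    have "maximal \<theta>' = {j}"
    proof (rule maximal_singletonI[OF d(4)])
      fix l assume l: "l \<in> A - {j}"
      have t: "0 < \<theta>' - \<theta>" "\<theta>' - \<theta> \<le> 2 * \<delta>" using True that d by auto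
      have "gap l j (\<theta> + (\<theta>' - \<theta>)) \<le> - \<kappa> * (\<theta>' - \<theta>)"
        using crit(1) l t unfolding crit_def by blast
      moreover have "\<kappa> * (\<theta>' - \<theta>) > 0" using d True by simp
      ultimately show "gap l j \<theta>' < 0" by simp
    qed
    thus ?thesis by blast
  next
    case False
    have "maximal \<theta>' = {k}"
    proof (rule maximal_singletonI[OF d(5)])
      fix l assume l: "l \<in> A - {k}"
      have t: "0 < \<theta> - \<theta>'" "\<theta> - \<theta>' \<le> 2 * \<delta>" using False that d by auto
      have "gap l k (\<theta> - (\<theta> - \<theta>')) \<le> - \<kappa> * (\<theta> - \<theta>')"
        using crit(1) l t unfolding crit_def by blast
      moreover have "\<kappa> * (\<theta> - \<theta>') > 0" using d t by simp
      ultimately show "gap l k \<theta>' < 0" by simp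
    qed
    thus ?thesis by blast
  qed
  moreover have "\<forall>c\<ge>c\<^sub>0. strip_asymptotics j k \<theta> c"
    using strip_asymptotics_if_crit[OF crit(1) B_def] by (simp add: c\<^sub>0_def)
  ultimately have "controlled \<theta> \<delta> c\<^sub>0" unfolding controlled_def using d crit(3) by blast
  thus ?thesis by blast
qed


text \<open>Compactness of [0, 2 pi] and periodicity reduce all thresholds to finitely many. An
  angle with several maximal indices is congruent modulo 2 pi to a centre of the finite cover, since
  every other angle in a controlled interval has only one.\<close>

lemma uniform_control:
  obtains c\<^sub>0 where "c\<^sub>0 > 0"
    "\<And>c. c \<ge> c\<^sub>0 \<Longrightarrow> \<exists>\<Theta> \<delta>. finite \<Theta> \<and> (\<forall>\<theta>\<in>\<Theta>. sparse_near \<theta> (\<delta> \<theta>) c) \<and> {0..2 * pi} \<subseteq> (\<Union>\<theta>\<in>\<Theta>. ball \<theta> (\<delta> \<theta>))"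
    "\<And>c \<theta>. c \<ge> c\<^sub>0 \<Longrightarrow> (\<exists>j. maximal \<theta> = {j}) \<or> (\<exists>j k. extremal_pair \<theta> j k \<and> strip_asymptotics j k \<theta> c)"
proof -
  obtain \<delta> c' where ctrl: "\<And>\<theta>. controlled \<theta> (\<delta> \<theta>) (c' \<theta>)" using exists_controlled by metis
  have "\<delta> \<theta> > 0" for \<theta> using ctrl[of \<theta>] by (simp add: controlled_def)
  hence "\<theta> \<in> ball \<theta> (\<delta> \<theta>)" for \<theta> by simp
  hence "{0..2 * pi} \<subseteq> (\<Union>\<theta>\<in>UNIV. ball \<theta> (\<delta> \<theta>))" by blast
  then obtain \<Theta> where \<Theta>: "finite \<Theta>" "{0..2 * pi} \<subseteq> (\<Union>\<theta>\<in>\<Theta>. ball \<theta> (\<delta> \<theta>))"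
    using compactE_image[of "{0..2 * pi}" UNIV "\<lambda>\<theta>. ball \<theta> (\<delta> \<theta>)"] by auto
  define c\<^sub>0 where "c\<^sub>0 = Max (insert 1 (c' ` \<Theta>))"
  have c0: "c\<^sub>0 \<ge> 1" "\<And>\<theta>. \<theta> \<in> \<Theta> \<Longrightarrow> c\<^sub>0 \<ge> c' \<theta>" unfolding c\<^sub>0_def using \<Theta>(1) by (auto intro: Max_ge)
  show ?thesis
  proof (rule that[of c\<^sub>0])
    show "c\<^sub>0 > 0" using c0 by simp
    show "\<exists>\<Theta> \<delta>. finite \<Theta> \<and> (\<forall>\<theta>\<in>\<Theta>. sparse_near \<theta> (\<delta> \<theta>) c) \<and> {0..2 * pi} \<subseteq> (\<Union>\<theta>\<in>\<Theta>. ball \<theta> (\<delta> \<theta>))"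
      if "c \<ge> c\<^sub>0" for c
    proof (intro exI[of _ \<Theta>] exI[of _ \<delta>] conjI \<Theta> ballI)
      fix \<theta> assume "\<theta> \<in> \<Theta>"
      hence "c \<ge> c' \<theta>" using c0(2)[of \<theta>] that by simp
      thus "sparse_near \<theta> (\<delta> \<theta>) c" using ctrl[of \<theta>] by (simp add: controlled_def)
    qed
  next
    fix c \<theta> :: real assume c: "c \<ge> c\<^sub>0"
    define n where "n = \<lfloor>\<theta> / (2 * pi)\<rfloor>"
    define \<theta>' where "\<theta>' = \<theta> - 2 * pi * of_int n"
    have \<theta>_eq: "\<theta> = \<theta>' + 2 * pi * of_int n" by (simp add: \<theta>'_def)
    have "of_int n \<le> \<theta> / (2 * pi)" "\<theta> / (2 * pi) \<le> of_int n + 1" unfolding n_def by linarith+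
    hence "\<theta>' \<in> {0..2 * pi}" by (simp add: \<theta>'_def field_simps)
    then obtain \<theta>c where \<theta>c: "\<theta>c \<in> \<Theta>" "\<bar>\<theta>' - \<theta>c\<bar> < \<delta> \<theta>c" using \<Theta>(2) by (auto simp: dist_real_def abs_minus_commute)
    have m: "maximal \<theta> = maximal \<theta>'" unfolding \<theta>_eq by (rule maximal_periodic)
    have ci: "cis (real q * \<theta>) = cis (real q * \<theta>')" unfolding \<theta>_eq by (rule cis_q_periodic)
    have ep: "extremal_pair \<theta> j k = extremal_pair \<theta>' j k" for j k
      by (simp only: extremal_pair_def m ci)
    have sa: "strip_asymptotics j k \<theta> c = strip_asymptotics j k \<theta>' c" for j k
      unfolding strip_asymptotics_def \<theta>_eq log_strip_periodic ..
    show "(\<exists>j. maximal \<theta> = {j}) \<or> (\<exists>j k. extremal_pair \<theta> j k \<and> strip_asymptotics j k \<theta> c)"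
    proof (cases "\<theta>' = \<theta>c")
      case True
      have cc: "c \<ge> c' \<theta>c" using c0(2)[OF \<theta>c(1)] c by simp
      show ?thesis unfolding m ep sa True using ctrl[of \<theta>c] cc unfolding controlled_def by blast
    next
      case False
      thus ?thesis unfolding m using ctrl[of \<theta>c] \<theta>c(2) unfolding controlled_def by blast
    qed
  qed
qed

text \<open>Each block contributes O(growth X). For q > p the blocks sum geometrically to r^(q - p);
  for q = p each contributes O(1) and their number gives log r.\<close>

lemma outside_strips_bound:
  assumes fin: "finite \<Theta>" and sp: "\<And>\<theta>. \<theta> \<in> \<Theta> \<Longrightarrow> sparse_near \<theta> (\<delta> \<theta>) c"
    and cov: "{0..2 * pi} \<subseteq> (\<Union>\<theta>\<in>\<Theta>. ball \<theta> (\<delta> \<theta>))" and fnz: "\<exists>z. f z \<noteq> 0"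
  shows "\<exists>C' R. \<forall>r\<ge>R. real_of_int (zero_count f ({z. norm z \<le> r} - strips c)) \<le> C' * (r ^ (q - p) + ln r)"
proof -
  obtain x where x: "\<And>\<theta>. \<theta> \<in> \<Theta> \<Longrightarrow> x \<theta> \<ge> X0"
    and S: "\<And>\<theta> X. \<theta> \<in> \<Theta> \<Longrightarrow> X \<ge> x \<theta> \<Longrightarrow> \<exists>S. sparse_cover \<theta> (\<delta> \<theta>) c X S"
    using bchoice[of \<Theta> "\<lambda>\<theta> X1. X1 \<ge> X0 \<and> (\<forall>X\<ge>X1. \<exists>S. sparse_cover \<theta> (\<delta> \<theta>) c X S)"] sp
    unfolding sparse_near_def by blast
  define Xm where "Xm = Max (insert X0 (x ` \<Theta>))"
  have Xm: "Xm \<ge> X0" "\<And>\<theta>. \<theta> \<in> \<Theta> \<Longrightarrow> Xm \<ge> x \<theta>" unfolding Xm_def using fin by (auto intro: Max_ge)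
  have Xm1: "Xm \<ge> 1" using Xm X0 by simp
  define T where "T X = {z. norm z \<le> exp X} - strips c" for X
  define n where "n X = real_of_int (zero_count f (T X))" for X
  have bT: "bounded (T X)" for X
    by (rule bounded_subset[OF bounded_cball[of 0 "exp X"]]) (auto simp: T_def)
  define Cb where "Cb = real (card \<Theta>) * (8 * C2)"
  have Cb: "Cb \<ge> 0" using C2_pos by (simp add: Cb_def)
  have step: "n (X + 1) \<le> n X + Cb * growth X" if X: "X \<ge> Xm" for X
  proof -
    have "\<forall>\<theta>\<in>\<Theta>. \<exists>S. sparse_cover \<theta> (\<delta> \<theta>) c X S"
      using S Xm(2) X by (meson order.trans)
    from bchoice[OF this] obtain S where "\<And>\<theta>. \<theta> \<in> \<Theta> \<Longrightarrow> sparse_cover \<theta> (\<delta> \<theta>) c X (S \<theta>)" by blast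
    hence S: "\<And>\<theta>. \<theta> \<in> \<Theta> \<Longrightarrow> bounded (S \<theta>)" "\<And>\<theta>. \<theta> \<in> \<Theta> \<Longrightarrow> inj_on exp (S \<theta>)"
      "\<And>\<theta>. \<theta> \<in> \<Theta> \<Longrightarrow> real_of_int (zero_count g (S \<theta>)) \<le> 8 * C2 * growth X"
      "\<And>\<theta> s. \<theta> \<in> \<Theta> \<Longrightarrow> X \<le> Re s \<Longrightarrow> Re s \<le> X + 1 \<Longrightarrow> \<bar>Im s - \<theta>\<bar> < \<delta> \<theta> \<Longrightarrow> exp s \<notin> strips c \<Longrightarrow> s \<in> S \<theta>"
      by (auto simp: sparse_cover_def)
    have bS: "bounded (exp ` S \<theta>)" if \<theta>: "\<theta> \<in> \<Theta>" for \<theta>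
    proof -
      obtain b where b: "\<And>s. s \<in> S \<theta> \<Longrightarrow> norm s \<le> b" using S(1)[OF \<theta>] by (auto simp: bounded_iff)
      have "norm (exp s) \<le> exp b" if "s \<in> S \<theta>" for s
        using b[OF that] norm_exp[of s] by (meson exp_le_cancel_iff order.trans)
      thus ?thesis by (auto simp: bounded_iff)
    qed
    have "zero_count f (T (X + 1)) \<le> zero_count f (T X \<union> (\<Union>\<theta>\<in>\<Theta>. exp ` S \<theta>))"
    proof (rule zero_count_mono[OF f_entire fnz])
      show "bounded (T X \<union> (\<Union>\<theta>\<in>\<Theta>. exp ` S \<theta>))" using bT bS fin by auto
      fix z assume z: "z \<in> T (X + 1)"
      show "z \<in> T X \<union> (\<Union>\<theta>\<in>\<Theta>. exp ` S \<theta>)"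
      proof (cases "norm z \<le> exp X")
        case True
        thus ?thesis using z by (auto simp: T_def)
      next
        case False
        hence nz: "norm z > exp X" by simp
        hence z0: "norm z > 0" using exp_gt_zero[of X] by linarith
        \<comment> \<open>The logarithm with argument in [0, 2 pi), the range covered by the
          finitely many sectors.\<close>
        define s where "s = Complex (ln (norm z)) (Arg2pi z)"
        have es: "exp s = z"
        proof -
          have "z = of_real (norm z) * cis (Arg2pi z)" unfolding cis_conv_exp by (rule Arg2pi_eq)
          moreover have "exp s = of_real (norm z) * cis (Arg2pi z)" using z0 by (simp add: s_def exp_eq_polar)
          ultimately show ?thesis by simp
        qed
        have "X \<le> Re s" using nz z0 by (simp add: s_def ln_ge_iff)
        moreover have "Re s \<le> X + 1"
        proof -
          have "norm z \<le> exp (X + 1)" using z by (simp add: T_def)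
          hence "ln (norm z) \<le> ln (exp (X + 1))" using z0 by (subst ln_le_cancel_iff) auto
          thus ?thesis by (simp add: s_def)
        qed
        moreover have "Im s \<in> {0..2 * pi}" using Arg2pi_ge_0[of z] Arg2pi_lt_2pi[of z] by (simp add: s_def)
        then obtain \<theta> where "\<theta> \<in> \<Theta>" "\<bar>Im s - \<theta>\<bar> < \<delta> \<theta>" using cov by (auto simp: dist_real_def abs_minus_commute)
        moreover have "exp s \<notin> strips c" using z by (simp add: es T_def)
        ultimately have "s \<in> S \<theta>" using S(4) by blast
        thus ?thesis using es \<open>\<theta> \<in> \<Theta>\<close> by blast
      qed
    qed
    also have "\<dots> \<le> zero_count f (T X) + zero_count f (\<Union>\<theta>\<in>\<Theta>. exp ` S \<theta>)"
      using bT bS fin by (intro zero_count_Un_le[OF f_entire fnz]) auto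
    also have "zero_count f (\<Union>\<theta>\<in>\<Theta>. exp ` S \<theta>) \<le> (\<Sum>\<theta>\<in>\<Theta>. zero_count f (exp ` S \<theta>))"
      using bS by (intro zero_count_UN_le[OF f_entire fnz fin]) auto
    also have "(\<Sum>\<theta>\<in>\<Theta>. zero_count f (exp ` S \<theta>)) = (\<Sum>\<theta>\<in>\<Theta>. zero_count g (S \<theta>))"
      unfolding g_def[abs_def] using S(2) by (intro sum.cong refl zero_count_exp_image[OF f_entire fnz]) auto
    finally have "n (X + 1) \<le> n X + (\<Sum>\<theta>\<in>\<Theta>. real_of_int (zero_count g (S \<theta>)))"
      unfolding n_def by (simp flip: of_int_sum of_int_add)
    also have "(\<Sum>\<theta>\<in>\<Theta>. real_of_int (zero_count g (S \<theta>))) \<le> (\<Sum>\<theta>\<in>\<Theta>. 8 * C2 * growth X)"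
      by (rule sum_mono) (rule S(3))
    finally show ?thesis by (simp add: Cb_def)
  qed
  define Q where "Q = n (Xm + 1)"
  have Q0: "Q \<ge> 0" using zero_count_nonneg[OF f_entire fnz] by (simp add: Q_def n_def)
  have base: "n X \<le> Q" if "X \<le> Xm + 1" for X
  proof -
    have "exp X \<le> exp (Xm + 1)" using that by simp
    thus ?thesis unfolding n_def Q_def of_int_le_iff
      by (intro zero_count_mono[OF f_entire fnz bT]) (auto simp: T_def intro: order.trans[OF _ \<open>exp X \<le> exp (Xm + 1)\<close>])
  qed
  \<comment> \<open>For q > p, \<open>growth\<close> at least doubles per step because exp (q - p)
    \<ge> 2, so the sum is below the next term. For q = p the sum is exactly k.\<close>
  have geo: "(\<Sum>i<k. growth (X + real i)) \<le> growth (X + real k) + real k" for X k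
  proof (cases "q = p")
    case True
    hence eq0: "q - p = 0" by simp
    have "growth Y = 1" for Y unfolding growth_def eq0 by simp
    thus ?thesis by simp
  next
    case False
    have double: "2 * growth Y \<le> growth (Y + 1)" for Y
    proof -
      have "real (q - p) \<ge> 1" using False pq by simp
      hence "exp (real (q - p)) \<ge> 2" using exp_ge_add_one_self[of "real (q - p)"] by linarith
      hence "2 * growth Y \<le> exp (real (q - p)) * growth Y" by (intro mult_right_mono) (auto simp: growth_def)
      thus ?thesis by (simp add: growth_def exp_add[symmetric] algebra_simps)
    qed
    have "(\<Sum>i<k. growth (X + real i)) \<le> growth (X + real k)"
    proof (induction k)
      case 0
      show ?case by (simp add: growth_def)
    next
      case (Suc k)
      thus ?case using double[of "X + real k"] by (simp add: algebra_simps)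
    qed
    thus ?thesis by simp
  qed
  have bound: "n Y \<le> (Q + Cb) * (growth Y + Y)" if Y: "Y \<ge> Xm" for Y
  proof -
    obtain k :: nat and X where kX: "Xm \<le> X" "X \<le> Xm + 1" "Y = X + real k" "n Y \<le> Q + (\<Sum>i<k. Cb * growth (X + real i))"
      using unit_step_telescope[of Xm n "\<lambda>X. Cb * growth X" Q Y] step base Y by blast
    have "(\<Sum>i<k. Cb * growth (X + real i)) \<le> Cb * (growth Y + real k)"
      unfolding sum_distrib_left[symmetric] using geo[of X k] Cb kX(3) by (intro mult_left_mono) auto
    also have "\<dots> \<le> Cb * (growth Y + Y)" using Cb kX Xm1 by (intro mult_left_mono) auto
    finally have "n Y \<le> Q * 1 + Cb * (growth Y + Y)" using kX(4) by linarith
    also have "Q * 1 \<le> Q * (growth Y + Y)" using Q0 Y Xm1 growth_ge1[of Y] by (intro mult_left_mono) auto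
    finally show ?thesis by (simp add: algebra_simps)
  qed
  show ?thesis
  proof (rule exI[of _ "Q + Cb"], rule exI[of _ "exp Xm"], intro allI impI)
    fix r :: real assume r: "r \<ge> exp Xm"
    have rpos: "r > 0" using r exp_gt_zero[of Xm] by linarith
    have lnr: "ln r \<ge> Xm" using r rpos by (simp add: ln_ge_iff)
    show "real_of_int (zero_count f ({z. norm z \<le> r} - strips c)) \<le> (Q + Cb) * (r ^ (q - p) + ln r)"
      using bound[OF lnr] rpos by (simp add: n_def T_def growth_ln)
  qed
qed

section \<open>Vertices of the convex hull and the final estimates\<close>

lemma f_not_zero: "\<exists>z. f z \<noteq> 0"
proof -
  have "\<exists>s. g s \<noteq> 0"
  proof (cases rule: local_structure[of 0])
    case (noncrit j \<delta> \<kappa>)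
    thus ?thesis by (rule noncrit_count) blast
  next
    case (crit j k \<delta> \<kappa>)
    show ?thesis by (rule strip_count[OF crit(1) refl order.refl]) blast
  qed
  thus ?thesis by (rule f_nonzero)
qed

text \<open>The conjugate coefficients of all maximal indices lie on one line, ordered by the
  rotated imaginary part. One strictly between the ends lies in an open segment of the hull and so
  cannot be an extreme point.\<close>

lemma vertex_in_extremes:
  assumes a: "a \<in> maximal \<theta>" and ext: "cnj (w a) extreme_point_of (convex hull (conj_coeffs m w H))"
    and ep: "extremal_pair \<theta> j k"
  shows "a = j \<or> a = k"
proof (rule ccontr)
  have j: "j \<in> maximal \<theta>" and k: "k \<in> maximal \<theta>"
    and le: "Im (w j * cis (real q * \<theta>)) \<le> Im (w a * cis (real q * \<theta>))"
      "Im (w a * cis (real q * \<theta>)) \<le> Im (w k * cis (real q * \<theta>))"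
    using ep a by (auto simp: extremal_pair_def)
  assume "\<not> ?thesis"
  hence neq: "a \<noteq> j" "a \<noteq> k" by auto
  define u where "u = cis (real q * \<theta>)"
  define v where "v l = Im (w l * u)" for l
  have lt: "v j < v a" "v a < v k"
    using le maximal_Im_inj[OF a j] maximal_Im_inj[OF a k] neq unfolding v_def u_def by force+
  \<comment> \<open>Barycentric coordinate of the intermediate point between the two ends.\<close>
  define t where "t = (v a - v j) / (v k - v j)"
  have t: "0 < t" "t < 1" using lt by (auto simp: t_def field_simps)
  have "(w a - w j) * u = of_real t * ((w k - w j) * u)"
  proof (rule complex_eqI)
    have "Re ((w a - w j) * u) = 0" "Re ((w k - w j) * u) = 0"
      using maximal_same_Re[OF j a] maximal_same_Re[OF j k] by (simp_all add: u_def)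
    thus "Re ((w a - w j) * u) = Re (of_real t * ((w k - w j) * u))" by (simp only: Re_complex_of_real times_complex.sel(1)[of "of_real t"] Im_complex_of_real mult_zero_left mult_zero_right diff_zero)
    have "Im ((w a - w j) * u) = v a - v j" "Im ((w k - w j) * u) = v k - v j"
      by (simp_all only: v_def left_diff_distrib minus_complex.sel)
    thus "Im ((w a - w j) * u) = Im (of_real t * ((w k - w j) * u))"
      using lt by (simp only: times_complex.sel(2)[of "of_real t"] Re_complex_of_real Im_complex_of_real) (simp add: t_def)
  qed
  hence "((w a - w j) - of_real t * (w k - w j)) * u = 0" by (simp add: algebra_simps)
  hence "(w a - w j) - of_real t * (w k - w j) = 0" by (simp add: u_def)
  hence wa: "w a = (1 - of_real t) * w j + of_real t * w k" by (simp add: algebra_simps)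
  have "w j \<noteq> w k" using lt by (auto simp: v_def)
  moreover have "cnj (w a) = (1 - t) *\<^sub>R cnj (w j) + t *\<^sub>R cnj (w k)"
    unfolding wa by (simp add: scaleR_conv_of_real)
  ultimately have "cnj (w a) \<in> open_segment (cnj (w j)) (cnj (w k))"
    using t unfolding in_segment by auto
  moreover have "cnj (w j) \<in> convex hull (conj_coeffs m w H)" "cnj (w k) \<in> convex hull (conj_coeffs m w H)"
    using j k by (auto intro!: hull_inc simp: conj_coeffs_def maximal_def)
  ultimately show False using ext unfolding extreme_point_of_def by blast
qed

text \<open>For the second estimate, the side of the hull has to be matched with the extremal pair
  found analytically. The outer normal makes j and k maximal at \<theta>; as distinct vertices they
  must be the two ends of the face, so the pair agrees up to order and |w j - w k| is the
  same.\<close>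

lemma main_estimates:
  shows "\<exists>c\<^sub>0>0. \<forall>c\<ge>c\<^sub>0.
      (\<lambda>r. real_of_int (zero_count f ({z. norm z \<le> r} - strips c))) \<in> O(\<lambda>r. r ^ (q - p) + ln r) \<and>
      (\<forall>j k \<theta>\<^sub>0 \<theta> (n::int) \<epsilon>.
         j \<le> m \<longrightarrow> k \<le> m \<longrightarrow>
         consecutive_vertices (convex hull (conj_coeffs m w H)) (cnj (w j)) (cnj (w k)) \<longrightarrow>
         outer_normal_arg (convex hull (conj_coeffs m w H)) (cnj (w j)) (cnj (w k)) \<theta>\<^sub>0 \<longrightarrow>
         \<theta> = (\<theta>\<^sub>0 + 2 * pi * of_int n) / real q \<longrightarrow>
         \<epsilon> > 0 \<longrightarrow>
         (\<lambda>r. real_of_int (zero_count f (log_strip p \<theta> c \<inter> {z. norm z < r}))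
               - norm (w j - w k) * (r ^ q / (2 * pi)))
           \<in> O(\<lambda>r. r ^ (q - p) * ln r powr (3 + \<epsilon>)))"
proof -
  obtain c\<^sub>0 where c0: "c\<^sub>0 > 0"
    and c1: "\<And>c. c \<ge> c\<^sub>0 \<Longrightarrow> \<exists>\<Theta> \<delta>. finite \<Theta> \<and> (\<forall>\<theta>\<in>\<Theta>. sparse_near \<theta> (\<delta> \<theta>) c) \<and> {0..2 * pi} \<subseteq> (\<Union>\<theta>\<in>\<Theta>. ball \<theta> (\<delta> \<theta>))"
    and c2: "\<And>c \<theta>. c \<ge> c\<^sub>0 \<Longrightarrow> (\<exists>j. maximal \<theta> = {j}) \<or> (\<exists>j k. extremal_pair \<theta> j k \<and> strip_asymptotics j k \<theta> c)"
    by (rule uniform_control) blast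
  show ?thesis
  proof (rule exI[of _ c\<^sub>0], intro conjI c0 allI impI)
    fix c assume c: "c \<ge> c\<^sub>0"
    obtain \<Theta> \<delta> where \<Theta>: "finite \<Theta>" "\<And>\<theta>. \<theta> \<in> \<Theta> \<Longrightarrow> sparse_near \<theta> (\<delta> \<theta>) c" "{0..2 * pi} \<subseteq> (\<Union>\<theta>\<in>\<Theta>. ball \<theta> (\<delta> \<theta>))"
      using c1[OF c] by blast
    obtain C' R where R: "\<And>r. r \<ge> R \<Longrightarrow> real_of_int (zero_count f ({z. norm z \<le> r} - strips c)) \<le> C' * (r ^ (q - p) + ln r)"
      using outside_strips_bound[OF \<Theta> f_not_zero] by blast
    show "(\<lambda>r. real_of_int (zero_count f ({z. norm z \<le> r} - strips c))) \<in> O(\<lambda>r. r ^ (q - p) + ln r)"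
    proof (rule bigoI[where c = C'])
      show "\<forall>\<^sub>F r in at_top. norm (real_of_int (zero_count f ({z. norm z \<le> r} - strips c))) \<le> C' * norm (r ^ (q - p) + ln r)"
        using eventually_ge_at_top[of "max R 1"]
      proof eventually_elim
        case (elim r)
        have "norm (r ^ (q - p) + ln r) = r ^ (q - p) + ln r" using elim by simp
        thus ?case using R[of r] elim zero_count_nonneg[OF f_entire f_not_zero] by simp
      qed
    qed
  next
    fix c j k \<theta>\<^sub>0 \<theta> n and \<epsilon> :: real
    assume c: "c \<ge> c\<^sub>0" and jk: "j \<le> m" "k \<le> m"
      and cv: "consecutive_vertices (convex hull (conj_coeffs m w H)) (cnj (w j)) (cnj (w k))"
      and on: "outer_normal_arg (convex hull (conj_coeffs m w H)) (cnj (w j)) (cnj (w k)) \<theta>\<^sub>0"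
      and \<theta>: "\<theta> = (\<theta>\<^sub>0 + 2 * pi * of_int n) / real q" and \<epsilon>: "\<epsilon> > 0"
    define Kh where "Kh = convex hull (conj_coeffs m w H)"
    have ext: "cnj (w j) extreme_point_of Kh" "cnj (w k) extreme_point_of Kh"
      and edge: "closed_segment (cnj (w j)) (cnj (w k)) edge_of Kh"
      using cv by (auto simp: consecutive_vertices_def Kh_def)
    have inA: "i \<in> A" if "i \<le> m" "cnj (w i) extreme_point_of Kh" for i
    proof -
      have "cnj (w i) \<in> conj_coeffs m w H" using that(2) extreme_point_of_convex_hull unfolding Kh_def by blast
      then obtain l where l: "l \<in> A" "w l = w i" by (auto simp: conj_coeffs_def)
      hence "l = i" using w_inj A_le[OF l(1)] that(1) by (auto simp: inj_on_def)
      thus ?thesis using l by simp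
    qed
    have jA: "j \<in> A" and kA: "k \<in> A" using inA jk ext by auto
    \<comment> \<open>An edge has affine dimension 1, hence cannot be a single point.\<close>
    have neq: "j \<noteq> k"
    proof
      assume "j = k"
      hence "aff_dim {cnj (w k)} = 1" using edge by (simp add: edge_of_def)
      thus False by simp
    qed
    have u: "cis (real q * \<theta>) = cis \<theta>\<^sub>0"
    proof -
      have "real q * \<theta> = \<theta>\<^sub>0 + 2 * pi * of_int n" using q by (simp add: \<theta>)
      thus ?thesis by (simp add: cis_mult[symmetric] cis_multiple_2pi)
    qed
    \<comment> \<open>This identity is why W_f consists of conjugates: the real inner product of cnj
      a with b is Re (a b).\<close>
    have inner: "(cnj (w l) - cnj (w i)) \<bullet> cis \<theta>\<^sub>0 = gap l i \<theta>" for l i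
      unfolding gap_def u by (simp add: inner_complex_def algebra_simps)
    have "gap l j \<theta> \<le> 0" if "l \<in> A" for l
    proof -
      have "cnj (w l) \<in> Kh" unfolding Kh_def using that by (intro hull_inc) (auto simp: conj_coeffs_def)
      thus ?thesis using on unfolding outer_normal_arg_def Kh_def[symmetric] inner[symmetric] by blast
    qed
    hence jm: "j \<in> maximal \<theta>" using jA by (simp add: maximal_def)
    have "gap k j \<theta> = 0" using on unfolding outer_normal_arg_def inner by blast
    hence "gap l k \<theta> = gap l j \<theta>" for l by (simp add: gap_def left_diff_distrib)
    hence km: "k \<in> maximal \<theta>" using jm kA by (simp add: maximal_def)
    have "\<nexists>i. maximal \<theta> = {i}" using jm km neq by (metis singletonD)
    then obtain a b where ab: "extremal_pair \<theta> a b" "strip_asymptotics a b \<theta> c" using c2[OF c, of \<theta>] by blast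
    have "j = a \<or> j = b" "k = a \<or> k = b"
      using vertex_in_extremes[OF jm _ ab(1)] vertex_in_extremes[OF km _ ab(1)] ext unfolding Kh_def by auto
    hence N: "norm (w j - w k) = norm (w a - w b)" using neq by (auto simp: norm_minus_commute)
    obtain C' R where R: "\<And>r. r \<ge> R \<Longrightarrow>
      \<bar>real_of_int (zero_count f (log_strip p \<theta> c \<inter> {z. norm z < r})) - norm (w j - w k) * (r ^ q / (2 * pi))\<bar>
       \<le> C' * (r ^ (q - p) * (ln r)\<^sup>2)"
      using ab(2) unfolding strip_asymptotics_def N by blast
    show "(\<lambda>r. real_of_int (zero_count f (log_strip p \<theta> c \<inter> {z. norm z < r})) - norm (w j - w k) * (r ^ q / (2 * pi)))
           \<in> O(\<lambda>r. r ^ (q - p) * ln r powr (3 + \<epsilon>))"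
    proof (rule bigoI[where c = "\<bar>C'\<bar>"])
      show "\<forall>\<^sub>F r in at_top. norm (real_of_int (zero_count f (log_strip p \<theta> c \<inter> {z. norm z < r})) - norm (w j - w k) * (r ^ q / (2 * pi)))
         \<le> \<bar>C'\<bar> * norm (r ^ (q - p) * ln r powr (3 + \<epsilon>))"
        using eventually_ge_at_top[of "max R (exp 1)"]
      proof eventually_elim
        case (elim r)
        have r1: "r \<ge> exp 1" "r \<ge> R" using elim by auto
        moreover have "r > 0" using r1(1) exp_gt_zero[of "1::real"] by linarith
        ultimately have r1: "r \<ge> exp 1" "r \<ge> R" "r > 0" by auto
        hence l1: "ln r \<ge> 1" by (simp add: ln_ge_iff)
        \<comment> \<open>The proved error carries the square of the logarithm; since ln r \<ge> 1,
          the exponent may be raised to 3 + \<epsilon>.\<close>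
        have "(ln r)\<^sup>2 = ln r powr 2" using l1 by (simp add: powr_numeral)
        also have "\<dots> \<le> ln r powr (3 + \<epsilon>)" using l1 \<epsilon> by (intro powr_mono) auto
        finally have "r ^ (q - p) * (ln r)\<^sup>2 \<le> r ^ (q - p) * ln r powr (3 + \<epsilon>)"
          using r1 by (intro mult_left_mono) auto
        hence "\<bar>C'\<bar> * (r ^ (q - p) * (ln r)\<^sup>2) \<le> \<bar>C'\<bar> * (r ^ (q - p) * ln r powr (3 + \<epsilon>))" by (rule mult_left_mono) simp
        moreover have "C' * (r ^ (q - p) * (ln r)\<^sup>2) \<le> \<bar>C'\<bar> * (r ^ (q - p) * (ln r)\<^sup>2)"
          using r1 by (intro mult_right_mono) auto
        moreover have "norm (r ^ (q - p) * ln r powr (3 + \<epsilon>)) = r ^ (q - p) * ln r powr (3 + \<epsilon>)" using r1 by simp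
        ultimately show ?case using R[OF r1(2)] by simp
      qed
    qed
  qed
qed

end

theorem theorem2p1:
  fixes q p m :: nat and w :: "nat \<Rightarrow> complex"
    and H :: "nat \<Rightarrow> complex \<Rightarrow> complex" and f :: "complex \<Rightarrow> complex"
  assumes "1 \<le> q" and "1 \<le> p" and "p \<le> q" and "1 \<le> m"
    and "exp_poly_has_order f q"
    and "w 0 = 0" and "inj_on w {..m}"
    and "\<And>j. j \<le> m \<Longrightarrow> exp_poly_order_le (H j) (q - p)"
    and "\<And>j. 1 \<le> j \<Longrightarrow> j \<le> m \<Longrightarrow> \<exists>z. H j z \<noteq> 0"
    and "\<And>z. f z = (\<Sum>j\<le>m. H j z * exp (w j * z ^ q))"
  shows "\<exists>c\<^sub>0>0. \<forall>c\<ge>c\<^sub>0.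
      (\<lambda>r. real_of_int (zero_count f
          ({z. norm z \<le> r} - (\<Union>\<theta>\<in>{\<theta>. critical_angle q m w H \<theta>}. log_strip p \<theta> c))))
        \<in> O(\<lambda>r. r ^ (q - p) + ln r) \<and>
      (\<forall>j k \<theta>\<^sub>0 \<theta> (n::int) \<epsilon>.
         j \<le> m \<longrightarrow> k \<le> m \<longrightarrow>
         consecutive_vertices (convex hull (conj_coeffs m w H)) (cnj (w j)) (cnj (w k)) \<longrightarrow>
         outer_normal_arg (convex hull (conj_coeffs m w H)) (cnj (w j)) (cnj (w k)) \<theta>\<^sub>0 \<longrightarrow>
         \<theta> = (\<theta>\<^sub>0 + 2 * pi * of_int n) / real q \<longrightarrow>
         \<epsilon> > 0 \<longrightarrow>
         (\<lambda>r. real_of_int (zero_count f (log_strip p \<theta> c \<inter> {z. norm z < r}))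
               - norm (w j - w k) * (r ^ q / (2 * pi)))
           \<in> O(\<lambda>r. r ^ (q - p) * ln r powr (3 + \<epsilon>)))"
proof -
  interpret normalized_sum q p m w H f
    by unfold_locales (use assms in auto)
  obtain C X0 where const: "C > 0" "X0 \<ge> 1"
    "\<And>j X s. j \<in> A \<Longrightarrow> X \<ge> X0 \<Longrightarrow> \<bar>Re s - X\<bar> \<le> 4 \<Longrightarrow> norm (H j (exp s)) \<le> exp (C * (X * growth X))"
    "\<And>j X y. j \<in> A \<Longrightarrow> X \<ge> X0 \<Longrightarrow> log_factored (\<lambda>s. H j (exp s)) (C * growth X) (Complex X y)"
    by (rule uniform_constants) blast
  interpret normalized_sum_constants q p m w H f C X0
    by unfold_locales (use const in auto)
  show ?thesis by (rule main_estimates)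
qed

end
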